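(* Let $E$ be an arbitrary directed graph and let $K$ be any field. (1) The following conditions are equivalent. (i) The algebra $L_K(E)$ is graded simple. (ii) The $\Gamma$-monoid $M_E^\Gamma$ is simple. (iii) The $\Gamma$-group $G_E^\Gamma$ is simple as an ordered $\Gamma$-group. (2) The following conditions are equivalent. (i) The algebra $L_K(E)$ is simple. (ii) The $\Gamma$-monoid $M_E^\Gamma$ is simple and no nonzero element of $M_E^\Gamma$ is periodic. (iii) The $\Gamma$-monoid $M_E^\Gamma$ is simple and every nonzero comparable element of $M_E^\Gamma$ is aperiodic. (3) The following conditions are equivalent. (i) The algebra $L_K(E)$ is purely infinite simple. (ii) The $\Gamma$-monoid $M_E^\Gamma$ is simple, no nonzero element of $M_E^\Gamma$ is periodic and some element of $M_E^\Gamma$ is aperiodic.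
   Context: Setup. $\Gamma=\{x^n\mid n\in\mathbb Z\}$ is the infinite cyclic group generated by $x$. $E$ is an arbitrary directed graph (not necessarily row-finite) with vertex set $E^0$, edge set $E^1$, source map $\mathbf s$ and range map $\mathbf r$. A vertex $v$ is regular if $\mathbf s^{-1}(v)$ is finite and nonempty, and an infinite emitter if $\mathbf s^{-1}(v)$ is infinite. For every infinite emitter $v$ and every finite nonempty $Z\subseteq \mathbf s^{-1}(v)$ introduce a symbol $q_Z=q_Z^v$, called an improper vertex; elements of $E^0$ are called proper vertices. $F_E^\Gamma$ is the free commutative $\Gamma$-monoid on all proper and improper vertices (these are called the generators): its elements are finite formal sums of monomials $x^m g$ ($m\in\mathbb Z$, $g$ a generator), and $x^n$ acts by $x^n(x^m g)=x^{n+m}g$. The relation $\to_1$ on $F_E^\Gamma-\{0\}$ is given, for all $a\in F_E^\Gamma$ and $m\in\mathbb Z$, by: (A1) $a+x^m v\to_1 a+\sum_{e\in \mathbf s^{-1}(v)}x^{m+1}\mathbf r(e)$ for $v$ regular; (A2) $a+x^m v\to_1 a+x^m q_Z+\sum_{e\in Z}x^{m+1}\mathbf r(e)$ for $v$ an infinite emitter and $Z\subseteq \mathbf s^{-1}(v)$ finite and nonempty; (A3) $a+x^m q_Z\to_1 a+x^m q_W+\sum_{e\in W-Z}x^{m+1}\mathbf r(e)$ for $v$ an infinite emitter and finite nonempty $Z\subsetneq W\subseteq \mathbf s^{-1}(v)$. $\sim$ is the congruence on $F_E^\Gamma$ generated by $\to_1$, and $M_E^\Gamma=F_E^\Gamma/\sim$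 is the graph $\Gamma$-monoid. It is cancellative and it is partially ordered by $a\le b$ if and only if $a+c=b$ for some $c\in M_E^\Gamma$. $G_E^\Gamma$ is its Grothendieck group completion with the induced $\Gamma$-action, ordered with positive cone $M_E^\Gamma$. An element $a\in M_E^\Gamma$ is comparable if $a\ge x^n a$, periodic if $a=x^na$, aperiodic if $a>x^na$, in each case for some positive integer $n$. A $\Gamma$-order-ideal of $M_E^\Gamma$ is a submonoid $I$ closed under the action of $\Gamma$ such that $a\le b$ and $b\in I$ imply $a\in I$. A $\Gamma$-order-ideal of $G_E^\Gamma$ is a $\Gamma$-subgroup $J$ such that $J\cap M_E^\Gamma$ is a $\Gamma$-order-ideal of $M_E^\Gamma$ and $J=\{y-z\mid y,z\in J\cap M_E^\Gamma\}$. $M_E^\Gamma$ (respectively $G_E^\Gamma$) is simple if it is nonzero and has no $\Gamma$-order-ideals other than $0$ and itself. $L_K(E)$, the Leavitt path algebra, is the $K$-algebra generated by $E^0\cup E^1\cup\{e^*\mid e\in E^1\}$ subject to: $vw=0$ for distinct vertices and $vv=v$; $\mathbf s(e)e=e\mathbf r(e)=e$; $\mathbf r(e)e^*=e^*\mathbf s(e)=e^*$; $e^*f=0$ for $e\neq f$ and $e^*e=\mathbf r(e)$; $v=\sum_{e\in\mathbf s^{-1}(v)}ee^*$ for $v$ regular. It is $\mathbb Z$-graded by letting $pq^*$ ($p,q$ paths) have degree $|p|-|q|$. It is graded simple if it is nonzero and its only graded two-sided ideals are $0$ and itself. A ring is purely infinite simple if it is simple and every nonzero right ideal contains an infinite idempotent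 (an idempotent $e$ such that $eR$ is isomorphic to a proper direct summand of itself). *)

theory Defs
  imports
    "HOL-Algebra.QuotRing"
    "HOL-Algebra.Module"
    "HOL-Library.Poly_Mapping"
    "HOL-Library.Multiset"
    "Graph_Theory.Arc_Walk"
begin

text \<open>
  A directed graph is a \<^locale>\<open>wf_digraph\<close>: vertices \<^term>\<open>verts E\<close>, edges \<^term>\<open>arcs E\<close>,
  source map \<^term>\<open>tail E\<close>, range map \<^term>\<open>head E\<close>. No finiteness is assumed, parallel edges and
  loops are allowed, and either set may be empty.
\<close>

definition regular_vertex :: "('v, 'e) pre_digraph \<Rightarrow> 'v \<Rightarrow> bool" where
  "regular_vertex E v \<longleftrightarrow> v \<in> verts E \<and> finite (out_arcs E v) \<and> out_arcs E v \<noteq> {}"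

definition infinite_emitter :: "('v, 'e) pre_digraph \<Rightarrow> 'v \<Rightarrow> bool" where
  "infinite_emitter E v \<longleftrightarrow> v \<in> verts E \<and> infinite (out_arcs E v)"


section \<open>\<open>\<Gamma>\<close>-monoids and ordered \<open>\<Gamma>\<close>-groups\<close>

text \<open>
  \<open>\<Gamma>\<close> is infinite cyclic on \<open>x\<close>; the action of \<open>x\<^sup>n\<close> is the field \<open>act\<close> at \<open>n :: int\<close>.
  The commutative monoids below are additive in the mathematics, but use the multiplicative field
  names of \<^typ>\<open>'a monoid\<close>: \<open>\<otimes>\<close> is the sum and \<open>\<one>\<close> is zero.
\<close>

record 'a gamma_monoid = "'a monoid" +
  act :: "int \<Rightarrow> 'a \<Rightarrow> 'a"

record 'a ordered_gamma_group = "'a gamma_monoid" +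
  pos_cone :: "'a set"

definition gm_le :: "('a, 'm) gamma_monoid_scheme \<Rightarrow> 'a \<Rightarrow> 'a \<Rightarrow> bool" where
  "gm_le M a b \<longleftrightarrow> (\<exists>c\<in>carrier M. a \<otimes>\<^bsub>M\<^esub> c = b)"

definition gm_less :: "('a, 'm) gamma_monoid_scheme \<Rightarrow> 'a \<Rightarrow> 'a \<Rightarrow> bool" where
  "gm_less M a b \<longleftrightarrow> gm_le M a b \<and> a \<noteq> b"

definition comparable :: "('a, 'm) gamma_monoid_scheme \<Rightarrow> 'a \<Rightarrow> bool" where
  "comparable M a \<longleftrightarrow> (\<exists>n::nat. n > 0 \<and> gm_le M (act M (int n) a) a)"

definition periodic :: "('a, 'm) gamma_monoid_scheme \<Rightarrow> 'a \<Rightarrow> bool" where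
  "periodic M a \<longleftrightarrow> (\<exists>n::nat. n > 0 \<and> a = act M (int n) a)"

definition aperiodic :: "('a, 'm) gamma_monoid_scheme \<Rightarrow> 'a \<Rightarrow> bool" where
  "aperiodic M a \<longleftrightarrow> (\<exists>n::nat. n > 0 \<and> gm_less M (act M (int n) a) a)"

definition gamma_order_ideal :: "('a, 'm) gamma_monoid_scheme \<Rightarrow> 'a set \<Rightarrow> bool" where
  "gamma_order_ideal M I \<longleftrightarrow>
     submonoid I M \<and>
     (\<forall>n. \<forall>a\<in>I. act M n a \<in> I) \<and>
     (\<forall>a\<in>carrier M. \<forall>b\<in>I. gm_le M a b \<longrightarrow> a \<in> I)"

definition simple_gamma_monoid :: "('a, 'm) gamma_monoid_scheme \<Rightarrow> bool" where
  "simple_gamma_monoid M \<longleftrightarrow>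
     carrier M \<noteq> {\<one>\<^bsub>M\<^esub>} \<and>
     (\<forall>I. gamma_order_ideal M I \<longrightarrow> I = {\<one>\<^bsub>M\<^esub>} \<or> I = carrier M)"

text \<open>
  The positive cone is itself a \<open>\<Gamma>\<close>-monoid, with the operations of the group restricted to it; in
  particular its order is \<open>a \<le> b \<longleftrightarrow> b - a \<in> pos_cone G\<close>.
\<close>

definition group_order_ideal :: "('a, 'm) ordered_gamma_group_scheme \<Rightarrow> 'a set \<Rightarrow> bool" where
  "group_order_ideal G J \<longleftrightarrow>
     subgroup J G \<and>
     (\<forall>n. \<forall>a\<in>J. act G n a \<in> J) \<and>
     gamma_order_ideal (G\<lparr>carrier := pos_cone G\<rparr>) (J \<inter> pos_cone G) \<and>
     J = {y \<otimes>\<^bsub>G\<^esub> inv\<^bsub>G\<^esub> z |y z. y \<in> J \<inter> pos_cone G \<and> z \<in> J \<inter> pos_cone G}"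

definition simple_ordered_gamma_group :: "('a, 'm) ordered_gamma_group_scheme \<Rightarrow> bool" where
  "simple_ordered_gamma_group G \<longleftrightarrow>
     carrier G \<noteq> {\<one>\<^bsub>G\<^esub>} \<and>
     (\<forall>J. group_order_ideal G J \<longrightarrow> J = {\<one>\<^bsub>G\<^esub>} \<or> J = carrier G)"

text \<open>
  Grothendieck completion: the pair \<open>(a, b)\<close> represents \<open>a - b\<close>. The positive cone is the image of
  the monoid, which is a copy of the monoid when the latter is cancellative.
\<close>

definition groth_rel :: "('a, 'm) gamma_monoid_scheme \<Rightarrow> (('a \<times> 'a) \<times> ('a \<times> 'a)) set" where
  "groth_rel M = {((a, b), (c, d)) |a b c d.
     a \<in> carrier M \<and> b \<in> carrier M \<and> c \<in> carrier M \<and> d \<in> carrier M \<and>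
     (\<exists>k\<in>carrier M. (a \<otimes>\<^bsub>M\<^esub> d) \<otimes>\<^bsub>M\<^esub> k = (c \<otimes>\<^bsub>M\<^esub> b) \<otimes>\<^bsub>M\<^esub> k)}"

definition grothendieck_group ::
  "('a, 'm) gamma_monoid_scheme \<Rightarrow> ('a \<times> 'a) set ordered_gamma_group" where
  "grothendieck_group M =
     \<lparr>carrier = (carrier M \<times> carrier M) // groth_rel M,
      monoid.mult = (\<lambda>A B. \<Union>(a, b)\<in>A. \<Union>(c, d)\<in>B. groth_rel M `` {(a \<otimes>\<^bsub>M\<^esub> c, b \<otimes>\<^bsub>M\<^esub> d)}),
      one = groth_rel M `` {(\<one>\<^bsub>M\<^esub>, \<one>\<^bsub>M\<^esub>)},
      act = (\<lambda>n A. \<Union>(a, b)\<in>A. groth_rel M `` {(act M n a, act M n b)}),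
      pos_cone = (\<lambda>a. groth_rel M `` {(a, \<one>\<^bsub>M\<^esub>)}) ` carrier M\<rparr>"


section \<open>The graph \<open>\<Gamma>\<close>-monoid\<close>

text \<open>\<open>Improper v Z\<close> is the improper vertex \<open>q\<^sub>Z\<close> of the infinite emitter \<open>v\<close>.\<close>

datatype ('v, 'e) gen = Proper 'v | Improper 'v "'e set"

definition gens :: "('v, 'e) pre_digraph \<Rightarrow> ('v, 'e) gen set" where
  "gens E = Proper ` verts E \<union>
     {Improper v Z |v Z. infinite_emitter E v \<and> finite Z \<and> Z \<noteq> {} \<and> Z \<subseteq> out_arcs E v}"

text \<open>
  A formal sum of monomials is a multiset of pairs \<open>(m, g)\<close>, standing for \<open>x\<^sup>m g\<close>.
\<close>

type_synonym ('v, 'e) formal_sum = "(int \<times> ('v, 'e) gen) multiset"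

definition free_gamma :: "('v, 'e) pre_digraph \<Rightarrow> ('v, 'e) formal_sum set" where
  "free_gamma E = {a. set_mset a \<subseteq> UNIV \<times> gens E}"

definition shift :: "int \<Rightarrow> ('v, 'e) formal_sum \<Rightarrow> ('v, 'e) formal_sum" where
  "shift n a = image_mset (\<lambda>(m, g). (n + m, g)) a"

definition range_sum :: "('v, 'e) pre_digraph \<Rightarrow> int \<Rightarrow> 'e set \<Rightarrow> ('v, 'e) formal_sum" where
  "range_sum E m Z = (\<Sum>e\<in>Z. {#(m, Proper (head E e))#})"

inductive step1 :: "('v, 'e) pre_digraph \<Rightarrow> ('v, 'e) formal_sum \<Rightarrow> ('v, 'e) formal_sum \<Rightarrow> bool"
  for E :: "('v, 'e) pre_digraph" where
  A1: "\<lbrakk>a \<in> free_gamma E; regular_vertex E v\<rbrakk> \<Longrightarrow>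
    step1 E (a + {#(m, Proper v)#}) (a + range_sum E (m + 1) (out_arcs E v))"
| A2: "\<lbrakk>a \<in> free_gamma E; infinite_emitter E v; finite Z; Z \<noteq> {}; Z \<subseteq> out_arcs E v\<rbrakk> \<Longrightarrow>
    step1 E (a + {#(m, Proper v)#}) (a + {#(m, Improper v Z)#} + range_sum E (m + 1) Z)"
| A3: "\<lbrakk>a \<in> free_gamma E; infinite_emitter E v; Z \<noteq> {}; Z \<subset> W; finite W; W \<subseteq> out_arcs E v\<rbrakk> \<Longrightarrow>
    step1 E (a + {#(m, Improper v Z)#})
      (a + {#(m, Improper v W)#} + range_sum E (m + 1) (W - Z))"

text \<open>The congruence of \<open>\<Gamma>\<close>-monoids generated by \<^const>\<open>step1\<close>.\<close>

inductive gcong :: "('v, 'e) pre_digraph \<Rightarrow> ('v, 'e) formal_sum \<Rightarrow> ('v, 'e) formal_sum \<Rightarrow> bool"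
  for E :: "('v, 'e) pre_digraph" where
  step: "step1 E a b \<Longrightarrow> gcong E a b"
| refl: "a \<in> free_gamma E \<Longrightarrow> gcong E a a"
| sym: "gcong E a b \<Longrightarrow> gcong E b a"
| trans: "gcong E a b \<Longrightarrow> gcong E b c \<Longrightarrow> gcong E a c"
| add: "gcong E a b \<Longrightarrow> gcong E c d \<Longrightarrow> gcong E (a + c) (b + d)"
| shift: "gcong E a b \<Longrightarrow> gcong E (shift n a) (shift n b)"

definition gcong_rel :: "('v, 'e) pre_digraph \<Rightarrow> (('v, 'e) formal_sum \<times> ('v, 'e) formal_sum) set"
  where "gcong_rel E = {(a, b). gcong E a b}"

definition graph_monoid :: "('v, 'e) pre_digraph \<Rightarrow> ('v, 'e) formal_sum set gamma_monoid" where
  "graph_monoid E =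
     \<lparr>carrier = free_gamma E // gcong_rel E,
      monoid.mult = (\<lambda>A B. \<Union>a\<in>A. \<Union>b\<in>B. gcong_rel E `` {a + b}),
      one = gcong_rel E `` {0},
      act = (\<lambda>n A. \<Union>a\<in>A. gcong_rel E `` {shift n a})\<rparr>"

abbreviation graph_group ::
  "('v, 'e) pre_digraph \<Rightarrow> (('v, 'e) formal_sum set \<times> ('v, 'e) formal_sum set) set ordered_gamma_group"
  where "graph_group E \<equiv> grothendieck_group (graph_monoid E)"


section \<open>Rings without unit\<close>

text \<open>
  A Leavitt path algebra over infinitely many vertices has no unit, whereas \<^locale>\<open>ring\<close> and
  \<^locale>\<open>ideal\<close> require one. The notions below never mention the field \<open>one\<close> of the record.
\<close>

definition two_sided_ideal :: "('a, 'm) ring_scheme \<Rightarrow> 'a set \<Rightarrow> bool" where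
  "two_sided_ideal R I \<longleftrightarrow> additive_subgroup I R \<and>
     (\<forall>a\<in>I. \<forall>x\<in>carrier R. x \<otimes>\<^bsub>R\<^esub> a \<in> I \<and> a \<otimes>\<^bsub>R\<^esub> x \<in> I)"

definition right_ideal :: "('a, 'm) ring_scheme \<Rightarrow> 'a set \<Rightarrow> bool" where
  "right_ideal R I \<longleftrightarrow> additive_subgroup I R \<and> (\<forall>a\<in>I. \<forall>x\<in>carrier R. a \<otimes>\<^bsub>R\<^esub> x \<in> I)"

definition simple_ring :: "('a, 'm) ring_scheme \<Rightarrow> bool" where
  "simple_ring R \<longleftrightarrow> carrier R \<noteq> {\<zero>\<^bsub>R\<^esub>} \<and>
     (\<forall>I. two_sided_ideal R I \<longrightarrow> I = {\<zero>\<^bsub>R\<^esub>} \<or> I = carrier R)"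

text \<open>\<open>D n\<close> is the homogeneous component of degree \<open>n\<close>.\<close>

definition graded_ideal :: "('a, 'm) ring_scheme \<Rightarrow> (int \<Rightarrow> 'a set) \<Rightarrow> 'a set \<Rightarrow> bool" where
  "graded_ideal R D I \<longleftrightarrow> two_sided_ideal R I \<and>
     (\<forall>a\<in>I. \<exists>N h. finite N \<and> (\<forall>n\<in>N. h n \<in> I \<inter> D n) \<and> a = (\<Oplus>\<^bsub>R\<^esub>n\<in>N. h n))"

definition graded_simple :: "('a, 'm) ring_scheme \<Rightarrow> (int \<Rightarrow> 'a set) \<Rightarrow> bool" where
  "graded_simple R D \<longleftrightarrow> carrier R \<noteq> {\<zero>\<^bsub>R\<^esub>} \<and>
     (\<forall>I. graded_ideal R D I \<longrightarrow> I = {\<zero>\<^bsub>R\<^esub>} \<or> I = carrier R)"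

definition right_mult :: "('a, 'm) ring_scheme \<Rightarrow> 'a \<Rightarrow> 'a set" where
  "right_mult R e = (\<lambda>x. e \<otimes>\<^bsub>R\<^esub> x) ` carrier R"

text \<open>Isomorphism of right ideals as right modules.\<close>

definition right_module_iso :: "('a, 'm) ring_scheme \<Rightarrow> 'a set \<Rightarrow> 'a set \<Rightarrow> bool" where
  "right_module_iso R A B \<longleftrightarrow> (\<exists>f. bij_betw f A B \<and>
     (\<forall>a\<in>A. \<forall>b\<in>A. f (a \<oplus>\<^bsub>R\<^esub> b) = f a \<oplus>\<^bsub>R\<^esub> f b) \<and>
     (\<forall>a\<in>A. \<forall>x\<in>carrier R. f (a \<otimes>\<^bsub>R\<^esub> x) = f a \<otimes>\<^bsub>R\<^esub> x))"

definition direct_summand :: "('a, 'm) ring_scheme \<Rightarrow> 'a set \<Rightarrow> 'a set \<Rightarrow> bool" where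
  "direct_summand R A P \<longleftrightarrow> right_ideal R A \<and>
     (\<exists>B. right_ideal R B \<and> A \<inter> B = {\<zero>\<^bsub>R\<^esub>} \<and> A <+>\<^bsub>R\<^esub> B = P)"

definition infinite_idempotent :: "('a, 'm) ring_scheme \<Rightarrow> 'a \<Rightarrow> bool" where
  "infinite_idempotent R e \<longleftrightarrow> e \<in> carrier R \<and> e \<otimes>\<^bsub>R\<^esub> e = e \<and>
     (\<exists>A. direct_summand R A (right_mult R e) \<and> A \<noteq> right_mult R e \<and>
          right_module_iso R (right_mult R e) A)"

definition purely_infinite_simple :: "('a, 'm) ring_scheme \<Rightarrow> bool" where
  "purely_infinite_simple R \<longleftrightarrow> simple_ring R \<and>
     (\<forall>I. right_ideal R I \<and> I \<noteq> {\<zero>\<^bsub>R\<^esub>} \<longrightarrow> (\<exists>e\<in>I. infinite_idempotent R e))"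


section \<open>The Leavitt path algebra\<close>

datatype ('v, 'e) letter = Vert 'v | Edge 'e | Ghost 'e

datatype ('v, 'e) lword = Word (letters: "('v, 'e) letter list")

text \<open>
  Words form a monoid under concatenation, so \<open>('v, 'e) lword \<Rightarrow>\<^sub>0 'k\<close> is the free unital algebra
  on all letters, with the convolution product of \<^theory>\<open>HOL-Library.Poly_Mapping\<close>.
\<close>

instantiation lword :: (type, type) monoid_add
begin

definition zero_lword :: "('a, 'b) lword" where
  "0 = Word []"

definition plus_lword :: "('a, 'b) lword \<Rightarrow> ('a, 'b) lword \<Rightarrow> ('a, 'b) lword" where
  "u + w = Word (letters u @ letters w)"

instance
  by standard (simp_all add: zero_lword_def plus_lword_def)

end

definition graph_letters :: "('v, 'e) pre_digraph \<Rightarrow> ('v, 'e) letter set" where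
  "graph_letters E = Vert ` verts E \<union> Edge ` arcs E \<union> Ghost ` arcs E"

text \<open>
  The free non-unital algebra on the letters of \<open>E\<close>: the empty word is excluded, so the field
  \<open>one\<close> holds an element outside the carrier.
\<close>

definition free_algebra ::
  "'k::field itself \<Rightarrow> ('v, 'e) pre_digraph \<Rightarrow> ('k, ('v, 'e) lword \<Rightarrow>\<^sub>0 'k) module" where
  "free_algebra k E =
     \<lparr>carrier = {f. \<forall>w\<in>Poly_Mapping.keys f. letters w \<noteq> [] \<and> set (letters w) \<subseteq> graph_letters E},
      monoid.mult = (*), one = 1, zero = 0, add = (+),
      smult = (\<lambda>c. Poly_Mapping.map ((*) c))\<rparr>"

definition wmon :: "('v, 'e) letter list \<Rightarrow> ('v, 'e) lword \<Rightarrow>\<^sub>0 'k::field" where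
  "wmon ls = Poly_Mapping.single (Word ls) 1"

inductive_set relators :: "('v, 'e) pre_digraph \<Rightarrow> (('v, 'e) lword \<Rightarrow>\<^sub>0 'k::field) set"
  for E :: "('v, 'e) pre_digraph" where
  vert_orth: "\<lbrakk>v \<in> verts E; w \<in> verts E; v \<noteq> w\<rbrakk> \<Longrightarrow> wmon [Vert v, Vert w] \<in> relators E"
| vert_idem: "v \<in> verts E \<Longrightarrow> wmon [Vert v, Vert v] - wmon [Vert v] \<in> relators E"
| edge_source: "e \<in> arcs E \<Longrightarrow> wmon [Vert (tail E e), Edge e] - wmon [Edge e] \<in> relators E"
| edge_range: "e \<in> arcs E \<Longrightarrow> wmon [Edge e, Vert (head E e)] - wmon [Edge e] \<in> relators E"
| ghost_range: "e \<in> arcs E \<Longrightarrow> wmon [Vert (head E e), Ghost e] - wmon [Ghost e] \<in> relators E"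
| ghost_source: "e \<in> arcs E \<Longrightarrow> wmon [Ghost e, Vert (tail E e)] - wmon [Ghost e] \<in> relators E"
| CK1_orth: "\<lbrakk>e \<in> arcs E; f \<in> arcs E; e \<noteq> f\<rbrakk> \<Longrightarrow> wmon [Ghost e, Edge f] \<in> relators E"
| CK1: "e \<in> arcs E \<Longrightarrow> wmon [Ghost e, Edge e] - wmon [Vert (head E e)] \<in> relators E"
| CK2: "regular_vertex E v \<Longrightarrow>
    wmon [Vert v] - (\<Sum>e\<in>out_arcs E v. wmon [Edge e, Ghost e]) \<in> relators E"

text \<open>
  The algebra ideal generated by the relators; closure under scalars does not follow from the ring
  ideal axioms, because the free algebra has no unit.
\<close>

definition relation_ideal ::
  "'k::field itself \<Rightarrow> ('v, 'e) pre_digraph \<Rightarrow> (('v, 'e) lword \<Rightarrow>\<^sub>0 'k) set" where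
  "relation_ideal k E =
     \<Inter>{I. two_sided_ideal (free_algebra k E) I \<and>
         (\<forall>c. \<forall>f\<in>I. c \<odot>\<^bsub>free_algebra k E\<^esub> f \<in> I) \<and> relators E \<subseteq> I}"

definition leavitt_path_algebra ::
  "'k::field itself \<Rightarrow> ('v, 'e) pre_digraph \<Rightarrow> ('k, (('v, 'e) lword \<Rightarrow>\<^sub>0 'k) set) module" where
  "leavitt_path_algebra k E =
     (let F = free_algebra k E; N = relation_ideal k E; Q = F Quot N in
      \<lparr>carrier = carrier Q, monoid.mult = monoid.mult Q, one = one Q, zero = zero Q, add = add Q,
       smult = (\<lambda>c A. \<Union>f\<in>A. N +>\<^bsub>F\<^esub> (c \<odot>\<^bsub>F\<^esub> f))\<rparr>)"

text \<open>
  A path is a walk together with its source, which matters when the walk is empty: the path is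
  then that vertex. For \<open>q = f\<^sub>1 \<dots> f\<^sub>n\<close>, \<open>q\<^sup>*\<close> is \<open>f\<^sub>n\<^sup>* \<dots> f\<^sub>1\<^sup>*\<close>.
\<close>

definition path_word :: "'v \<Rightarrow> 'e list \<Rightarrow> ('v, 'e) letter list" where
  "path_word u p = (if p = [] then [Vert u] else map Edge p)"

definition ghost_word :: "'v \<Rightarrow> 'e list \<Rightarrow> ('v, 'e) letter list" where
  "ghost_word w q = (if q = [] then [Vert w] else map Ghost (rev q))"

definition homogeneous_words :: "('v, 'e) pre_digraph \<Rightarrow> int \<Rightarrow> ('v, 'e) lword set" where
  "homogeneous_words E n =
     {Word (path_word u p @ ghost_word w q) |u p u' w q w'.
        pre_digraph.awalk E u p u' \<and> pre_digraph.awalk E w q w' \<and>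
        int (length p) - int (length q) = n}"

text \<open>The span of the elements \<open>p q\<^sup>*\<close> with \<open>\<bar>p\<bar> - \<bar>q\<bar> = n\<close>.\<close>

definition lpa_component ::
  "'k::field itself \<Rightarrow> ('v, 'e) pre_digraph \<Rightarrow> int \<Rightarrow> (('v, 'e) lword \<Rightarrow>\<^sub>0 'k) set set" where
  "lpa_component k E n =
     {relation_ideal k E +>\<^bsub>free_algebra k E\<^esub> f |f. Poly_Mapping.keys f \<subseteq> homogeneous_words E n}"

end

theory Submission
  imports Defs "HOL-Library.Function_Algebras"
begin

text \<open>
  All conditions are compared with three conditions on the graph: the only hereditary saturated sets
  of vertices are the trivial ones, every closed walk has an exit, and there is a closed walk.

  On the monoid side, expanding every generator up to a common degree, with one fixed finite set of
  edges per infinite emitter, is additive and separates congruence classes once the degree and the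
  finite sets are large enough. Hence the graph monoid is cancellative. If \<open>x\<^sup>n a \<le> a\<close>, then
  a large expansion of \<open>a\<close> contains its own translates, which forces a closed walk; if
  \<open>x\<^sup>n a = a\<close>, nothing may branch, so the closed walk has no exit.

  On the algebra side, the Leavitt path algebra is realised inside a ring of additive endomorphisms
  of the free algebra. Representations on boundary paths detect vertices, gradings and closed walks
  without exit. A nonzero element can be multiplied on both sides into a nonzero multiple of a vertex,
  provided that it is homogeneous or that all closed walks have exits. Without closed walks, every
  finite subset lies in a finite-dimensional subalgebra, which has no infinite idempotent.
\<close>

text \<open>Infinite emitters are the obstacle on the monoid side: \<open>A2\<close> and
  \<open>A3\<close> leave infinitely many choices of edge sets. Fixing one set \<open>Z v\<close>
  per emitter turns rewriting into a function, and congruent elements are compared for all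
  sufficiently large \<open>Z\<close> at once, which replaces a confluence argument. On the algebra
  side, cosets are awkward to compute with and the algebra may have no unit; the endomorphism ring
  is a type-class ring with unit, and the scalars are elements of it. The monomials made of a path
  and an adjoint path are only known to span, because CK2 relates them. Every claim that something
  is nonzero therefore comes from a boundary path representation with two parameters: the set
  \<open>H\<close> of forbidden vertices and the degree increment \<delta>. With \<delta> = 1 walks
  of different length are separated; with \<delta> = 0 a closed walk without exit acts as its
  vertex. Closed walks are used in place of cycles, so that no minimal cycle has to be
  chosen.\<close>

lemma UN_const_on:
  assumes "A \<noteq> {}" "\<And>x. x \<in> A \<Longrightarrow> f x = C"
  shows "(\<Union>x\<in>A. f x) = C"
  using assms by auto

lemma setcompr_image2: "{f y z |y z. y \<in> h ` I \<and> z \<in> h ` J} = (\<lambda>(a, b). f (h a) (h b)) ` (I \<times> J)"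
  by fast

section \<open>Cancellative conical \<open>\<Gamma>\<close>-monoids\<close>

text \<open>These properties carry the abstract part of the monoid side. Cancellation and conicality
  together make \<open>gm_le\<close> antisymmetric, which is what keeps periodic and aperiodic
  elements apart.\<close>

locale cancel_gamma_monoid = comm_monoid M for M :: "('a, 'm) gamma_monoid_scheme" (structure) +
  assumes act_closed [simp]: "a \<in> carrier M \<Longrightarrow> act M n a \<in> carrier M"
    and act_mult: "\<lbrakk>a \<in> carrier M; b \<in> carrier M\<rbrakk> \<Longrightarrow> act M n (a \<otimes> b) = act M n a \<otimes> act M n b"
    and act_act: "a \<in> carrier M \<Longrightarrow> act M m (act M n a) = act M (m + n) a"
    and act_0 [simp]: "a \<in> carrier M \<Longrightarrow> act M 0 a = a"
    and cancel: "\<lbrakk>a \<in> carrier M; b \<in> carrier M; c \<in> carrier M; a \<otimes> c = b \<otimes> c\<rbrakk> \<Longrightarrow> a = b"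
    and conical: "\<lbrakk>a \<in> carrier M; b \<in> carrier M; a \<otimes> b = \<one>\<rbrakk> \<Longrightarrow> a = \<one>"
begin

text \<open>The image of zero is idempotent, and by cancellation zero is the only
  idempotent.\<close>

lemma act_one [simp]: "act M n \<one> = \<one>"
proof -
  have "act M n \<one> \<otimes> act M n \<one> = act M n \<one>"
    using act_mult[of \<one> \<one> n] by simp
  then show ?thesis using cancel[of "act M n \<one>" \<one> "act M n \<one>"] by simp
qed

lemma act_periodic_mult:
  assumes "a \<in> carrier M" "a = act M (int n) a"
  shows "act M (int (k * n)) a = a"
proof (induction k)
  case (Suc k)
  have "act M (int (Suc k * n)) a = act M (int n) (act M (int (k * n)) a)"
    using assms(1) by (simp add: act_act)
  then show ?case using Suc assms(2) by simp
qed (use assms in simp)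

text \<open>Substituting the equation into itself replaces \<open>m\<close> by its multiples while
  the first remainder \<open>c\<close> stays visible as a summand; this is how a nonzero
  \<open>c\<close> survives the iteration.\<close>

lemma le_iterate:
  assumes a: "a \<in> carrier M" and c: "c \<in> carrier M" and eq: "act M m a \<otimes> c = a"
  shows "\<exists>d\<in>carrier M. act M (int (Suc k) * m) a \<otimes> (c \<otimes> d) = a"
proof (induction k)
  case 0
  then show ?case using assms by (intro bexI[of _ \<one>]) simp_all
next
  case (Suc k)
  then obtain d where d: "d \<in> carrier M" "act M (int (Suc k) * m) a \<otimes> (c \<otimes> d) = a" by blast
  have "act M m a = act M (int (Suc (Suc k)) * m) a \<otimes> act M m (c \<otimes> d)"
    using d a c act_mult[of "act M (int (Suc k) * m) a" "c \<otimes> d" m]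
    by (simp add: act_act algebra_simps)
  then have "act M (int (Suc (Suc k)) * m) a \<otimes> (c \<otimes> act M m (c \<otimes> d)) = a"
    using eq a c d by (simp add: m_ac)
  then show ?case using c d by (intro bexI[of _ "act M m (c \<otimes> d)"]) simp_all
qed

text \<open>If \<open>n\<close> is a period and \<open>m\<close> witnesses aperiodicity with
  remainder \<open>c\<close>, iterating up to \<open>n * m\<close> returns to \<open>a\<close>
  itself. The accumulated remainder cancels to zero, and conicality makes \<open>c\<close>
  zero.\<close>

lemma periodic_not_aperiodic:
  assumes a: "a \<in> carrier M" and p: "periodic M a"
  shows "\<not> aperiodic M a"
proof
  assume "aperiodic M a"
  then obtain m :: nat and c where m: "c \<in> carrier M" "act M (int m) a \<otimes> c = a" "act M (int m) a \<noteq> a"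
    unfolding aperiodic_def gm_less_def gm_le_def by blast
  obtain n :: nat where n: "n > 0" "a = act M (int n) a"
    using p unfolding periodic_def by blast
  obtain k where k: "n = Suc k" using n(1) by (cases n) auto
  obtain d where d: "d \<in> carrier M" "act M (int (Suc k) * int m) a \<otimes> (c \<otimes> d) = a"
    using le_iterate[OF a m(1,2)] by blast
  have "act M (int (Suc k) * int m) a = a"
    using act_periodic_mult[OF a n(2), of m] k by (simp add: algebra_simps)
  then have "(c \<otimes> d) \<otimes> a = \<one> \<otimes> a" using d a m(1) by (simp add: m_ac)
  then have "c \<otimes> d = \<one>" using cancel[of "c \<otimes> d" \<one> a] a d m(1) by simp
  then have "c = \<one>" using conical m(1) d(1) by blast
  then show False using m a by simp
qed

text \<open>A comparable element that is not aperiodic has equality in its inequality and so is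
  periodic. A periodic element in turn is comparable, because \<open>gm_le M a a\<close>
  holds.\<close>

lemma no_periodic_iff_comparable_aperiodic:
  "\<not> (\<exists>a\<in>carrier M. a \<noteq> \<one> \<and> periodic M a) \<longleftrightarrow>
   (\<forall>a\<in>carrier M. a \<noteq> \<one> \<and> comparable M a \<longrightarrow> aperiodic M a)"
proof (intro iffI)
  assume L: "\<not> (\<exists>a\<in>carrier M. a \<noteq> \<one> \<and> periodic M a)"
  show "\<forall>a\<in>carrier M. a \<noteq> \<one> \<and> comparable M a \<longrightarrow> aperiodic M a"
  proof (intro ballI impI, elim conjE)
    fix a assume a: "a \<in> carrier M" "a \<noteq> \<one>" "comparable M a"
    then show "aperiodic M a"
      using L unfolding comparable_def aperiodic_def gm_less_def periodic_def by metis
  qed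
next
  assume R: "\<forall>a\<in>carrier M. a \<noteq> \<one> \<and> comparable M a \<longrightarrow> aperiodic M a"
  show "\<not> (\<exists>a\<in>carrier M. a \<noteq> \<one> \<and> periodic M a)"
  proof
    assume "\<exists>a\<in>carrier M. a \<noteq> \<one> \<and> periodic M a"
    then obtain a where a: "a \<in> carrier M" "a \<noteq> \<one>" "periodic M a" by blast
    have "gm_le M a a" unfolding gm_le_def using a(1) by (intro bexI[of _ \<one>]) simp_all
    then have "comparable M a"
      using a(3) unfolding comparable_def periodic_def by metis
    then show False using R a periodic_not_aperiodic by blast
  qed
qed

section \<open>The Grothendieck group of a cancellative monoid\<close>

abbreviation "groth_class a b \<equiv> groth_rel M `` {(a, b)}"
abbreviation "GG \<equiv> grothendieck_group M"

text \<open>The extra summand \<open>k\<close> makes the relation transitive in an arbitrary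
  commutative monoid. Cancellation absorbs it, and pairs are compared by cross sums from here
  on.\<close>

lemma groth_rel_iff:
  "((a, b), (c, d)) \<in> groth_rel M \<longleftrightarrow>
     a \<in> carrier M \<and> b \<in> carrier M \<and> c \<in> carrier M \<and> d \<in> carrier M \<and> a \<otimes> d = c \<otimes> b"
proof -
  have "(\<exists>k\<in>carrier M. (a \<otimes> d) \<otimes> k = (c \<otimes> b) \<otimes> k) \<longleftrightarrow> a \<otimes> d = c \<otimes> b"
    if "a \<in> carrier M" "b \<in> carrier M" "c \<in> carrier M" "d \<in> carrier M"
  proof
    assume "\<exists>k\<in>carrier M. (a \<otimes> d) \<otimes> k = (c \<otimes> b) \<otimes> k"
    then show "a \<otimes> d = c \<otimes> b" using that cancel[OF m_closed m_closed] by blast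
  next
    assume "a \<otimes> d = c \<otimes> b"
    then show "\<exists>k\<in>carrier M. (a \<otimes> d) \<otimes> k = (c \<otimes> b) \<otimes> k" by (intro bexI[of _ \<one>]) simp_all
  qed
  then show ?thesis unfolding groth_rel_def by blast
qed

lemma groth_equiv: "equiv (carrier M \<times> carrier M) (groth_rel M)"
proof (rule equivI)
  show "groth_rel M \<subseteq> (carrier M \<times> carrier M) \<times> carrier M \<times> carrier M"
    by (auto simp: groth_rel_iff)
  show "refl_on (carrier M \<times> carrier M) (groth_rel M)"
    by (rule refl_onI) (auto simp: groth_rel_iff)
  show "sym (groth_rel M)"
    by (rule symI) (auto simp: groth_rel_iff)
  show "trans (groth_rel M)"
  proof (rule transI, clarify)
    fix a b c d e f
    assume "((a, b), (c, d)) \<in> groth_rel M" "((c, d), (e, f)) \<in> groth_rel M"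
    then have C: "a \<in> carrier M" "b \<in> carrier M" "c \<in> carrier M" "d \<in> carrier M" "e \<in> carrier M" "f \<in> carrier M"
      and e: "a \<otimes> d = c \<otimes> b" "c \<otimes> f = e \<otimes> d" by (auto simp: groth_rel_iff)
    have "(a \<otimes> f) \<otimes> d = (a \<otimes> d) \<otimes> f" using C by (simp add: m_ac)
    also have "\<dots> = (c \<otimes> f) \<otimes> b" using C e by (simp add: m_ac)
    also have "\<dots> = (e \<otimes> b) \<otimes> d" using C e by (simp add: m_ac)
    finally show "((a, b), (e, f)) \<in> groth_rel M"
      using C cancel[of "a \<otimes> f" "e \<otimes> b" d] by (simp add: groth_rel_iff)
  qed
qed

lemma groth_class_eq:
  assumes "a \<in> carrier M" "b \<in> carrier M" "c \<in> carrier M" "d \<in> carrier M"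
  shows "groth_class a b = groth_class c d \<longleftrightarrow> a \<otimes> d = c \<otimes> b"
  using eq_equiv_class_iff[OF groth_equiv, of "(a, b)" "(c, d)"] assms by (simp add: groth_rel_iff)

lemma groth_mult:
  assumes "a \<in> carrier M" "b \<in> carrier M" "c \<in> carrier M" "d \<in> carrier M"
  shows "groth_class a b \<otimes>\<^bsub>GG\<^esub> groth_class c d = groth_class (a \<otimes> c) (b \<otimes> d)"
proof -
  have eq: "groth_class (a' \<otimes> c') (b' \<otimes> d') = groth_class (a \<otimes> c) (b \<otimes> d)"
    if "((a, b), (a', b')) \<in> groth_rel M" "((c, d), (c', d')) \<in> groth_rel M" for a' b' c' d'
  proof -
    have C: "a' \<in> carrier M" "b' \<in> carrier M" "c' \<in> carrier M" "d' \<in> carrier M"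
      and e: "a \<otimes> b' = a' \<otimes> b" "c \<otimes> d' = c' \<otimes> d"
      using that by (auto simp: groth_rel_iff)
    have "(a' \<otimes> c') \<otimes> (b \<otimes> d) = (a' \<otimes> b) \<otimes> (c' \<otimes> d)"
      using C assms by (simp add: m_ac)
    also have "\<dots> = (a \<otimes> b') \<otimes> (c \<otimes> d')" using e by simp
    also have "\<dots> = (a \<otimes> c) \<otimes> (b' \<otimes> d')" using C assms by (simp add: m_ac)
    finally show ?thesis using C assms by (subst groth_class_eq) auto
  qed
  have ne: "groth_class a b \<noteq> {}" "groth_class c d \<noteq> {}"
    using assms groth_rel_iff by (auto simp: Image_def)
  show ?thesis
    \<comment> \<open>The product is a union over all representatives; \<open>eq\<close> says that
      all members of the union are the same class.\<close>
    unfolding grothendieck_group_def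
    apply (simp only: monoid.simps)
    apply (rule UN_const_on[OF ne(1)])
    apply clarsimp
    apply (rule UN_const_on[OF ne(2)])
    apply (clarsimp simp: eq)
    done
qed

lemma groth_act:
  assumes "a \<in> carrier M" "b \<in> carrier M"
  shows "act GG n (groth_class a b) = groth_class (act M n a) (act M n b)"
proof -
  have eq: "groth_class (act M n a') (act M n b') = groth_class (act M n a) (act M n b)"
    if "((a, b), (a', b')) \<in> groth_rel M" for a' b'
  proof -
    have C: "a' \<in> carrier M" "b' \<in> carrier M" and e: "a \<otimes> b' = a' \<otimes> b"
      using that by (auto simp: groth_rel_iff)
    have "act M n a' \<otimes> act M n b = act M n a \<otimes> act M n b'"
      using e C assms by (metis act_mult)
    then show ?thesis using C assms by (subst groth_class_eq) auto
  qed
  have ne: "groth_class a b \<noteq> {}"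
    using assms groth_rel_iff by (auto simp: Image_def)
  show ?thesis
    unfolding grothendieck_group_def
    apply (simp only: gamma_monoid.simps)
    apply (rule UN_const_on[OF ne(1)])
    apply (clarsimp simp: eq)
    done
qed

lemma groth_carrier: "carrier GG = {groth_class a b |a b. a \<in> carrier M \<and> b \<in> carrier M}"
  unfolding grothendieck_group_def by (auto simp: quotient_def)

lemma groth_one: "\<one>\<^bsub>GG\<^esub> = groth_class \<one> \<one>"
  unfolding grothendieck_group_def by simp

lemma groth_pos: "pos_cone GG = {groth_class a \<one> |a. a \<in> carrier M}"
  unfolding grothendieck_group_def by auto

lemma groth_group: "group GG"
proof (rule groupI)
  fix x y z assume "x \<in> carrier GG" "y \<in> carrier GG" "z \<in> carrier GG"
  then show "x \<otimes>\<^bsub>GG\<^esub> y \<otimes>\<^bsub>GG\<^esub> z = x \<otimes>\<^bsub>GG\<^esub> (y \<otimes>\<^bsub>GG\<^esub> z)"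
    unfolding groth_carrier by (auto simp: groth_mult m_ac)
next
  fix x y assume "x \<in> carrier GG" "y \<in> carrier GG"
  then show "x \<otimes>\<^bsub>GG\<^esub> y \<in> carrier GG"
    unfolding groth_carrier by (force simp: groth_mult)
next
  show "\<one>\<^bsub>GG\<^esub> \<in> carrier GG" unfolding groth_carrier groth_one by blast
next
  fix x assume x: "x \<in> carrier GG"
  then show "\<one>\<^bsub>GG\<^esub> \<otimes>\<^bsub>GG\<^esub> x = x" unfolding groth_carrier groth_one by (auto simp: groth_mult)
  obtain a b where "a \<in> carrier M" "b \<in> carrier M" "x = groth_class a b"
    using x unfolding groth_carrier by blast
  then show "\<exists>y\<in>carrier GG. y \<otimes>\<^bsub>GG\<^esub> x = \<one>\<^bsub>GG\<^esub>"
    unfolding groth_carrier groth_one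
    by (intro bexI[of _ "groth_class b a"]) (auto simp: groth_mult groth_class_eq m_ac)
qed

lemma groth_inv:
  assumes "a \<in> carrier M" "b \<in> carrier M"
  shows "inv\<^bsub>GG\<^esub> groth_class a b = groth_class b a"
proof -
  have "groth_class b a \<otimes>\<^bsub>GG\<^esub> groth_class a b = \<one>\<^bsub>GG\<^esub>"
    using assms unfolding groth_one by (simp add: groth_mult groth_class_eq m_ac)
  then show ?thesis
    using group.inv_equality[OF groth_group] assms unfolding groth_carrier by blast
qed

lemma groth_diff:
  assumes "a \<in> carrier M" "b \<in> carrier M"
  shows "groth_class a \<one> \<otimes>\<^bsub>GG\<^esub> inv\<^bsub>GG\<^esub> groth_class b \<one> = groth_class a b"
  using assms by (simp add: groth_inv groth_mult)

lemma groth_diff_set: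
  assumes "I \<subseteq> carrier M"
  shows "{y \<otimes>\<^bsub>GG\<^esub> inv\<^bsub>GG\<^esub> z |y z. y \<in> (\<lambda>a. groth_class a \<one>) ` I \<and> z \<in> (\<lambda>a. groth_class a \<one>) ` I} =
    (\<lambda>(a, b). groth_class a b) ` (I \<times> I)" (is "?L = _")
proof -
  have "?L = (\<lambda>(a, b). groth_class a \<one> \<otimes>\<^bsub>GG\<^esub> inv\<^bsub>GG\<^esub> groth_class b \<one>) ` (I \<times> I)"
    by (rule setcompr_image2)
  also have "\<dots> = (\<lambda>(a, b). groth_class a b) ` (I \<times> I)"
    using assms by (intro image_cong refl) (auto intro!: groth_diff)
  finally show ?thesis .
qed

text \<open>The embedding of \<open>M\<close> is injective by cancellation, additive, equivariant
  and onto the cone, so each clause of the definition transfers separately.\<close>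

lemma pos_cone_ideal_iff:
  assumes "I \<subseteq> carrier M"
  shows "gamma_order_ideal (GG\<lparr>carrier := pos_cone GG\<rparr>) ((\<lambda>a. groth_class a \<one>) ` I) \<longleftrightarrow>
         gamma_order_ideal M I"
proof -
  have inj: "groth_class a \<one> \<in> (\<lambda>a. groth_class a \<one>) ` I \<longleftrightarrow> a \<in> I" if "a \<in> carrier M" for a
    using that assms by (auto simp: groth_class_eq image_iff subset_iff)
  have le: "gm_le (GG\<lparr>carrier := pos_cone GG\<rparr>) (groth_class a \<one>) (groth_class b \<one>) \<longleftrightarrow> gm_le M a b"
    if "a \<in> carrier M" "b \<in> carrier M" for a b
  proof -
    have "(\<exists>x\<in>pos_cone GG. groth_class a \<one> \<otimes>\<^bsub>GG\<^esub> x = groth_class b \<one>) \<longleftrightarrow>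
       (\<exists>c\<in>carrier M. groth_class a \<one> \<otimes>\<^bsub>GG\<^esub> groth_class c \<one> = groth_class b \<one>)"
      unfolding groth_pos by blast
    also have "\<dots> \<longleftrightarrow> (\<exists>c\<in>carrier M. a \<otimes> c = b)"
      using that by (simp add: groth_mult groth_class_eq)
    finally show ?thesis unfolding gm_le_def by simp
  qed
  have C: "a \<in> carrier M" if "a \<in> I" for a using that assms by blast
  let ?P = "GG\<lparr>carrier := pos_cone GG\<rparr>" and ?I = "(\<lambda>a. groth_class a \<one>) ` I"
  have "?I \<subseteq> pos_cone GG" unfolding groth_pos using C by blast
  moreover have "(\<forall>x\<in>?I. \<forall>y\<in>?I. x \<otimes>\<^bsub>GG\<^esub> y \<in> ?I) \<longleftrightarrow> (\<forall>x\<in>I. \<forall>y\<in>I. x \<otimes> y \<in> I)"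
    by (simp add: groth_mult C inj)
  moreover have "\<one>\<^bsub>GG\<^esub> \<in> ?I \<longleftrightarrow> \<one> \<in> I"
    unfolding groth_one by (rule inj) simp
  ultimately have s: "submonoid ?I ?P \<longleftrightarrow> submonoid I M"
    unfolding submonoid_def using assms by simp blast
  have A: "(\<forall>n. \<forall>a\<in>?I. act ?P n a \<in> ?I) \<longleftrightarrow> (\<forall>n. \<forall>a\<in>I. act M n a \<in> I)"
    by (simp add: groth_act C inj)
  have O: "(\<forall>a\<in>carrier ?P. \<forall>b\<in>?I. gm_le ?P a b \<longrightarrow> a \<in> ?I) \<longleftrightarrow>
     (\<forall>a\<in>carrier M. \<forall>b\<in>I. gm_le M a b \<longrightarrow> a \<in> I)"
  proof -
    have "(\<forall>a\<in>carrier ?P. \<forall>b\<in>?I. gm_le ?P a b \<longrightarrow> a \<in> ?I) \<longleftrightarrow>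
      (\<forall>a\<in>carrier M. \<forall>b\<in>I. gm_le ?P (groth_class a \<one>) (groth_class b \<one>) \<longrightarrow> groth_class a \<one> \<in> ?I)"
    proof -
      have "carrier ?P = (\<lambda>a. groth_class a \<one>) ` carrier M" by (auto simp: groth_pos)
      then show ?thesis by (simp only: ball_simps(9))
    qed
    also have "\<dots> \<longleftrightarrow> (\<forall>a\<in>carrier M. \<forall>b\<in>I. gm_le M a b \<longrightarrow> a \<in> I)"
      using le C inj by blast
    finally show ?thesis .
  qed
  show ?thesis unfolding gamma_order_ideal_def s A O ..
qed

text \<open>A group ideal is sent to its trace on the cone, a monoid ideal to the group of
  differences of its elements. The equation demanded of a group ideal says that the first passage
  loses nothing; order closure gives the same for the second.\<close>

lemma simple_group_iff: "simple_gamma_monoid M \<longleftrightarrow> simple_ordered_gamma_group GG"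
proof
  assume S: "simple_gamma_monoid M"
  show "simple_ordered_gamma_group GG"
    unfolding simple_ordered_gamma_group_def
  proof (intro conjI allI impI)
    obtain a where a: "a \<in> carrier M" "a \<noteq> \<one>"
      using S unfolding simple_gamma_monoid_def by blast
    then have "groth_class a \<one> \<in> carrier GG" "groth_class a \<one> \<noteq> \<one>\<^bsub>GG\<^esub>"
      unfolding groth_carrier groth_one by (auto simp: groth_class_eq)
    then show "carrier GG \<noteq> {\<one>\<^bsub>GG\<^esub>}" by blast
  next
    fix J assume J: "group_order_ideal GG J"
    define I where "I = {a \<in> carrier M. groth_class a \<one> \<in> J}"
    have JI: "J \<inter> pos_cone GG = (\<lambda>a. groth_class a \<one>) ` I"
      unfolding I_def groth_pos by auto
    have "gamma_order_ideal M I"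
      using J pos_cone_ideal_iff[of I] unfolding group_order_ideal_def JI by (auto simp: I_def)
    then have "I = {\<one>} \<or> I = carrier M" using S unfolding simple_gamma_monoid_def by blast
    moreover have Jeq: "J = (\<lambda>(a, b). groth_class a b) ` (I \<times> I)"
      using J groth_diff_set[of I] unfolding group_order_ideal_def JI by (auto simp only: I_def)
    ultimately show "J = {\<one>\<^bsub>GG\<^esub>} \<or> J = carrier GG"
    proof (elim disjE)
      assume "I = {\<one>}"
      then have "J = {\<one>\<^bsub>GG\<^esub>}" unfolding Jeq by (simp add: groth_one)
      then show ?thesis ..
    next
      assume "I = carrier M"
      then have "J = carrier GG" unfolding Jeq groth_carrier by auto
      then show ?thesis ..
    qed
  qed
next
  assume S: "simple_ordered_gamma_group GG"
  show "simple_gamma_monoid M"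
    unfolding simple_gamma_monoid_def
  proof (intro conjI allI impI)
    show "carrier M \<noteq> {\<one>}"
      using S unfolding simple_ordered_gamma_group_def groth_carrier groth_one by auto
  next
    fix I assume I: "gamma_order_ideal M I"
    have IC: "I \<subseteq> carrier M" and one: "\<one> \<in> I" and mult: "\<And>a b. a \<in> I \<Longrightarrow> b \<in> I \<Longrightarrow> a \<otimes> b \<in> I"
      and actI: "\<And>n a. a \<in> I \<Longrightarrow> act M n a \<in> I"
      and le: "\<And>a b. a \<in> carrier M \<Longrightarrow> b \<in> I \<Longrightarrow> gm_le M a b \<Longrightarrow> a \<in> I"
      using I unfolding gamma_order_ideal_def submonoid_def by auto
    have C: "a \<in> carrier M" if "a \<in> I" for a using that IC by blast
    define J where "J = (\<lambda>(a, b). groth_class a b) ` (I \<times> I)"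
    have JE: "\<exists>a\<in>I. \<exists>b\<in>I. x = groth_class a b" if "x \<in> J" for x
      using that unfolding J_def by auto
    have JI: "J \<inter> pos_cone GG = (\<lambda>a. groth_class a \<one>) ` I"
    proof
      show "J \<inter> pos_cone GG \<subseteq> (\<lambda>a. groth_class a \<one>) ` I"
      proof
        fix x assume "x \<in> J \<inter> pos_cone GG"
        then obtain a b c where x: "a \<in> I" "b \<in> I" "c \<in> carrier M" "x = groth_class a b" "x = groth_class c \<one>"
          using JE unfolding groth_pos by blast
        \<comment> \<open>A difference of elements of \<open>I\<close> that lies in the cone is
          below an element of \<open>I\<close>, and order closure brings it back into
          \<open>I\<close>.\<close>
        then have "c \<otimes> b = a" using C by (auto simp: groth_class_eq)
        then have "gm_le M c a" unfolding gm_le_def using x C by blast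
        then show "x \<in> (\<lambda>a. groth_class a \<one>) ` I" using le x by blast
      qed
      show "(\<lambda>a. groth_class a \<one>) ` I \<subseteq> J \<inter> pos_cone GG"
        unfolding J_def groth_pos using one C by auto
    qed
    have "group_order_ideal GG J"
      unfolding group_order_ideal_def JI
    proof (intro conjI)
      show "subgroup J GG"
      proof (rule group.subgroupI[OF groth_group])
        show "J \<subseteq> carrier GG" unfolding J_def groth_carrier using C by auto
        show "J \<noteq> {}" unfolding J_def using one by auto
        show "inv\<^bsub>GG\<^esub> a \<in> J" if "a \<in> J" for a
          using that C unfolding J_def by (auto simp: groth_inv)
        show "a \<otimes>\<^bsub>GG\<^esub> b \<in> J" if ab: "a \<in> J" "b \<in> J" for a b
        proof -
          obtain a1 a2 where a: "a1 \<in> I" "a2 \<in> I" "a = groth_class a1 a2"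
            using JE[OF ab(1)] by blast
          obtain b1 b2 where "b1 \<in> I" "b2 \<in> I" "b = groth_class b1 b2"
            using JE[OF ab(2)] by blast
          with a show ?thesis unfolding J_def
            by (intro image_eqI[of _ _ "(a1 \<otimes> b1, a2 \<otimes> b2)"]) (auto simp: groth_mult C mult)
        qed
      qed
      show "\<forall>n. \<forall>a\<in>J. act GG n a \<in> J"
      proof (intro allI ballI)
        fix n a assume "a \<in> J"
        then obtain a1 a2 where "a1 \<in> I" "a2 \<in> I" "a = groth_class a1 a2"
          using JE by blast
        then show "act GG n a \<in> J" unfolding J_def
          by (intro image_eqI[of _ _ "(act M n a1, act M n a2)"]) (auto simp: groth_act C actI)
      qed
      show "gamma_order_ideal (GG\<lparr>carrier := pos_cone GG\<rparr>) ((\<lambda>a. groth_class a \<one>) ` I)"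
        using I pos_cone_ideal_iff[OF IC] by blast
      show "J = {y \<otimes>\<^bsub>GG\<^esub> inv\<^bsub>GG\<^esub> z |y z. y \<in> (\<lambda>a. groth_class a \<one>) ` I \<and> z \<in> (\<lambda>a. groth_class a \<one>) ` I}"
        unfolding groth_diff_set[OF IC] J_def ..
    qed
    then have "J = {\<one>\<^bsub>GG\<^esub>} \<or> J = carrier GG"
      using S unfolding simple_ordered_gamma_group_def by blast
    then show "I = {\<one>} \<or> I = carrier M"
    proof
      assume J: "J = {\<one>\<^bsub>GG\<^esub>}"
      have "a = \<one>" if "a \<in> I" for a
      proof -
        have "groth_class a \<one> \<in> J" using that one unfolding J_def
          by (intro image_eqI[of _ _ "(a, \<one>)"]) auto
        then show ?thesis using J C[OF that] by (simp add: groth_one groth_class_eq)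
      qed
      then show ?thesis using one by blast
    next
      assume J: "J = carrier GG"
      have "a \<in> I" if a: "a \<in> carrier M" for a
      proof -
        have "groth_class a \<one> \<in> J \<inter> pos_cone GG" using a unfolding J groth_carrier groth_pos by blast
        then obtain b where "b \<in> I" "groth_class a \<one> = groth_class b \<one>" unfolding JI by blast
        then show ?thesis using a C by (auto simp: groth_class_eq)
      qed
      then show ?thesis using IC by blast
    qed
  qed
qed

end

section \<open>Graph conditions\<close>

text \<open>These are the vertex sets of graded ideals. With infinite emitters a graded ideal
  carries breaking vertices as further data, but those exist only for nonempty proper sets, so the
  criterion for simplicity can be stated with vertices alone.\<close>

definition hereditary_saturated :: "('v, 'e) pre_digraph \<Rightarrow> 'v set \<Rightarrow> bool" where
  "hereditary_saturated E H \<longleftrightarrow> H \<subseteq> verts E \<and>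
     (\<forall>e\<in>arcs E. tail E e \<in> H \<longrightarrow> head E e \<in> H) \<and>
     (\<forall>v. regular_vertex E v \<longrightarrow> (\<forall>e\<in>out_arcs E v. head E e \<in> H) \<longrightarrow> v \<in> H)"

definition hs_simple :: "('v, 'e) pre_digraph \<Rightarrow> bool" where
  "hs_simple E \<longleftrightarrow> verts E \<noteq> {} \<and> (\<forall>H. hereditary_saturated E H \<longrightarrow> H = {} \<or> H = verts E)"

text \<open>The condition is put on each edge, so it passes to prefixes and tails of a walk and
  holds for the empty walk, as inductions want it.\<close>

definition exitless :: "('v, 'e) pre_digraph \<Rightarrow> 'e list \<Rightarrow> bool" where
  "exitless E p \<longleftrightarrow> (\<forall>e\<in>set p. out_arcs E (tail E e) = {e})"

text \<open>Closed walks may repeat vertices. The condition agrees with the usual one for cycles,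
  since a closed walk without exit contains a cycle, again without exit.\<close>

definition condition_L :: "('v, 'e) pre_digraph \<Rightarrow> bool" where
  "condition_L E \<longleftrightarrow> \<not> (\<exists>v p. pre_digraph.awalk E v p v \<and> p \<noteq> [] \<and> exitless E p)"

definition has_closed_walk :: "('v, 'e) pre_digraph \<Rightarrow> bool" where
  "has_closed_walk E \<longleftrightarrow> (\<exists>v p. pre_digraph.awalk E v p v \<and> p \<noteq> [])"

section \<open>The graph monoid\<close>

lemma shift_simps [simp]:
  "shift n 0 = 0" "shift n {#} = {#}" "shift n (a + b) = shift n a + shift n b"
  "shift n {#(m, g)#} = {#(n + m, g)#}" "shift n (add_mset (m, g) a) = add_mset (n + m, g) (shift n a)"
  by (simp_all add: shift_def)

lemma shift_shift: "shift m (shift n a) = shift (m + n) a"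
  by (simp add: shift_def multiset.map_comp comp_def case_prod_unfold add.assoc)

lemma shift_0_left: "shift 0 a = a"
  by (simp add: shift_def case_prod_unfold)

lemma shift_sum: "shift n (\<Sum>x\<in>A. f x) = (\<Sum>x\<in>A. shift n (f x))"
  by (induction A rule: infinite_finite_induct) simp_all

lemma size_shift [simp]: "size (shift n a) = size a"
  by (simp add: shift_def)

primrec base :: "('v, 'e) gen \<Rightarrow> 'v" where
  "base (Proper v) = v"
| "base (Improper v Z) = v"

context wf_digraph
begin

lemma out_arcs_head: "e \<in> out_arcs G v \<Longrightarrow> head G e \<in> verts G"
  by (simp add: out_arcs_def)

lemma gens_Proper [simp]: "Proper v \<in> gens G \<longleftrightarrow> v \<in> verts G"
  by (auto simp: gens_def)

lemma gens_Improper [simp]: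
  "Improper v Z \<in> gens G \<longleftrightarrow> infinite_emitter G v \<and> finite Z \<and> Z \<noteq> {} \<and> Z \<subseteq> out_arcs G v"
  by (auto simp: gens_def)

lemma gens_base: "g \<in> gens G \<Longrightarrow> base g \<in> verts G"
  by (cases g) (auto simp: infinite_emitter_def)

lemma free_gamma_iff: "a \<in> free_gamma G \<longleftrightarrow> (\<forall>x\<in>#a. snd x \<in> gens G)"
  by (auto simp: free_gamma_def subset_iff mem_Times_iff)

lemma free_gamma_simps [simp]:
  "0 \<in> free_gamma G" "{#} \<in> free_gamma G"
  "a + b \<in> free_gamma G \<longleftrightarrow> a \<in> free_gamma G \<and> b \<in> free_gamma G"
  "{#(m, g)#} \<in> free_gamma G \<longleftrightarrow> g \<in> gens G"
  "add_mset (m, g) a \<in> free_gamma G \<longleftrightarrow> g \<in> gens G \<and> a \<in> free_gamma G"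
  by (auto simp: free_gamma_iff)

lemma free_gamma_shift [simp]: "shift n a \<in> free_gamma G \<longleftrightarrow> a \<in> free_gamma G"
  by (force simp: free_gamma_iff shift_def)

lemma free_gamma_sum: "(\<And>x. x \<in> A \<Longrightarrow> f x \<in> free_gamma G) \<Longrightarrow> (\<Sum>x\<in>A. f x) \<in> free_gamma G"
  by (induction A rule: infinite_finite_induct) auto

lemma range_sum_free: "Z \<subseteq> out_arcs G v \<Longrightarrow> range_sum G m Z \<in> free_gamma G"
  unfolding range_sum_def by (rule free_gamma_sum) (auto dest!: out_arcs_head subsetD)

lemma step1_free: "step1 G a b \<Longrightarrow> a \<in> free_gamma G \<and> b \<in> free_gamma G"
proof (induction rule: step1.induct)
  case (A1 a v m)
  then show ?case using range_sum_free[of "out_arcs G v" v] by (auto simp: regular_vertex_def)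
next
  case (A2 a v Z m)
  then show ?case using range_sum_free[of Z v] by (auto simp: infinite_emitter_def)
next
  case (A3 a v Z W m)
  then have "finite Z" using finite_subset by blast
  then show ?case using A3 range_sum_free[of "W - Z" v] by auto
qed

lemma gcong_free: "gcong G a b \<Longrightarrow> a \<in> free_gamma G \<and> b \<in> free_gamma G"
  by (induction rule: gcong.induct) (auto dest: step1_free)

lemma gcong_sum:
  assumes "\<And>x. x \<in> A \<Longrightarrow> gcong G (f x) (h x)"
  shows "gcong G (\<Sum>x\<in>A. f x) (\<Sum>x\<in>A. h x)"
  using assms
proof (induction A rule: infinite_finite_induct)
  case (insert x F)
  then show ?case using gcong.add[of G "f x" "h x"] by simp
qed (auto intro: gcong.refl)

lemma gcong_A1:
  assumes "regular_vertex G v"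
  shows "gcong G {#(m, Proper v)#} (range_sum G (m + 1) (out_arcs G v))"
  using gcong.step[OF step1.A1[of 0 G v m]] assms by simp

lemma gcong_A2:
  assumes "infinite_emitter G v" "finite Z" "Z \<noteq> {}" "Z \<subseteq> out_arcs G v"
  shows "gcong G {#(m, Proper v)#} ({#(m, Improper v Z)#} + range_sum G (m + 1) Z)"
  using gcong.step[OF step1.A2[of 0 G v Z m]] assms by simp

lemma gcong_A3:
  assumes "infinite_emitter G v" "Z \<noteq> {}" "Z \<subset> W" "finite W" "W \<subseteq> out_arcs G v"
  shows "gcong G {#(m, Improper v Z)#} ({#(m, Improper v W)#} + range_sum G (m + 1) (W - Z))"
  using gcong.step[OF step1.A3[of 0 G v Z W m]] assms by simp

text \<open>
  Full expansion: every generator is rewritten until its degree reaches a common level, and every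
  infinite emitter \<open>v\<close> uses the single set \<open>Z v\<close>. Congruent elements acquire equal expansions as
  soon as the level and the sets \<open>Z v\<close> are large enough.
\<close>

definition admissible :: "('a \<Rightarrow> 'b set) \<Rightarrow> bool" where
  "admissible Z \<longleftrightarrow> (\<forall>v. infinite_emitter G v \<longrightarrow> finite (Z v) \<and> Z v \<subseteq> out_arcs G v)"

text \<open>The number \<open>k\<close> counts the degrees still to climb. The unchanged branches
  cover sinks, emitters with empty \<open>Z v\<close> (no improper vertex belongs to the empty set),
  and improper vertices whose set does not lie in \<open>Z v\<close>. For \<open>W = Z v\<close> the
  sum is empty, so \<open>Improper v (Z v)\<close> is a fixed point.\<close>

primrec expand_gen :: "('a \<Rightarrow> 'b set) \<Rightarrow> nat \<Rightarrow> int \<Rightarrow> ('a, 'b) gen \<Rightarrow> ('a, 'b) formal_sum" where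
  "expand_gen Z 0 m g = {#(m, g)#}"
| "expand_gen Z (Suc k) m g = (case g of
     Proper v \<Rightarrow>
       if regular_vertex G v then \<Sum>e\<in>out_arcs G v. expand_gen Z k (m + 1) (Proper (head G e))
       else if infinite_emitter G v \<and> Z v \<noteq> {} then
         {#(m, Improper v (Z v))#} + (\<Sum>e\<in>Z v. expand_gen Z k (m + 1) (Proper (head G e)))
       else {#(m, g)#}
   | Improper v W \<Rightarrow>
       if infinite_emitter G v \<and> W \<subseteq> Z v then
         {#(m, Improper v (Z v))#} + (\<Sum>e\<in>Z v - W. expand_gen Z k (m + 1) (Proper (head G e)))
       else {#(m, g)#})"

text \<open>The conversion \<open>nat\<close> leaves monomials of degree above \<open>N\<close>
  unchanged; hence the lower bounds on \<open>N\<close> in later statements.\<close>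

definition expand :: "('a \<Rightarrow> 'b set) \<Rightarrow> int \<Rightarrow> ('a, 'b) formal_sum \<Rightarrow> ('a, 'b) formal_sum" where
  "expand Z N a = (\<Sum>x\<in>#a. expand_gen Z (nat (N - fst x)) (fst x) (snd x))"

lemma expand_simps [simp]:
  "expand Z N 0 = 0" "expand Z N {#} = {#}" "expand Z N (a + b) = expand Z N a + expand Z N b"
  "expand Z N {#(m, g)#} = expand_gen Z (nat (N - m)) m g"
  "expand Z N (add_mset (m, g) a) = expand_gen Z (nat (N - m)) m g + expand Z N a"
  by (simp_all add: expand_def)

lemma expand_sum: "expand Z N (\<Sum>x\<in>A. f x) = (\<Sum>x\<in>A. expand Z N (f x))"
  by (induction A rule: infinite_finite_induct) simp_all

lemma expand_range_sum:
  "expand Z N (range_sum G m W) = (\<Sum>e\<in>W. expand_gen Z (nat (N - m)) m (Proper (head G e)))"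
  by (simp add: range_sum_def expand_sum)

lemma admissible_simps:
  "admissible (\<lambda>_. {})"
  "finite W \<Longrightarrow> W \<subseteq> out_arcs G v \<Longrightarrow> admissible ((\<lambda>_. {})(v := W))"
  "admissible Z \<Longrightarrow> admissible Z' \<Longrightarrow> admissible (\<lambda>v. Z v \<union> Z' v)"
  by (auto simp: admissible_def)

lemma expand_gen_shift: "shift n (expand_gen Z k m g) = expand_gen Z k (n + m) g"
  by (induction k arbitrary: m g) (auto simp: shift_sum add.assoc split: gen.splits)

lemma expand_shift: "expand Z N (shift n a) = shift n (expand Z (N - n) a)"
proof (induction a)
  case (add x a)
  have "shift n (add_mset x a) = add_mset (n + fst x, snd x) (shift n a)"
    by (simp add: shift_def case_prod_unfold)
  then show ?case using add
    by (cases x) (simp add: expand_gen_shift algebra_simps)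
qed simp

lemma expand_single_step:
  assumes "N \<ge> m + 1"
  shows "expand Z N {#(m, g)#} = expand_gen Z (Suc (nat (N - (m + 1)))) m g"
proof -
  have "nat (N - m) = Suc (nat (N - (m + 1)))" using assms by simp
  then show ?thesis by (simp only: expand_simps(4))
qed

lemma regular_not_emitter: "regular_vertex G v \<Longrightarrow> \<not> infinite_emitter G v"
  by (simp add: regular_vertex_def infinite_emitter_def)

lemma sum_minus_union:
  assumes "finite B" "A \<subseteq> B"
  shows "(\<Sum>e\<in>B. f e :: 'x multiset) = (\<Sum>e\<in>B - A. f e) + (\<Sum>e\<in>A. f e)"
  using assms by (simp add: sum.subset_diff)

text \<open>One unfolding of the left side reproduces the right side. For \<open>A2\<close> and
  \<open>A3\<close> this amounts to splitting the edges of \<open>Z v\<close> still to be released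
  into those that the step releases and the rest, which requires the set of the step to lie in
  \<open>Z v\<close>.\<close>

lemma step1_expand:
  assumes "step1 G a b"
  shows "\<exists>N0 Z0. admissible Z0 \<and> (\<forall>N\<ge>N0. \<forall>Z. admissible Z \<longrightarrow> (\<forall>v. Z0 v \<subseteq> Z v) \<longrightarrow>
           expand Z N a = expand Z N b)"
  using assms
proof cases
  case (A1 c v m)
  have "expand Z N {#(m, Proper v)#} = expand Z N (range_sum G (m + 1) (out_arcs G v))"
    if "N \<ge> m + 1" for Z N
    unfolding expand_single_step[OF that] expand_range_sum using A1 by simp
  then show ?thesis using A1 admissible_simps(1)
    by (intro exI[of _ "m + 1"] exI[of _ "\<lambda>_. {}"]) (simp del: expand_simps(4))
next
  case (A2 c v W m)
  have "expand Z N {#(m, Proper v)#} = expand Z N ({#(m, Improper v W)#} + range_sum G (m + 1) W)"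
    if "N \<ge> m + 1" "admissible Z" "W \<subseteq> Z v" for Z N
  proof -
    have fin: "finite (Z v)" using that(2) A2 by (auto simp: admissible_def)
    show ?thesis
      unfolding expand_simps(3) expand_single_step[OF that(1)] expand_range_sum
      using A2 that regular_not_emitter[of v] sum_minus_union[OF fin that(3)] by auto
  qed
  note * = this
  show ?thesis
  proof (intro exI conjI allI impI)
    \<comment> \<open>The lower bound prescribes \<open>W\<close> at the one emitter involved and
      nothing elsewhere.\<close>
    show "admissible ((\<lambda>_. {})(v := W))" using A2 admissible_simps by blast
    fix N Z assume N: "m + 1 \<le> N" and Z: "admissible Z" "\<forall>u. ((\<lambda>_. {})(v := W)) u \<subseteq> Z u"
    have "W \<subseteq> Z v" using Z(2)[rule_format, of v] by simp
    then show "expand Z N a = expand Z N b"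
      unfolding A2 using *[OF N Z(1)] by (simp add: add.assoc)
  qed
next
  case (A3 c v V W m)
  have "expand Z N {#(m, Improper v V)#} = expand Z N ({#(m, Improper v W)#} + range_sum G (m + 1) (W - V))"
    if "N \<ge> m + 1" "admissible Z" "W \<subseteq> Z v" for Z N
  proof -
    have fin: "finite (Z v)" using that(2) A3 by (auto simp: admissible_def)
    have eq: "Z v - V - (W - V) = Z v - W" "W - V \<subseteq> Z v - V" "V \<subseteq> Z v" using A3 that(3) by auto
    show ?thesis
      unfolding expand_simps(3) expand_single_step[OF that(1)] expand_range_sum
      using A3 that eq(3) sum_minus_union[of "Z v - V", OF _ eq(2)] fin by (simp add: eq(1))
  qed
  note * = this
  show ?thesis
  proof (intro exI conjI allI impI)
    show "admissible ((\<lambda>_. {})(v := W))" using A3 admissible_simps by blast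
    fix N Z assume N: "m + 1 \<le> N" and Z: "admissible Z" "\<forall>u. ((\<lambda>_. {})(v := W)) u \<subseteq> Z u"
    have "W \<subseteq> Z v" using Z(2)[rule_format, of v] by simp
    then show "expand Z N a = expand Z N b"
      unfolding A3 using *[OF N Z(1)] by (simp add: add.assoc)
  qed
qed

text \<open>Demanding equality for all larger levels and sets lets two thresholds be joined by
  maximum and union, as transitivity and addition require. A shift translates levels and moves the
  threshold accordingly.\<close>

lemma gcong_expand:
  assumes "gcong G a b"
  shows "\<exists>N0 Z0. admissible Z0 \<and> (\<forall>N\<ge>N0. \<forall>Z. admissible Z \<longrightarrow> (\<forall>v. Z0 v \<subseteq> Z v) \<longrightarrow>
           expand Z N a = expand Z N b)"
  using assms
proof induction
  case (step a b)
  then show ?case by (rule step1_expand)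
next
  case (refl a)
  then show ?case using admissible_simps(1) by blast
next
  case (sym a b)
  then show ?case by metis
next
  case (trans a b c)
  then obtain N1 Z1 N2 Z2 where "admissible Z1" "admissible Z2"
    "\<forall>N\<ge>N1. \<forall>Z. admissible Z \<longrightarrow> (\<forall>v. Z1 v \<subseteq> Z v) \<longrightarrow> expand Z N a = expand Z N b"
    "\<forall>N\<ge>N2. \<forall>Z. admissible Z \<longrightarrow> (\<forall>v. Z2 v \<subseteq> Z v) \<longrightarrow> expand Z N b = expand Z N c" by metis
  then show ?case
    by (intro exI[of _ "max N1 N2"] exI[of _ "\<lambda>v. Z1 v \<union> Z2 v"]) (simp add: admissible_simps(3))
next
  case (add a b c d)
  then obtain N1 Z1 N2 Z2 where "admissible Z1" "admissible Z2"
    "\<forall>N\<ge>N1. \<forall>Z. admissible Z \<longrightarrow> (\<forall>v. Z1 v \<subseteq> Z v) \<longrightarrow> expand Z N a = expand Z N b"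
    "\<forall>N\<ge>N2. \<forall>Z. admissible Z \<longrightarrow> (\<forall>v. Z2 v \<subseteq> Z v) \<longrightarrow> expand Z N c = expand Z N d" by metis
  then show ?case
    by (intro exI[of _ "max N1 N2"] exI[of _ "\<lambda>v. Z1 v \<union> Z2 v"]) (simp add: admissible_simps(3))
next
  case (shift a b n)
  then obtain N1 Z1 where "admissible Z1"
    "\<forall>N\<ge>N1. \<forall>Z. admissible Z \<longrightarrow> (\<forall>v. Z1 v \<subseteq> Z v) \<longrightarrow> expand Z N a = expand Z N b" by metis
  then show ?case
    by (intro exI[of _ "N1 + n"] exI[of _ Z1]) (simp add: expand_shift)
qed

text \<open>Each unfolding is an instance of \<open>A1\<close>, \<open>A2\<close> or
  \<open>A3\<close>, so expansion never leaves the congruence class; the unchanged branches are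
  reflexivity.\<close>

lemma gcong_expand_gen:
  assumes Z: "admissible Z" and g: "g \<in> gens G"
  shows "gcong G {#(m, g)#} (expand_gen Z k m g)"
  using g
proof (induction k arbitrary: m g)
  case 0
  then show ?case by (auto intro: gcong.refl)
next
  case (Suc k)
  have heads: "gcong G (range_sum G (m + 1) W) (\<Sum>e\<in>W. expand_gen Z k (m + 1) (Proper (head G e)))"
    if "W \<subseteq> out_arcs G v" for W v
    unfolding range_sum_def using that by (intro gcong_sum Suc.IH) (auto dest: out_arcs_head)
  have q: "gcong G x (y + u) \<Longrightarrow> gcong G u w \<Longrightarrow> gcong G x (y + w)" for x y u w
    using gcong.trans[OF _ gcong.add[OF gcong.refl[of y]]] gcong_free[of x "y + u"] by simp
  show ?case
  proof (cases g)
    case (Proper v)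
    then have v: "v \<in> verts G" using Suc.prems by simp
    consider "regular_vertex G v" | "\<not> regular_vertex G v" "infinite_emitter G v" "Z v \<noteq> {}"
      | "\<not> regular_vertex G v" "\<not> (infinite_emitter G v \<and> Z v \<noteq> {})" by blast
    then show ?thesis
    proof cases
      case 1
      then show ?thesis using Proper gcong.trans[OF gcong_A1 heads[of "out_arcs G v" v]] by simp
    next
      case 2
      have "finite (Z v)" "Z v \<subseteq> out_arcs G v" using Z 2 by (auto simp: admissible_def)
      then show ?thesis using Proper 2 q[OF gcong_A2[of v "Z v" m] heads[of "Z v" v]] by simp
    next
      case 3
      then show ?thesis using Proper Suc.prems by (auto intro: gcong.refl)
    qed
  next
    case (Improper v W)
    then have W: "infinite_emitter G v" "finite W" "W \<noteq> {}" "W \<subseteq> out_arcs G v" using Suc.prems by auto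
    have Zv: "finite (Z v)" "Z v \<subseteq> out_arcs G v" using Z W by (auto simp: admissible_def)
    consider "W = Z v" | "W \<subset> Z v" | "\<not> W \<subseteq> Z v" by blast
    then show ?thesis
    proof cases
      case 2
      then show ?thesis using Improper W Zv q[OF gcong_A3[of v W "Z v" m] heads[of "Z v - W" v]] by auto
    qed (use Improper W gcong.refl[of "{#(m, g)#}" G] Suc.prems in auto)
  qed
qed

lemma gcong_expand_self:
  assumes "admissible Z" "a \<in> free_gamma G"
  shows "gcong G a (expand Z N a)"
  using assms(2)
proof (induction a)
  case empty
  then show ?case by (auto intro: gcong.refl)
next
  case (add x a)
  obtain m g where x: "x = (m, g)" by (cases x)
  then have "g \<in> gens G" "a \<in> free_gamma G" using add.prems by auto
  then show ?case
    using gcong.add[OF gcong_expand_gen[OF assms(1), of g m "nat (N - m)"] add.IH] x by simp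
qed

text \<open>Expansion is additive, so \<open>c\<close> can be cancelled in the free monoid of
  multisets. The expansions of \<open>a\<close> and \<open>b\<close> then coincide, and each is
  congruent to its origin.\<close>

lemma gcong_cancel:
  assumes "gcong G (a + c) (b + c)"
  shows "gcong G a b"
proof -
  obtain N Z where Z: "admissible Z" and "expand Z N (a + c) = expand Z N (b + c)"
    using gcong_expand[OF assms] by blast
  then have "expand Z N a = expand Z N b" by simp
  moreover have "a \<in> free_gamma G" "b \<in> free_gamma G" using gcong_free[OF assms] by auto
  ultimately show ?thesis
    using gcong_expand_self[OF Z, of a N] gcong_expand_self[OF Z, of b N]
    by (metis gcong.sym gcong.trans)
qed

section \<open>Supports and hereditary saturated sets\<close>

definition supported :: "'a set \<Rightarrow> ('a, 'b) formal_sum \<Rightarrow> bool" where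
  "supported H a \<longleftrightarrow> (\<forall>x\<in>#a. base (snd x) \<in> H)"

lemma supported_simps [simp]:
  "supported H 0" "supported H {#}" "supported H (a + b) \<longleftrightarrow> supported H a \<and> supported H b"
  "supported H {#(m, g)#} \<longleftrightarrow> base g \<in> H"
  "supported H (add_mset (m, g) a) \<longleftrightarrow> base g \<in> H \<and> supported H a"
  "supported H (shift n a) \<longleftrightarrow> supported H a"
  by (auto simp: supported_def shift_def)

lemma supported_range_sum:
  "finite Z \<Longrightarrow> supported H (range_sum G m Z) \<longleftrightarrow> (\<forall>e\<in>Z. head G e \<in> H)"
  unfolding range_sum_def by (induction Z rule: finite_induct) auto

text \<open>\<open>A1\<close> preserves supports forwards by heredity and backwards by saturation.
  In \<open>A2\<close> and \<open>A3\<close> a generator based at \<open>v\<close> is present on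
  both sides, so heredity suffices.\<close>

lemma gcong_supported:
  assumes H: "hereditary_saturated G H" and "gcong G a b"
  shows "supported H a \<longleftrightarrow> supported H b"
  using assms(2)
proof induction
  have her: "head G e \<in> H" if "e \<in> out_arcs G v" "v \<in> H" for e v
    using H that unfolding hereditary_saturated_def by (auto simp: out_arcs_def)
  case (step a b)
  then show ?case
  proof cases
    case (A1 c v m)
    have "(\<forall>e\<in>out_arcs G v. head G e \<in> H) \<longleftrightarrow> v \<in> H"
      using H A1 her unfolding hereditary_saturated_def by blast
    then show ?thesis using A1 by (auto simp: supported_range_sum regular_vertex_def)
  next
    case (A2 c v Z m)
    then show ?thesis using her[of _ v] by (auto simp: supported_range_sum)
  next
    case (A3 c v Z W m)
    then show ?thesis using her[of _ v] by (auto simp: supported_range_sum)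
  qed
qed auto

lemma hereditary_saturated_empty: "hereditary_saturated G {}"
  by (auto simp: hereditary_saturated_def regular_vertex_def)

text \<open>Invariance of supports is applied to the empty set of vertices, in which only zero is
  supported.\<close>

lemma gcong_zero:
  assumes "gcong G a 0" shows "a = 0"
proof -
  have "supported {} a" using gcong_supported[OF hereditary_saturated_empty assms] by simp
  then show ?thesis by (metis empty_iff multiset_nonemptyE supported_def zero_multiset_def)
qed

section \<open>The graph monoid as a quotient\<close>

abbreviation "cls a \<equiv> gcong_rel G `` {a}"
abbreviation "MM \<equiv> graph_monoid G"

lemma gcong_equiv: "equiv (free_gamma G) (gcong_rel G)"
proof (rule equivI)
  show "gcong_rel G \<subseteq> free_gamma G \<times> free_gamma G"
    using gcong_free by (auto simp: gcong_rel_def)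
  show "refl_on (free_gamma G) (gcong_rel G)"
    by (auto simp: refl_on_def gcong_rel_def intro: gcong.refl)
  show "sym (gcong_rel G)" by (auto simp: sym_def gcong_rel_def intro: gcong.sym)
  show "trans (gcong_rel G)" by (auto simp: trans_def gcong_rel_def intro: gcong.trans)
qed

lemma cls_eq: "a \<in> free_gamma G \<Longrightarrow> b \<in> free_gamma G \<Longrightarrow> cls a = cls b \<longleftrightarrow> gcong G a b"
  using eq_equiv_class_iff[OF gcong_equiv] by (simp add: gcong_rel_def)

lemma cls_eqI: "gcong G a b \<Longrightarrow> cls a = cls b"
  using cls_eq gcong_free by blast

lemma cls_ne: "a \<in> free_gamma G \<Longrightarrow> cls a \<noteq> {}"
  by (auto simp: gcong_rel_def intro: gcong.refl)

lemma MM_carrier: "carrier MM = cls ` free_gamma G"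
  by (auto simp: graph_monoid_def quotient_def)

lemma MM_one: "\<one>\<^bsub>MM\<^esub> = cls 0"
  by (simp add: graph_monoid_def)

lemma MM_mult:
  assumes "a \<in> free_gamma G" "b \<in> free_gamma G"
  shows "cls a \<otimes>\<^bsub>MM\<^esub> cls b = cls (a + b)"
  unfolding graph_monoid_def monoid.simps
proof (intro UN_const_on cls_ne assms)
  fix x y assume "x \<in> cls a" "y \<in> cls b"
  then have "gcong G (a + b) (x + y)" by (auto simp: gcong_rel_def intro: gcong.add)
  then show "cls (x + y) = cls (a + b)" using cls_eqI by metis
qed

lemma MM_act:
  assumes "a \<in> free_gamma G"
  shows "act MM n (cls a) = cls (shift n a)"
  unfolding graph_monoid_def gamma_monoid.simps
proof (intro UN_const_on cls_ne assms)
  fix x assume "x \<in> cls a"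
  then have "gcong G (shift n a) (shift n x)" by (auto simp: gcong_rel_def intro: gcong.shift)
  then show "cls (shift n x) = cls (shift n a)" using cls_eqI by metis
qed

lemma MM_le:
  assumes "a \<in> free_gamma G" "b \<in> free_gamma G"
  shows "gm_le MM (cls a) (cls b) \<longleftrightarrow> (\<exists>c\<in>free_gamma G. gcong G (a + c) b)"
  using assms unfolding gm_le_def MM_carrier by (simp add: MM_mult cls_eq)

lemma cancel_gamma_monoid_MM: "cancel_gamma_monoid MM"
proof -
  interpret comm_monoid MM
  proof (rule comm_monoidI)
    fix x y assume "x \<in> carrier MM" "y \<in> carrier MM"
    then show "x \<otimes>\<^bsub>MM\<^esub> y \<in> carrier MM" "x \<otimes>\<^bsub>MM\<^esub> y = y \<otimes>\<^bsub>MM\<^esub> x"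
      unfolding MM_carrier by (auto simp: MM_mult add.commute)
  next
    show "\<one>\<^bsub>MM\<^esub> \<in> carrier MM" unfolding MM_carrier MM_one by simp
  next
    fix x y z assume "x \<in> carrier MM" "y \<in> carrier MM" "z \<in> carrier MM"
    then show "x \<otimes>\<^bsub>MM\<^esub> y \<otimes>\<^bsub>MM\<^esub> z = x \<otimes>\<^bsub>MM\<^esub> (y \<otimes>\<^bsub>MM\<^esub> z)"
      unfolding MM_carrier by (auto simp: MM_mult add.assoc)
  next
    fix x assume "x \<in> carrier MM"
    then show "\<one>\<^bsub>MM\<^esub> \<otimes>\<^bsub>MM\<^esub> x = x" unfolding MM_carrier MM_one by (auto simp: MM_mult)
  qed
  show ?thesis
  proof (unfold_locales, goal_cases)
    case (1 a n) then show ?case unfolding MM_carrier by (auto simp: MM_act)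
  next
    case (2 a b n) then show ?case unfolding MM_carrier by (auto simp: MM_act MM_mult)
  next
    case (3 a m n) then show ?case unfolding MM_carrier by (auto simp: MM_act shift_shift)
  next
    case (4 a) then show ?case unfolding MM_carrier by (auto simp: MM_act shift_0_left)
  next
    case (5 a b c)
    then obtain a' b' c' where "a' \<in> free_gamma G" "b' \<in> free_gamma G" "c' \<in> free_gamma G"
      "a = cls a'" "b = cls b'" "c = cls c'" unfolding MM_carrier by blast
    then show ?case using 5(4) gcong_cancel[of a' c' b'] by (simp add: MM_mult cls_eq)
  next
    case (6 a b) then show ?case unfolding MM_carrier MM_one by (auto simp: MM_mult cls_eq dest!: gcong_zero)
  qed
qed

section \<open>Order relations along edges, and simplicity\<close>

lemma set_range_sum: "finite Z \<Longrightarrow> set_mset (range_sum G m Z) = (\<lambda>e. (m, Proper (head G e))) ` Z"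
  unfolding range_sum_def by (induction Z rule: finite_induct) auto

text \<open>Whether the remainder vanishes is recorded because it later separates periodic from
  aperiodic elements. At an infinite emitter, \<open>A2\<close> with the set \<open>{e}\<close>
  leaves an improper vertex behind, so the remainder is never zero there.\<close>

lemma arc_le:
  assumes e: "e \<in> arcs G"
  shows "\<exists>c\<in>free_gamma G. gcong G {#(m, Proper (tail G e))#} ({#(m + 1, Proper (head G e))#} + c) \<and>
     (out_arcs G (tail G e) \<noteq> {e} \<longrightarrow> c \<noteq> 0) \<and> (out_arcs G (tail G e) = {e} \<longrightarrow> c = 0)"
proof -
  let ?v = "tail G e"
  have ev: "e \<in> out_arcs G ?v" "?v \<in> verts G" using e by auto
  show ?thesis
  proof (cases "finite (out_arcs G ?v)")
    case True
    then have r: "regular_vertex G ?v" using ev unfolding regular_vertex_def by blast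
    let ?c = "range_sum G (m + 1) (out_arcs G ?v - {e})"
    have "range_sum G (m + 1) (out_arcs G ?v) = {#(m + 1, Proper (head G e))#} + ?c"
      unfolding range_sum_def using True ev(1) by (simp add: sum.remove)
    moreover have "?c \<in> free_gamma G" using range_sum_free[of "out_arcs G ?v - {e}" ?v] by blast
    moreover have "?c \<noteq> 0" if "out_arcs G ?v \<noteq> {e}"
    proof -
      have "out_arcs G ?v - {e} \<noteq> {}" using that ev(1) by blast
      then have "set_mset ?c \<noteq> {}" using True by (simp only: set_range_sum finite_Diff image_is_empty) simp
      then show ?thesis by auto
    qed
    moreover have "?c = 0" if "out_arcs G ?v = {e}" using that by (simp add: range_sum_def)
    ultimately show ?thesis using gcong_A1[OF r, of m] by metis
  next
    case False
    then have i: "infinite_emitter G ?v" using ev unfolding infinite_emitter_def by blast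
    have "out_arcs G ?v \<noteq> {e}" using False by (metis finite.simps)
    moreover have "gcong G {#(m, Proper ?v)#} ({#(m + 1, Proper (head G e))#} + {#(m, Improper ?v {e})#})"
      using gcong_A2[OF i, of "{e}" m] ev by (simp add: range_sum_def add_mset_commute)
    ultimately show ?thesis using i ev
      by (intro bexI[of _ "{#(m, Improper ?v {e})#}"]) auto
  qed
qed

lemma awalk_le:
  assumes "awalk u p v"
  shows "\<exists>c\<in>free_gamma G. gcong G {#(m, Proper u)#} ({#(m + int (length p), Proper v)#} + c) \<and>
     (c = 0 \<longleftrightarrow> exitless G p)"
  using assms
proof (induction p arbitrary: u m)
  case Nil
  then show ?case by (intro bexI[of _ 0]) (auto simp: awalk_Nil_iff exitless_def intro: gcong.refl)
next
  case (Cons e p)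
  then have e: "e \<in> arcs G" "u = tail G e" "awalk (head G e) p v" by (auto simp: awalk_Cons_iff)
  obtain c where c: "c \<in> free_gamma G" "gcong G {#(m, Proper u)#} ({#(m + 1, Proper (head G e))#} + c)"
     "c = 0 \<longleftrightarrow> out_arcs G u = {e}" using arc_le[OF e(1), of m] e(2) by blast
  obtain d where d: "d \<in> free_gamma G"
    "gcong G {#(m + 1, Proper (head G e))#} ({#(m + 1 + int (length p), Proper v)#} + d)"
     "d = 0 \<longleftrightarrow> exitless G p" using Cons.IH[OF e(3), of "m + 1"] by blast
  have "gcong G {#(m, Proper u)#} ({#(m + int (length (e # p)), Proper v)#} + (d + c))"
    using gcong.trans[OF c(2) gcong.add[OF d(2) gcong.refl[OF c(1)]]] by (simp add: algebra_simps)
  moreover have "d + c = 0 \<longleftrightarrow> exitless G (e # p)"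
    using c(3) d(3) e(2) by (auto simp: exitless_def)
  ultimately show ?case using c(1) d(1) by (intro bexI[of _ "d + c"]) auto
qed

text \<open>A finite \<open>Z\<close> misses some edge \<open>e\<close>, and \<open>A3\<close> with
  \<open>insert e Z\<close> releases its range. An ideal containing an improper vertex therefore
  also contains a proper one.\<close>

lemma improper_le:
  assumes "Improper v Z \<in> gens G"
  shows "\<exists>c\<in>free_gamma G. gcong G {#(m, Proper v)#} ({#(m, Improper v Z)#} + c)"
    and "\<exists>e\<in>out_arcs G v. \<exists>c\<in>free_gamma G. gcong G {#(m, Improper v Z)#} ({#(m + 1, Proper (head G e))#} + c)"
proof -
  have Z: "infinite_emitter G v" "finite Z" "Z \<noteq> {}" "Z \<subseteq> out_arcs G v" using assms by auto
  show "\<exists>c\<in>free_gamma G. gcong G {#(m, Proper v)#} ({#(m, Improper v Z)#} + c)"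
    using gcong_A2[OF Z] range_sum_free[OF Z(4)] by blast
  obtain e where e: "e \<in> out_arcs G v" "e \<notin> Z"
    using Z by (metis infinite_emitter_def finite_subset subsetI)
  then have "insert e Z - Z = {e}" by blast
  then have "gcong G {#(m, Improper v Z)#} ({#(m, Improper v (insert e Z))#} + {#(m + 1, Proper (head G e))#})"
    using gcong_A3[of v Z "insert e Z" m] Z e by (auto simp: range_sum_def psubset_eq)
  then show "\<exists>e\<in>out_arcs G v. \<exists>c\<in>free_gamma G. gcong G {#(m, Improper v Z)#} ({#(m + 1, Proper (head G e))#} + c)"
    using Z e by (intro bexI[of _ e] bexI[of _ "{#(m, Improper v (insert e Z))#}"]) (auto simp: add.commute)
qed

text \<open>A set \<open>H\<close> gives the ideal of the classes supported in it, an ideal gives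
  the set of its vertices. In general an ideal is not determined by its vertices, because improper
  vertices may be added at breaking vertices; in the two extreme cases it is, by
  \<open>improper_le\<close>.\<close>

lemma simple_monoid_iff: "simple_gamma_monoid MM \<longleftrightarrow> hs_simple G"
proof
  assume S: "simple_gamma_monoid MM"
  show "hs_simple G" unfolding hs_simple_def
  proof (intro conjI allI impI)
    show "verts G \<noteq> {}"
    proof
      assume "verts G = {}"
      then have "a = 0" if "a \<in> free_gamma G" for a
        using that gens_base by (auto simp: free_gamma_iff intro: multiset_eqI)
      then have "free_gamma G = {0}" by (auto simp: free_gamma_simps(1))
      then show False using S unfolding simple_gamma_monoid_def MM_carrier MM_one by simp
    qed
    fix H assume H: "hereditary_saturated G H"
    define I where "I = cls ` {a \<in> free_gamma G. supported H a}"
    have I_iff: "cls a \<in> I \<longleftrightarrow> supported H a" if "a \<in> free_gamma G" for a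
      unfolding I_def using that gcong_supported[OF H] by (auto simp: cls_eq)
    have "gamma_order_ideal MM I"
      unfolding gamma_order_ideal_def
    proof (intro conjI allI ballI impI)
      show "submonoid I MM"
        by (rule submonoid.intro) (auto simp: I_def MM_carrier MM_mult MM_one)
      show "act MM n a \<in> I" if "a \<in> I" for n a
        using that by (auto simp: I_def MM_act)
      fix a b assume ab: "a \<in> carrier MM" "b \<in> I" "gm_le MM a b"
      obtain x y where xy: "x \<in> free_gamma G" "y \<in> free_gamma G" "a = cls x" "b = cls y" "supported H y"
        using ab unfolding MM_carrier I_def by blast
      then obtain c where "gcong G (x + c) y" using ab(3) by (auto simp: MM_le)
      then have "supported H x" using gcong_supported[OF H] xy by fastforce
      then show "a \<in> I" using xy by (auto simp: I_def)
    qed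
    then have "I = {\<one>\<^bsub>MM\<^esub>} \<or> I = carrier MM" using S unfolding simple_gamma_monoid_def by blast
    then show "H = {} \<or> H = verts G"
    proof
      assume I: "I = {\<one>\<^bsub>MM\<^esub>}"
      have "v \<notin> H" for v
      proof
        assume v: "v \<in> H"
        then have vf: "{#(0, Proper v)#} \<in> free_gamma G" using H by (auto simp: hereditary_saturated_def)
        then have "cls {#(0, Proper v)#} \<in> I" using v by (subst I_iff) auto
        then have "gcong G {#(0, Proper v)#} 0" using I vf by (simp add: MM_one cls_eq)
        then show False using gcong_zero by fastforce
      qed
      then show ?thesis by blast
    next
      assume I: "I = carrier MM"
      have "v \<in> H" if "v \<in> verts G" for v
      proof -
        have vf: "{#(0, Proper v)#} \<in> free_gamma G" using that by simp
        then have "cls {#(0, Proper v)#} \<in> I" unfolding I MM_carrier by blast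
        then show ?thesis using I_iff[OF vf] by simp
      qed
      then show ?thesis using H by (auto simp: hereditary_saturated_def)
    qed
  qed
next
  assume T: "hs_simple G"
  interpret MM: cancel_gamma_monoid MM by (rule cancel_gamma_monoid_MM)
  show "simple_gamma_monoid MM" unfolding simple_gamma_monoid_def
  proof (intro conjI allI impI)
    obtain v where v: "v \<in> verts G" using T unfolding hs_simple_def by blast
    then have "cls {#(0, Proper v)#} \<in> carrier MM" "cls {#(0, Proper v)#} \<noteq> \<one>\<^bsub>MM\<^esub>"
      using gcong_zero[of "{#(0, Proper v)#}"] by (auto simp: MM_carrier MM_one cls_eq)
    then show "carrier MM \<noteq> {\<one>\<^bsub>MM\<^esub>}" by blast
  next
    fix I assume I: "gamma_order_ideal MM I"
    have IC: "I \<subseteq> carrier MM" and one: "\<one>\<^bsub>MM\<^esub> \<in> I"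
      and mult: "\<And>a b. a \<in> I \<Longrightarrow> b \<in> I \<Longrightarrow> a \<otimes>\<^bsub>MM\<^esub> b \<in> I"
      and act: "\<And>n a. a \<in> I \<Longrightarrow> act MM n a \<in> I"
      and le: "\<And>a b. a \<in> carrier MM \<Longrightarrow> b \<in> I \<Longrightarrow> gm_le MM a b \<Longrightarrow> a \<in> I"
      using I unfolding gamma_order_ideal_def submonoid_def by auto
    have down: "cls a \<in> I" if "gcong G b (a + c)" "cls b \<in> I" for a b c
    proof -
      have f: "a \<in> free_gamma G" "b \<in> free_gamma G" "c \<in> free_gamma G" using gcong_free[OF that(1)] by auto
      then have "gm_le MM (cls a) (cls b)" using that(1) by (auto simp: MM_le intro: gcong.sym)
      then show ?thesis using le f that(2) by (auto simp: MM_carrier)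
    qed
    \<comment> \<open>Closure under the action makes membership of a generator independent of its
      degree.\<close>
    have sh: "cls {#(m, g)#} \<in> I" if "cls {#(n, g)#} \<in> I" "g \<in> gens G" for m n g
      using act[OF that(1), of "m - n"] that(2) by (simp add: MM_act)
    have plusI: "cls (a + b) \<in> I" if "cls a \<in> I" "cls b \<in> I" "a \<in> free_gamma G" "b \<in> free_gamma G" for a b
      using mult[OF that(1,2)] that by (simp add: MM_mult)
    define H where "H = {v \<in> verts G. cls {#(0, Proper v)#} \<in> I}"
    have HI: "cls {#(m, Proper v)#} \<in> I" if "v \<in> H" for m v
      using that sh[of 0 "Proper v" m] by (simp add: H_def)
    have IH: "v \<in> H" if "cls {#(m, Proper v)#} \<in> I" "v \<in> verts G" for m v
      using that sh[of m "Proper v" 0] by (simp add: H_def)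
    have arcH: "head G e \<in> H" if e: "e \<in> arcs G" "cls {#(m, Proper (tail G e))#} \<in> I" for e m
    proof -
      obtain c where "gcong G {#(m, Proper (tail G e))#} ({#(m + 1, Proper (head G e))#} + c)"
        using arc_le[OF e(1), of m] by blast
      then have "cls {#(m + 1, Proper (head G e))#} \<in> I" by (rule down[OF _ e(2)])
      then show ?thesis using IH e(1) by simp
    qed
    have rsI: "cls (range_sum G m Z) \<in> I" if "finite Z" "Z \<subseteq> out_arcs G v" "\<forall>e\<in>Z. head G e \<in> H" for Z m v
      using that
    proof (induction Z rule: finite_induct)
      case empty
      then show ?case using one by (simp add: range_sum_def MM_one)
    next
      case (insert e Z)
      have "range_sum G m (insert e Z) = {#(m, Proper (head G e))#} + range_sum G m Z"
        using insert by (simp add: range_sum_def)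
      moreover have "cls {#(m, Proper (head G e))#} \<in> I"
        using insert HI by simp
      ultimately show ?case
        using plusI[of "{#(m, Proper (head G e))#}" "range_sum G m Z"] insert range_sum_free[of Z v m]
        by (auto simp: out_arcs_head)
    qed
    have "hereditary_saturated G H" unfolding hereditary_saturated_def
    proof (intro conjI ballI allI impI)
      show "H \<subseteq> verts G" by (auto simp: H_def)
      show "head G e \<in> H" if "e \<in> arcs G" "tail G e \<in> H" for e
        using arcH[of e 0] that by (auto simp: H_def)
      fix v assume v: "regular_vertex G v" "\<forall>e\<in>out_arcs G v. head G e \<in> H"
      then have "cls (range_sum G (0 + 1) (out_arcs G v)) \<in> I"
        using rsI[of "out_arcs G v" v] by (auto simp: regular_vertex_def)
      then show "v \<in> H" using cls_eqI[OF gcong_A1[OF v(1), of 0]] v(1) IH[of 0 v] by (simp add: regular_vertex_def)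
    qed
    then consider "H = {}" | "H = verts G" using T unfolding hs_simple_def by blast
    then show "I = {\<one>\<^bsub>MM\<^esub>} \<or> I = carrier MM"
    proof cases
      case 1
      have noimp: "cls {#(m, Improper v Z)#} \<notin> I" if Z: "Improper v Z \<in> gens G" for m v Z
      proof
        assume I: "cls {#(m, Improper v Z)#} \<in> I"
        obtain e c where e: "e \<in> out_arcs G v" "gcong G {#(m, Improper v Z)#} ({#(m + 1, Proper (head G e))#} + c)"
          using improper_le(2)[OF Z] by blast
        then have "cls {#(m + 1, Proper (head G e))#} \<in> I" using down I by blast
        then have "head G e \<in> H" using IH out_arcs_head[OF e(1)] by blast
        then show False using 1 by blast
      qed
      have noprop: "cls {#(m, Proper v)#} \<notin> I" if "v \<in> verts G" for m v
        using IH[of m v] that 1 by blast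
      have "a = 0" if "a \<in> free_gamma G" "cls a \<in> I" for a
      proof (cases a)
        case (add x b)
        obtain m g where x: "x = (m, g)" by (cases x)
        have g: "g \<in> gens G" using that(1) add x by simp
        have "gcong G a ({#(m, g)#} + b)" using that(1) add x by (auto intro: gcong.refl)
        then have "cls {#(m, g)#} \<in> I" using down that(2) by blast
        then show ?thesis using noimp noprop g by (cases g) auto
      qed simp
      then have "I \<subseteq> {\<one>\<^bsub>MM\<^esub>}" using IC by (auto simp: MM_carrier MM_one)
      then show ?thesis using one by blast
    next
      case 2
      have gen: "cls {#(m, g)#} \<in> I" if g: "g \<in> gens G" for m g
      proof (cases g)
        case (Proper v)
        then show ?thesis using g 2 HI by simp
      next
        case (Improper v Z)
        then have "v \<in> H" using g 2 by (auto simp: infinite_emitter_def)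
        then have "cls {#(m, Proper v)#} \<in> I" by (rule HI)
        then show ?thesis using improper_le(1) g down unfolding Improper by blast
      qed
      have "cls a \<in> I" if "a \<in> free_gamma G" for a
        using that
      proof (induction a)
        case empty
        then show ?case using one by (simp add: MM_one)
      next
        case (add x a)
        obtain m g where x: "x = (m, g)" by (cases x)
        then show ?case using add add.IH gen plusI[of "{#(m, g)#}" a]
          by simp
      qed
      then have "carrier MM \<subseteq> I" by (auto simp: MM_carrier)
      then show ?thesis using IC by blast
    qed
  qed
qed

end

section \<open>Periodic and aperiodic elements\<close>

lemma in_sum_multiset: "x \<in># (\<Sum>e\<in>W. f e) \<Longrightarrow> \<exists>e\<in>W. x \<in># f e"
  by (induction W rule: infinite_finite_induct) auto

lemma size_sum_mset_ge: "(\<And>x. x \<in># b \<Longrightarrow> f x \<ge> (1::nat)) \<Longrightarrow> (\<Sum>x\<in>#b. f x) \<ge> size b"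
  by (induction b) fastforce+

lemma size_sum_mset_eq:
  assumes "\<And>x. x \<in># b \<Longrightarrow> f x \<ge> (1::nat)" "(\<Sum>x\<in>#b. f x) = size b" "x \<in># b"
  shows "f x = 1"
proof -
  obtain c where c: "b = add_mset x c" using assms(3) by (metis mset_add)
  have "(\<Sum>x\<in>#c. f x) \<ge> size c" using assms(1) c by (intro size_sum_mset_ge) auto
  then show ?thesis using assms(1)[of x] assms(2) c by simp
qed

lemma size_sum_multiset_set: "size (\<Sum>e\<in>W. f e :: 'c multiset) = (\<Sum>e\<in>W. size (f e))"
  by (induction W rule: infinite_finite_induct) auto

lemma size_sum_mset_multiset: "size (\<Sum>x\<in>#b. f x :: 'c multiset) = (\<Sum>x\<in>#b. size (f x))"
  by (induction b) auto

lemma shift_mono: "a \<subseteq># b \<Longrightarrow> shift n a \<subseteq># shift n b"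
  unfolding shift_def by (rule image_mset_subseteq_mono)

context wf_digraph
begin

section \<open>Walks traced by expansions\<close>

lemma expand_gen_ne: "expand_gen Z k m g \<noteq> {#}"
proof (induction k arbitrary: m g)
  case (Suc k)
  show ?case
  proof (cases g)
    case (Proper v)
    show ?thesis
    proof (cases "regular_vertex G v")
      case True
      then obtain e where e: "e \<in> out_arcs G v" "finite (out_arcs G v)" unfolding regular_vertex_def by blast
      have "(\<Sum>e\<in>out_arcs G v. expand_gen Z k (m + 1) (Proper (head G e))) =
        expand_gen Z k (m + 1) (Proper (head G e)) +
        (\<Sum>e\<in>out_arcs G v - {e}. expand_gen Z k (m + 1) (Proper (head G e)))"
        using sum.remove[OF e(2,1)] by fast
      then show ?thesis using Proper True Suc by simp
    next
      case False
      then show ?thesis using Proper by simp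
    qed
  next
    case (Improper v W)
    then show ?thesis by simp
  qed
qed simp

lemma expand_gen_stuck: "expand_gen Z k m (Improper v (Z v)) = {#(m, Improper v (Z v))#}"
  by (cases k) auto

text \<open>Improper vertices created by expansion are fixed by every further expansion, so only the
  proper ones continue, one degree higher. The bound keeps the first stage from passing the level
  \<open>N\<close>.\<close>

lemma expand_expand_gen:
  assumes "m + int k \<le> N"
  shows "expand Z N (expand_gen Z k m g) = expand_gen Z (nat (N - m)) m g"
  using assms
proof (induction k arbitrary: m g)
  case (Suc k)
  have N: "nat (N - m) = Suc (nat (N - (m + 1)))" "m + 1 + int k \<le> N" using Suc.prems by auto
  have IH: "expand Z N (expand_gen Z k (m + 1) h) = expand_gen Z (nat (N - (m + 1))) (m + 1) h" for h
    using Suc.IH[OF N(2)] .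
  show ?case
  proof (cases g)
    case (Proper v)
    consider "regular_vertex G v" | "\<not> regular_vertex G v" "infinite_emitter G v" "Z v \<noteq> {}"
      | "\<not> regular_vertex G v" "\<not> (infinite_emitter G v \<and> Z v \<noteq> {})" by blast
    then show ?thesis
    proof cases
      case 2
      then show ?thesis using Proper unfolding N(1) by (simp add: expand_sum IH expand_gen_stuck)
    qed (use Proper in \<open>simp_all add: expand_sum IH N(1)\<close>)
  next
    case (Improper v W)
    show ?thesis
    proof (cases "infinite_emitter G v \<and> W \<subseteq> Z v")
      case True
      then show ?thesis using Improper unfolding N(1) by (simp add: expand_sum IH expand_gen_stuck)
    next
      case False
      then show ?thesis using Improper by (auto simp: N(1))
    qed
  qed
qed simp

lemma expand_expand:
  assumes "N \<le> N'" "\<forall>x\<in>#a. fst x \<le> N'"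
  shows "expand Z N' (expand Z N a) = expand Z N' a"
  using assms(2)
proof (induction a)
  case (add x a)
  obtain m g where x: "x = (m, g)" by (cases x)
  have "m + int (nat (N - m)) \<le> N'" using assms(1) add.prems x by auto
  then show ?case using add x by (simp add: expand_expand_gen)
qed simp

text \<open>An expansion is a tree of edges whose leaves are the resulting monomials; the difference
  of degrees is the length of the branch. Size one means that the tree never branches. An emitter
  that is left along an edge leaves an improper vertex behind, which already gives size at least
  two.\<close>

lemma expand_gen_walk:
  assumes Z: "admissible Z" and "g \<in> gens G" "x \<in># expand_gen Z k m g"
  shows "\<exists>p. awalk (base g) p (base (snd x)) \<and> int (length p) = fst x - m \<and>
     (size (expand_gen Z k m g) = 1 \<longrightarrow> exitless G p)"
  using assms(2,3)
proof (induction k arbitrary: m g)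
  case 0
  then show ?case by (intro exI[of _ "[]"]) (auto simp: awalk_Nil_iff gens_base exitless_def)
next
  case (Suc k)
  let ?f = "\<lambda>e. expand_gen Z k (m + 1) (Proper (head G e))"
  have stay: ?case if "x = (m, h)" "base h = base g" for h
    using that Suc.prems by (intro exI[of _ "[]"]) (auto simp: awalk_Nil_iff gens_base exitless_def)
  have size_pos: "size (?f e) \<ge> 1" for e
    using expand_gen_ne[of Z k "m + 1" "Proper (head G e)"] by (metis One_nat_def Suc_leI nonempty_has_size)
  have move: "\<exists>p. awalk (base g) (e # p) (base (snd x)) \<and> int (length (e # p)) = fst x - m \<and>
     (size (?f e) = 1 \<longrightarrow> exitless G p)" if ex: "e \<in> out_arcs G (base g)" "x \<in># ?f e" for e
  proof -
    have "Proper (head G e) \<in> gens G" using out_arcs_head[OF that(1)] by simp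
    then obtain p where "awalk (head G e) p (base (snd x))" "int (length p) = fst x - (m + 1)"
      "size (?f e) = 1 \<longrightarrow> exitless G p"
      using Suc.IH[OF _ ex(2)] by auto
    then show ?thesis using that(1) by (intro exI[of _ p]) (auto simp: awalk_Cons_iff)
  qed
  have big: "size ({#y#} + (\<Sum>e\<in>W. ?f e)) \<noteq> 1" if "e \<in> W" "finite W" for e W y
  proof -
    have "size (\<Sum>e\<in>W. ?f e) \<ge> size (?f e)"
      unfolding size_sum_multiset_set using that by (meson member_le_sum zero_le)
    then show ?thesis using size_pos[of e] by simp
  qed
  have emitter: ?case
    if eq: "expand_gen Z (Suc k) m g = {#(m, h)#} + (\<Sum>e\<in>W. ?f e)" and h: "base h = base g"
      and W: "finite W" "W \<subseteq> out_arcs G (base g)" for h W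
  proof -
    consider "x = (m, h)" | e where "e \<in> W" "x \<in># ?f e"
      using Suc.prems(2) in_sum_multiset[of x ?f W] unfolding eq by auto
    then show ?thesis
    proof cases
      case 1
      then show ?thesis using stay h by simp
    next
      case (2 e)
      then obtain p where "awalk (base g) (e # p) (base (snd x)) \<and> int (length (e # p)) = fst x - m"
        using move[of e] W by blast
      moreover have "size (expand_gen Z (Suc k) m g) \<noteq> 1" unfolding eq using big 2(1) W(1) by blast
      ultimately show ?thesis by blast
    qed
  qed
  show ?case
  proof (cases g)
    case (Proper v)
    consider "regular_vertex G v" | "\<not> regular_vertex G v" "infinite_emitter G v" "Z v \<noteq> {}"
      | "\<not> regular_vertex G v" "\<not> (infinite_emitter G v \<and> Z v \<noteq> {})" by blast
    then show ?thesis
    proof cases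
      case 1
      then have eq: "expand_gen Z (Suc k) m g = (\<Sum>e\<in>out_arcs G v. ?f e)" using Proper by simp
      have fin: "finite (out_arcs G v)" using 1 by (simp add: regular_vertex_def)
      obtain e where e: "e \<in> out_arcs G v" "x \<in># ?f e"
        using Suc.prems(2) in_sum_multiset unfolding eq by fast
      obtain p where p: "awalk (base g) (e # p) (base (snd x))" "int (length (e # p)) = fst x - m"
        "size (?f e) = 1 \<longrightarrow> exitless G p" using move[of e] e Proper by auto
      have "exitless G (e # p)" if s: "size (expand_gen Z (Suc k) m g) = 1"
      proof -
        have s1: "size (?f e) + (\<Sum>e\<in>out_arcs G v - {e}. size (?f e)) = 1"
          using s sum.remove[OF fin e(1), of "\<lambda>e. size (?f e)"] unfolding eq size_sum_multiset_set by simp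
        then have "(\<Sum>e\<in>out_arcs G v - {e}. size (?f e)) = 0" "size (?f e) = 1"
          using size_pos[of e] by linarith+
        moreover have "out_arcs G v - {e} = {}"
        proof (rule ccontr)
          assume "out_arcs G v - {e} \<noteq> {}"
          then obtain f where "f \<in> out_arcs G v - {e}" by blast
          then have "size (?f f) \<le> (\<Sum>e\<in>out_arcs G v - {e}. size (?f e))"
            using fin by (intro member_le_sum) auto
          then show False using size_pos[of f] calculation(1) by linarith
        qed
        ultimately show ?thesis using p(3) e(1) by (auto simp: exitless_def)
      qed
      then show ?thesis using p by blast
    next
      case 2
      then have eq: "expand_gen Z (Suc k) m g = {#(m, Improper v (Z v))#} + (\<Sum>e\<in>Z v. ?f e)"
        using Proper by simp
      have Zv: "finite (Z v)" "Z v \<subseteq> out_arcs G v" using Z 2 by (auto simp: admissible_def)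
      show ?thesis by (rule emitter[OF eq _ Zv(1)]) (use Proper Zv in simp_all)
    next
      case 3
      then show ?thesis using Suc.prems Proper stay[of g] by auto
    qed
  next
    case (Improper v W)
    show ?thesis
    proof (cases "infinite_emitter G v \<and> W \<subseteq> Z v")
      case True
      then have eq: "expand_gen Z (Suc k) m g = {#(m, Improper v (Z v))#} + (\<Sum>e\<in>Z v - W. ?f e)"
        using Improper by simp
      have Zv: "finite (Z v - W)" "Z v - W \<subseteq> out_arcs G v" using Z True by (auto simp: admissible_def)
      show ?thesis by (rule emitter[OF eq _ Zv(1)]) (use Improper Zv in simp_all)
    next
      case False
      then show ?thesis using Suc.prems Improper stay[of g] by auto
    qed
  qed
qed

text \<open>Expanding both sides turns the congruence into an equality of multisets, in which the
  expansion of \<open>shift n a\<close> is a translate of an expansion of \<open>a\<close> at a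
  lower level. Repeating this places all translates of \<open>b\<close> inside expansions of
  \<open>b\<close>.\<close>

lemma self_similar_expansion:
  assumes cong: "gcong G a (shift (int n) a + c)" and ne: "a \<noteq> 0" and n: "n > 0"
  shows "\<exists>N Z b. admissible Z \<and> b \<in> free_gamma G \<and> b \<noteq> 0 \<and>
     (\<forall>k. shift (int (k * n)) b \<subseteq># expand Z (N + int (k * n)) b \<and>
       (c = 0 \<longrightarrow> shift (int (k * n)) b = expand Z (N + int (k * n)) b))"
proof -
  obtain N0 Z where Z: "admissible Z" and eq: "\<And>N. N \<ge> N0 \<Longrightarrow> expand Z N a = expand Z N (shift (int n) a + c)"
    using gcong_expand[OF cong] by blast
  \<comment> \<open>The level must pass the threshold of the congruence and also all degrees of
    \<open>a\<close>; under the second condition expanding \<open>b\<close> further agrees with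
    expanding \<open>a\<close>.\<close>
  define N where "N = Max (insert N0 (fst ` set_mset a))"
  have N: "N \<ge> N0" "\<forall>x\<in>#a. fst x \<le> N" by (auto simp: N_def)
  define b where "b = expand Z N a"
  have a: "a \<in> free_gamma G" using gcong_free[OF cong] by blast
  have ab: "gcong G a b" unfolding b_def by (rule gcong_expand_self[OF Z a])
  have b0: "b \<noteq> 0" using ab ne gcong_zero by blast
  have exp: "expand Z (N + int (k * n)) b = expand Z (N + int (k * n)) a" for k
    unfolding b_def
  proof (intro expand_expand ballI)
    have k: "int (k * n) \<ge> 0" by (rule of_nat_0_le_iff)
    then show "N \<le> N + int (k * n)" by linarith
    show "fst x \<le> N + int (k * n)" if "x \<in># a" for x
      using k bspec[OF N(2) that] by linarith
  qed
  have "shift (int (k * n)) b \<subseteq># expand Z (N + int (k * n)) a \<and>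
       (c = 0 \<longrightarrow> shift (int (k * n)) b = expand Z (N + int (k * n)) a)" for k
  proof (induction k)
    case 0
    then show ?case by (simp add: b_def shift_0_left)
  next
    case (Suc k)
    let ?N = "N + int (Suc k * n)"
    have "?N \<ge> N0" using N(1) of_nat_0_le_iff[of "Suc k * n", where 'a = int] by linarith
    then have e: "expand Z ?N a = shift (int n) (expand Z (N + int (k * n)) a) + expand Z ?N c"
      using eq[of ?N] by (simp add: expand_shift algebra_simps)
    have s: "shift (int (Suc k * n)) b = shift (int n) (shift (int (k * n)) b)"
      by (simp add: shift_shift algebra_simps)
    show ?case unfolding e s using Suc shift_mono[of "shift (int (k * n)) b" _ "int n"]
      by (auto intro: subset_mset.add_increasing2)
  qed
  then show ?thesis using Z b0 ab gcong_free exp by (intro exI[of _ N] exI[of _ Z] exI[of _ b]) auto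
qed

lemma expand_walk:
  assumes Z: "admissible Z" and b: "b \<in> free_gamma G" and "x \<in># expand Z N b"
  shows "\<exists>y\<in>#b. \<exists>p. awalk (base (snd y)) p (base (snd x)) \<and> int (length p) = fst x - fst y"
proof -
  obtain y where y: "y \<in># b" "x \<in># expand_gen Z (nat (N - fst y)) (fst y) (snd y)"
    using assms(3) unfolding expand_def by (auto simp: set_mset_Union_mset)
  then have "snd y \<in> gens G" using b by (auto simp: free_gamma_iff)
  then show ?thesis using expand_gen_walk[OF Z _ y(2)] y(1) by blast
qed

section \<open>From comparable and periodic elements to closed walks\<close>

lemma shift_mem: "y \<in># b \<Longrightarrow> (n + fst y, snd y) \<in># shift n b"
  by (force simp: shift_def)

text \<open>Every generator of a far translate of \<open>b\<close> arises from one of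
  \<open>b\<close> along a walk of positive length. Each vertex of the finite set of bases thus has
  a predecessor in that set, which contradicts well-foundedness of a finite acyclic
  relation.\<close>

lemma closed_walk_if_comparable:
  assumes "gcong G a (shift (int n) a + c)" "a \<noteq> 0" "n > 0"
  shows "has_closed_walk G"
proof (rule ccontr)
  assume "\<not> has_closed_walk G"
  then have ac: "\<And>v p. awalk v p v \<Longrightarrow> p = []" by (auto simp: has_closed_walk_def)
  obtain N Z b where Z: "admissible Z" and b: "b \<in> free_gamma G" "b \<noteq> 0"
    and sub: "\<And>k. shift (int (k * n)) b \<subseteq># expand Z (N + int (k * n)) b"
    using self_similar_expansion[OF assms] by blast
  define A where "A = fst ` set_mset b"
  have A: "finite A" "\<And>x. x \<in># b \<Longrightarrow> fst x \<in> A" by (auto simp: A_def)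
  \<comment> \<open>\<open>k\<close> exceeds the spread of the degrees in \<open>b\<close>, so no
    walk into the translate by \<open>k * n\<close> is empty.\<close>
  define k where "k = Suc (nat (Max A - Min A))"
  have pos: "int (k * n) + fst y - fst x > 0" if "x \<in># b" "y \<in># b" for x y
  proof -
    have "fst x \<le> Max A" "Min A \<le> fst y" using that A by auto
    moreover have "int k \<le> int (k * n)" using assms(3) by (intro of_nat_mono) (cases n; simp)
    ultimately show ?thesis unfolding k_def by linarith
  qed
  define W where "W = base ` snd ` set_mset b"
  have fin: "finite W" "W \<noteq> {}" using b(2) by (auto simp: W_def)
  define R where "R = {(u, w). u \<in> W \<and> w \<in> W \<and> (\<exists>p. p \<noteq> [] \<and> awalk u p w)}"
  have pre: "\<exists>u. (u, w) \<in> R" if "w \<in> W" for w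
  proof -
    obtain y where y: "y \<in># b" "w = base (snd y)" using \<open>w \<in> W\<close> by (auto simp: W_def)
    have mem: "(int (k * n) + fst y, snd y) \<in># expand Z (N + int (k * n)) b"
      using shift_mem[OF y(1)] sub by (meson mset_subset_eqD)
    obtain x p where x: "x \<in># b" "awalk (base (snd x)) p w" "int (length p) = int (k * n) + fst y - fst x"
      using expand_walk[OF Z b(1) mem] unfolding fst_conv snd_conv y(2) by blast
    have "int (length p) > 0" using pos[OF x(1) y(1)] x(3) by linarith
    then have "p \<noteq> []" by auto
    moreover have "base (snd x) \<in> W" using x(1) by (simp add: W_def)
    ultimately show ?thesis using that x(2) unfolding R_def by blast
  qed
  have "trans R" unfolding R_def trans_def by (auto intro: awalk_appendI)
  moreover have "(u, u) \<notin> R" for u using ac by (auto simp: R_def)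
  ultimately have "acyclic R" by (simp add: acyclic_def trancl_id)
  moreover have "finite R" by (rule finite_subset[of _ "W \<times> W"]) (auto simp: R_def fin)
  ultimately have "wf R" by (simp add: finite_acyclic_wf)
  then obtain w where "w \<in> W" "\<And>u. (u, w) \<in> R \<Longrightarrow> u \<notin> W"
    using fin(2) by (metis ex_in_conv wfE_min)
  then show False using pre unfolding R_def by blast
qed

lemma exitless_prefix:
  assumes "awalk u p w" "awalk u q w'" "exitless G p" "exitless G q" "length p \<le> length q"
  shows "\<exists>r. q = p @ r"
  using assms
proof (induction p arbitrary: u q)
  case (Cons e p)
  then obtain f q' where q: "q = f # q'" by (cases q) auto
  have "out_arcs G u = {e}" "out_arcs G u = {f}"
    using Cons.prems unfolding q by (auto simp: awalk_Cons_iff exitless_def)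
  then have "e = f" by simp
  then show ?case using Cons.IH[of "head G e" q'] Cons.prems unfolding q
    by (auto simp: awalk_Cons_iff exitless_def)
qed simp

text \<open>Equality of sizes forces every monomial of \<open>b\<close> to expand to a single
  monomial, so one fixed \<open>x\<close> is followed along walks without exits for every
  \<open>k\<close>. The ends lie in the finite \<open>b\<close>, two of them agree, and the longer
  walk continues the shorter one by a closed walk.\<close>

lemma exitless_closed_walk_if_periodic:
  assumes "gcong G a (shift (int n) a)" "a \<noteq> 0" "n > 0"
  shows "\<not> condition_L G"
proof -
  obtain N Z b where Z: "admissible Z" and b: "b \<in> free_gamma G" "b \<noteq> 0"
    and eq: "\<And>k. shift (int (k * n)) b = expand Z (N + int (k * n)) b"
    using self_similar_expansion[of a n 0] assms by auto
  obtain x where x: "x \<in># b" using b(2) by auto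
  have "\<exists>z p. z \<in># b \<and> awalk (base (snd x)) p (base (snd z)) \<and> exitless G p \<and>
     int (length p) = int (k * n) + fst z - fst x" for k
  proof -
    let ?E = "\<lambda>x. expand_gen Z (nat (N + int (k * n) - fst x)) (fst x) (snd x)"
    have "(\<Sum>x\<in>#b. size (?E x)) = size (expand Z (N + int (k * n)) b)"
      unfolding expand_def by (rule size_sum_mset_multiset[symmetric])
    also have "\<dots> = size b" by (subst eq[symmetric]) (rule size_shift)
    finally have "(\<Sum>x\<in>#b. size (?E x)) = size b" .
    then have s: "size (?E x) = 1"
      using x expand_gen_ne by (intro size_sum_mset_eq[of b]) (auto simp: Suc_le_eq nonempty_has_size[symmetric])
    then obtain y where y: "y \<in># ?E x" by (metis multiset_nonemptyE expand_gen_ne)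
    then have "y \<in># shift (int (k * n)) b" unfolding eq expand_def using x by (auto simp: set_mset_Union_mset)
    then obtain z where z: "z \<in># b" "y = (int (k * n) + fst z, snd z)" by (auto simp: shift_def)
    have "snd x \<in> gens G" using x b(1) by (auto simp: free_gamma_iff)
    then obtain q where "awalk (base (snd x)) q (base (snd y))" "int (length q) = fst y - fst x" "exitless G q"
      using expand_gen_walk[OF Z _ y] s by blast
    then show ?thesis using z by (intro exI[of _ z] exI[of _ q]) simp
  qed
  then obtain z p where zp: "\<And>k. z k \<in># b" "\<And>k. awalk (base (snd x)) (p k) (base (snd (z k)))"
    "\<And>k. exitless G (p k)" "\<And>k. int (length (p k)) = int (k * n) + fst (z k) - fst x"
    by metis
  have "\<not> inj z"
  proof
    assume "inj z"
    then have "infinite (range z)" using range_inj_infinite by blast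
    moreover have "range z \<subseteq> set_mset b" using zp(1) by blast
    ultimately show False using finite_subset by blast
  qed
  then obtain i j where ij: "i < j" "z i = z j" by (metis injI linorder_neqE_nat)
  have "int (i * n) < int (j * n)" using ij(1) assms(3) by simp
  then have len: "length (p i) < length (p j)" using zp(4)[of i] zp(4)[of j] ij(2) by simp
  obtain r where r: "p j = p i @ r"
    using exitless_prefix[OF zp(2)[of i] zp(2)[of j] zp(3) zp(3)] len by auto
  have "awalk (base (snd (z i))) r (base (snd (z i)))"
    using zp(2)[of i] zp(2)[of j] ij(2) unfolding r by (auto simp: awalk_append_iff dest: awlast_of_awalk)
  moreover have "r \<noteq> []" "exitless G r" using len zp(3)[of j] unfolding r by (auto simp: exitless_def)
  ultimately show ?thesis by (auto simp: condition_L_def)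
qed

section \<open>Graph criteria for periodic and aperiodic elements\<close>

lemma no_periodic_iff:
  "\<not> (\<exists>a\<in>carrier MM. a \<noteq> \<one>\<^bsub>MM\<^esub> \<and> periodic MM a) \<longleftrightarrow> condition_L G"
proof
  assume L: "\<not> (\<exists>a\<in>carrier MM. a \<noteq> \<one>\<^bsub>MM\<^esub> \<and> periodic MM a)"
  show "condition_L G" unfolding condition_L_def
  proof
    assume "\<exists>v p. awalk v p v \<and> p \<noteq> [] \<and> exitless G p"
    then obtain v p where p: "awalk v p v" "p \<noteq> []" "exitless G p" by blast
    have v: "{#(0, Proper v)#} \<in> free_gamma G" using awalk_hd_in_verts[OF p(1)] by simp
    have "gcong G {#(0, Proper v)#} {#(int (length p), Proper v)#}"
      using awalk_le[OF p(1), of 0] p(3) by auto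
    then have "periodic MM (cls {#(0, Proper v)#})"
      unfolding periodic_def using p(2) v by (intro exI[of _ "length p"]) (simp add: MM_act cls_eq)
    moreover have "cls {#(0, Proper v)#} \<noteq> \<one>\<^bsub>MM\<^esub>"
      using v gcong_zero[of "{#(0, Proper v)#}"] by (auto simp: MM_one cls_eq)
    ultimately show False using L v by (auto simp: MM_carrier)
  qed
next
  assume L: "condition_L G"
  show "\<not> (\<exists>a\<in>carrier MM. a \<noteq> \<one>\<^bsub>MM\<^esub> \<and> periodic MM a)"
  proof
    assume "\<exists>a\<in>carrier MM. a \<noteq> \<one>\<^bsub>MM\<^esub> \<and> periodic MM a"
    then obtain a n where a: "a \<in> free_gamma G" "cls a \<noteq> \<one>\<^bsub>MM\<^esub>" "n > 0" "cls a = act MM (int n) (cls a)"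
      by (auto simp: MM_carrier periodic_def)
    then have "gcong G a (shift (int n) a)" by (simp add: MM_act cls_eq)
    moreover have "a \<noteq> 0" using a(2) by (auto simp: MM_one)
    ultimately show False using exitless_closed_walk_if_periodic a(3) L by blast
  qed
qed

lemma closed_walk_if_aperiodic:
  assumes "a \<in> carrier MM" "aperiodic MM a"
  shows "has_closed_walk G"
proof -
  interpret MM: cancel_gamma_monoid MM by (rule cancel_gamma_monoid_MM)
  obtain x n where x: "x \<in> free_gamma G" "a = cls x" "n > 0" "gm_le MM (act MM (int n) a) a"
    "act MM (int n) a \<noteq> a"
    using assms by (auto simp: MM_carrier aperiodic_def gm_less_def)
  then obtain c where "gcong G (shift (int n) x + c) x" by (auto simp: MM_act MM_le)
  moreover have "x \<noteq> 0" using x(2,5) MM.act_one by (auto simp: MM_one)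
  ultimately show ?thesis using closed_walk_if_comparable x(3) gcong.sym by blast
qed

text \<open>An exit makes the remainder \<open>c\<close> along the closed walk nonzero. If the
  translate were equal to the vertex, cancellation would turn \<open>c\<close> into zero.\<close>

lemma aperiodic_if_closed_walk:
  assumes "condition_L G" "has_closed_walk G"
  shows "\<exists>a\<in>carrier MM. aperiodic MM a"
proof -
  obtain v p where p: "awalk v p v" "p \<noteq> []" using assms(2) by (auto simp: has_closed_walk_def)
  then have ex: "\<not> exitless G p" using assms(1) by (auto simp: condition_L_def)
  have v: "v \<in> verts G" using awalk_hd_in_verts[OF p(1)] .
  obtain c where c: "c \<in> free_gamma G" "gcong G {#(0, Proper v)#} ({#(int (length p), Proper v)#} + c)" "c \<noteq> 0"
    using awalk_le[OF p(1), of 0] ex by auto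
  have "\<not> gcong G {#(int (length p), Proper v)#} {#(0, Proper v)#}"
  proof
    assume "gcong G {#(int (length p), Proper v)#} {#(0, Proper v)#}"
    then have "gcong G (0 + {#(int (length p), Proper v)#}) (c + {#(int (length p), Proper v)#})"
      using gcong.trans[OF _ c(2)] by (simp only: add_0 add.commute[of c])
    then have "gcong G 0 c" by (rule gcong_cancel)
    then show False using gcong_zero[OF gcong.sym] c(3) by blast
  qed
  then have "aperiodic MM (cls {#(0, Proper v)#})"
    unfolding aperiodic_def gm_less_def using p(2) v c(1) gcong.sym[OF c(2)]
    by (intro exI[of _ "length p"]) (auto simp: MM_act MM_le cls_eq)
  then show ?thesis using v by (auto simp: MM_carrier)
qed

end

section \<open>Rings without unit and their isomorphisms\<close>

lemma set_add_image: "A <+>\<^bsub>R\<^esub> B = {a \<oplus>\<^bsub>R\<^esub> b |a b. a \<in> A \<and> b \<in> B}"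
  by (auto simp: set_add_def set_mult_def)

text \<open>Properties are transported in one direction only; the other comes from applying the
  locale to the inverse map. Closure under products is an assumption because the records are only
  known to be abelian groups.\<close>

locale rng_iso = R: abelian_group R + S: abelian_group S
  for R :: "('a, 'm) ring_scheme" and S :: "('b, 'n) ring_scheme" +
  fixes \<Psi> :: "'a \<Rightarrow> 'b"
  assumes bij: "bij_betw \<Psi> (carrier R) (carrier S)"
    and hom_add: "\<lbrakk>x \<in> carrier R; y \<in> carrier R\<rbrakk> \<Longrightarrow> \<Psi> (x \<oplus>\<^bsub>R\<^esub> y) = \<Psi> x \<oplus>\<^bsub>S\<^esub> \<Psi> y"
    and hom_mult: "\<lbrakk>x \<in> carrier R; y \<in> carrier R\<rbrakk> \<Longrightarrow> \<Psi> (x \<otimes>\<^bsub>R\<^esub> y) = \<Psi> x \<otimes>\<^bsub>S\<^esub> \<Psi> y"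
    and mult_closed: "\<lbrakk>x \<in> carrier R; y \<in> carrier R\<rbrakk> \<Longrightarrow> x \<otimes>\<^bsub>R\<^esub> y \<in> carrier R"
begin

lemma closed [simp]: "x \<in> carrier R \<Longrightarrow> \<Psi> x \<in> carrier S"
  using bij by (auto simp: bij_betw_def)

lemma inj: "inj_on \<Psi> (carrier R)" and img: "\<Psi> ` carrier R = carrier S"
  using bij by (auto simp: bij_betw_def)

lemma add_hom: "group_hom (add_monoid R) (add_monoid S) \<Psi>"
  using R.a_group S.a_group by (auto simp: group_hom_def group_hom_axioms_def hom_def hom_add)

lemma hom_zero [simp]: "\<Psi> \<zero>\<^bsub>R\<^esub> = \<zero>\<^bsub>S\<^esub>"
  using group_hom.hom_one[OF add_hom] by simp

lemma inverse_iso: "rng_iso S R (the_inv_into (carrier R) \<Psi>)"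
proof -
  let ?T = "the_inv_into (carrier R) \<Psi>"
  have T: "?T (\<Psi> x) = x" if "x \<in> carrier R" for x using that inj by (simp add: the_inv_into_f_f)
  have ex: "\<exists>x\<in>carrier R. y = \<Psi> x" if "y \<in> carrier S" for y using that img by blast
  show ?thesis
  proof (unfold_locales, goal_cases)
    case 1 then show ?case using bij by (rule bij_betw_the_inv_into)
  next
    case (2 x y)
    then obtain a b where ab: "a \<in> carrier R" "b \<in> carrier R" "x = \<Psi> a" "y = \<Psi> b" using ex by blast
    have "x \<oplus>\<^bsub>S\<^esub> y = \<Psi> (a \<oplus>\<^bsub>R\<^esub> b)" using ab hom_add by simp
    then show ?case using ab T by simp
  next
    case (3 x y)
    then obtain a b where ab: "a \<in> carrier R" "b \<in> carrier R" "x = \<Psi> a" "y = \<Psi> b" using ex by blast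
    have "x \<otimes>\<^bsub>S\<^esub> y = \<Psi> (a \<otimes>\<^bsub>R\<^esub> b)" using ab hom_mult by simp
    then show ?case using ab T mult_closed by simp
  next
    case (4 x y)
    then obtain a b where ab: "a \<in> carrier R" "b \<in> carrier R" "x = \<Psi> a" "y = \<Psi> b" using ex by blast
    have "x \<otimes>\<^bsub>S\<^esub> y = \<Psi> (a \<otimes>\<^bsub>R\<^esub> b)" using ab hom_mult by simp
    then show ?case using ab mult_closed by simp
  qed
qed

lemma the_inv_img: "A \<subseteq> carrier R \<Longrightarrow> the_inv_into (carrier R) \<Psi> ` \<Psi> ` A = A"
  using inj by (force simp: the_inv_into_f_f image_image subset_iff)

lemma additive_subgroup_img: "additive_subgroup I R \<Longrightarrow> additive_subgroup (\<Psi> ` I) S"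
  unfolding additive_subgroup_def by (rule group_hom.subgroup_img_is_subgroup[OF add_hom])

lemma additive_subgroup_sub: "additive_subgroup I R \<Longrightarrow> I \<subseteq> carrier R"
  by (rule additive_subgroup.a_subset)

lemma two_sided_ideal_img:
  assumes I: "two_sided_ideal R I"
  shows "two_sided_ideal S (\<Psi> ` I)"
  unfolding two_sided_ideal_def
proof (intro conjI ballI)
  have as: "additive_subgroup I R" using I by (simp add: two_sided_ideal_def)
  then show "additive_subgroup (\<Psi> ` I) S" by (rule additive_subgroup_img)
  fix y x assume "y \<in> \<Psi> ` I" "x \<in> carrier S"
  then obtain a b where ab: "a \<in> I" "b \<in> carrier R" "y = \<Psi> a" "x = \<Psi> b" using img by blast
  then have a: "a \<in> carrier R" using additive_subgroup_sub[OF as] by blast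
  have m: "b \<otimes>\<^bsub>R\<^esub> a \<in> I" "a \<otimes>\<^bsub>R\<^esub> b \<in> I" using I ab by (auto simp: two_sided_ideal_def)
  show "x \<otimes>\<^bsub>S\<^esub> y \<in> \<Psi> ` I" using hom_mult[OF ab(2) a] m ab by (metis imageI)
  show "y \<otimes>\<^bsub>S\<^esub> x \<in> \<Psi> ` I" using hom_mult[OF a ab(2)] m ab by (metis imageI)
qed

lemma right_ideal_sub: "right_ideal R I \<Longrightarrow> I \<subseteq> carrier R"
  unfolding right_ideal_def using additive_subgroup_sub by blast

lemma two_sided_ideal_sub: "two_sided_ideal R I \<Longrightarrow> I \<subseteq> carrier R"
  unfolding two_sided_ideal_def using additive_subgroup_sub by blast

lemma right_ideal_img:
  assumes I: "right_ideal R I"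
  shows "right_ideal S (\<Psi> ` I)"
  unfolding right_ideal_def
proof (intro conjI ballI)
  show "additive_subgroup (\<Psi> ` I) S" using I additive_subgroup_img by (simp add: right_ideal_def)
  fix y x assume "y \<in> \<Psi> ` I" "x \<in> carrier S"
  then obtain a b where ab: "a \<in> I" "b \<in> carrier R" "y = \<Psi> a" "x = \<Psi> b" using img by blast
  then have a: "a \<in> carrier R" using right_ideal_sub[OF I] by blast
  have m: "a \<otimes>\<^bsub>R\<^esub> b \<in> I" using I ab by (auto simp: right_ideal_def)
  show "y \<otimes>\<^bsub>S\<^esub> x \<in> \<Psi> ` I" using hom_mult[OF a ab(2)] m ab by (metis imageI)
qed

lemma img_eq_iff: "A \<subseteq> carrier R \<Longrightarrow> B \<subseteq> carrier R \<Longrightarrow> \<Psi> ` A = \<Psi> ` B \<longleftrightarrow> A = B"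
  using inj by (rule inj_on_image_eq_iff)

lemma img_zero_iff: "A \<subseteq> carrier R \<Longrightarrow> \<Psi> ` A = {\<zero>\<^bsub>S\<^esub>} \<longleftrightarrow> A = {\<zero>\<^bsub>R\<^esub>}"
  using img_eq_iff[of A "{\<zero>\<^bsub>R\<^esub>}"] by simp

lemma hom_finsum:
  assumes "finite N" "h \<in> N \<rightarrow> carrier R"
  shows "\<Psi> (\<Oplus>\<^bsub>R\<^esub>n\<in>N. h n) = (\<Oplus>\<^bsub>S\<^esub>n\<in>N. \<Psi> (h n))"
  using assms
proof (induction N rule: finite_induct)
  case (insert n N)
  have "\<And>x. x \<in> insert n N \<Longrightarrow> h x \<in> carrier R" using insert.prems by blast
  then have h: "h n \<in> carrier R" "h \<in> N \<rightarrow> carrier R" "(\<lambda>n. \<Psi> (h n)) \<in> N \<rightarrow> carrier S" "\<Psi> (h n) \<in> carrier S"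
    by (simp_all add: Pi_def)
  then show ?case
    unfolding R.finsum_insert[OF insert(1,2) h(2,1)] S.finsum_insert[OF insert(1,2) h(3,4)]
    using insert(3) by (simp add: hom_add R.finsum_closed)
qed simp

text \<open>Arbitrary predicates on subsets let two-sided and graded ideals share one
  argument.\<close>

lemma simple_preimg_aux:
  assumes "\<And>I. P I \<Longrightarrow> I \<subseteq> carrier R" "\<And>I. P I \<Longrightarrow> Q (\<Psi> ` I)"
    "carrier S \<noteq> {\<zero>\<^bsub>S\<^esub>} \<and> (\<forall>I. Q I \<longrightarrow> I = {\<zero>\<^bsub>S\<^esub>} \<or> I = carrier S)"
  shows "carrier R \<noteq> {\<zero>\<^bsub>R\<^esub>} \<and> (\<forall>I. P I \<longrightarrow> I = {\<zero>\<^bsub>R\<^esub>} \<or> I = carrier R)"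
proof (intro conjI allI impI)
  show "carrier R \<noteq> {\<zero>\<^bsub>R\<^esub>}" using assms(3) img hom_zero by auto
  fix I assume I: "P I"
  then have sub: "I \<subseteq> carrier R" by (rule assms(1))
  have "\<Psi> ` I = {\<zero>\<^bsub>S\<^esub>} \<or> \<Psi> ` I = \<Psi> ` carrier R" using assms(2)[OF I] assms(3) img by simp
  then show "I = {\<zero>\<^bsub>R\<^esub>} \<or> I = carrier R"
    using img_zero_iff[OF sub] img_eq_iff[OF sub subset_refl] by blast
qed

lemma simple_ring_preimg: "simple_ring S \<Longrightarrow> simple_ring R"
  unfolding simple_ring_def
  by (rule simple_preimg_aux[where P = "two_sided_ideal R" and Q = "two_sided_ideal S"])
    (use two_sided_ideal_sub two_sided_ideal_img in auto)

lemma graded_simple_preimg: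
  assumes S: "graded_simple S (\<lambda>n. \<Psi> ` D n)"
  shows "graded_simple R D"
proof -
  have "graded_ideal S (\<lambda>n. \<Psi> ` D n) (\<Psi> ` I)" if I: "graded_ideal R D I" for I
    unfolding graded_ideal_def
  proof (intro conjI ballI)
    have id: "two_sided_ideal R I" using I by (simp add: graded_ideal_def)
    then show "two_sided_ideal S (\<Psi> ` I)" by (rule two_sided_ideal_img)
    fix y assume "y \<in> \<Psi> ` I"
    then obtain a N h where a: "a \<in> I" "y = \<Psi> a" "finite N" "\<forall>n\<in>N. h n \<in> I \<inter> D n" "a = (\<Oplus>\<^bsub>R\<^esub>n\<in>N. h n)"
      using I unfolding graded_ideal_def by blast
    have h: "h \<in> N \<rightarrow> carrier R" using a(4) two_sided_ideal_sub[OF id] by blast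
    have "y = (\<Oplus>\<^bsub>S\<^esub>n\<in>N. \<Psi> (h n))"
      using hom_finsum[OF a(3) h] a(2,5) by simp
    then show "\<exists>N h. finite N \<and> (\<forall>n\<in>N. h n \<in> \<Psi> ` I \<inter> \<Psi> ` D n) \<and> y = (\<Oplus>\<^bsub>S\<^esub>n\<in>N. h n)"
      using a(3,4) by (intro exI[of _ N] exI[of _ "\<lambda>n. \<Psi> (h n)"]) auto
  qed
  moreover have "I \<subseteq> carrier R" if "graded_ideal R D I" for I
    using that two_sided_ideal_sub by (simp add: graded_ideal_def)
  ultimately show ?thesis
    using simple_preimg_aux[of "graded_ideal R D" "graded_ideal S (\<lambda>n. \<Psi> ` D n)"] S
    unfolding graded_simple_def by blast
qed

lemma right_mult_img:
  assumes "e \<in> carrier R"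
  shows "\<Psi> ` right_mult R e = right_mult S (\<Psi> e)"
proof -
  have "\<Psi> ` right_mult R e = (\<lambda>x. \<Psi> e \<otimes>\<^bsub>S\<^esub> \<Psi> x) ` carrier R"
    unfolding right_mult_def image_image using assms hom_mult by (intro image_cong) auto
  then show ?thesis unfolding right_mult_def img[symmetric] image_image .
qed

lemma right_mult_sub: "e \<in> carrier R \<Longrightarrow> right_mult R e \<subseteq> carrier R"
  unfolding right_mult_def using mult_closed by blast

lemma set_add_img:
  assumes "A \<subseteq> carrier R" "B \<subseteq> carrier R"
  shows "\<Psi> ` (A <+>\<^bsub>R\<^esub> B) = \<Psi> ` A <+>\<^bsub>S\<^esub> \<Psi> ` B"
proof -
  have *: "A <+>\<^bsub>Q\<^esub> B = (\<lambda>(a, b). a \<oplus>\<^bsub>Q\<^esub> b) ` (A \<times> B)" for A B and Q :: "('x, 'y) ring_scheme"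
    unfolding set_add_image by auto
  have "\<Psi> ` (A <+>\<^bsub>R\<^esub> B) = (\<lambda>(a, b). \<Psi> a \<oplus>\<^bsub>S\<^esub> \<Psi> b) ` (A \<times> B)"
    unfolding * image_image using assms by (intro image_cong) (auto simp: hom_add subset_iff)
  also have "\<dots> = \<Psi> ` A <+>\<^bsub>S\<^esub> \<Psi> ` B"
    unfolding set_add_image by auto
  finally show ?thesis .
qed

lemma direct_summand_img:
  assumes "direct_summand R A P"
  shows "direct_summand S (\<Psi> ` A) (\<Psi> ` P)"
proof -
  obtain B where B: "right_ideal R A" "right_ideal R B" "A \<inter> B = {\<zero>\<^bsub>R\<^esub>}" "A <+>\<^bsub>R\<^esub> B = P"
    using assms unfolding direct_summand_def by blast
  have "\<Psi> ` A \<inter> \<Psi> ` B = \<Psi> ` (A \<inter> B)"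
    using inj_on_image_Int[OF inj] right_ideal_sub B(1,2) by metis
  then show ?thesis
    unfolding direct_summand_def
    using B right_ideal_img[OF B(1)] right_ideal_img[OF B(2)]
      set_add_img[OF right_ideal_sub[OF B(1)] right_ideal_sub[OF B(2)]]
    by (intro conjI exI[of _ "\<Psi> ` B"]) simp_all
qed

lemma right_module_iso_img:
  assumes iso: "right_module_iso R A B" and A: "A \<subseteq> carrier R" "right_ideal R A" and B: "B \<subseteq> carrier R"
  shows "right_module_iso S (\<Psi> ` A) (\<Psi> ` B)"
proof -
  obtain f where f: "bij_betw f A B" "\<And>a b. a \<in> A \<Longrightarrow> b \<in> A \<Longrightarrow> f (a \<oplus>\<^bsub>R\<^esub> b) = f a \<oplus>\<^bsub>R\<^esub> f b"
    "\<And>a x. a \<in> A \<Longrightarrow> x \<in> carrier R \<Longrightarrow> f (a \<otimes>\<^bsub>R\<^esub> x) = f a \<otimes>\<^bsub>R\<^esub> x"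
    using iso unfolding right_module_iso_def by blast
  let ?T = "the_inv_into (carrier R) \<Psi>"
  let ?g = "\<lambda>y. \<Psi> (f (?T y))"
  have T: "?T (\<Psi> x) = x" if "x \<in> carrier R" for x using that inj by (simp add: the_inv_into_f_f)
  have g: "?g (\<Psi> a) = \<Psi> (f a)" if "a \<in> A" for a using T that A by auto
  have fB: "f a \<in> carrier R" if "a \<in> A" for a using f(1) that B by (auto simp: bij_betw_def)
  have Ac: "a \<in> carrier R" if "a \<in> A" for a using that A by blast
  have inj_g: "inj_on ?g (\<Psi> ` A)"
  proof (rule inj_onI)
    fix x y assume "x \<in> \<Psi> ` A" "y \<in> \<Psi> ` A" and eq: "?g x = ?g y"
    then obtain a b where ab: "a \<in> A" "b \<in> A" "x = \<Psi> a" "y = \<Psi> b" by blast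
    then have "\<Psi> (f a) = \<Psi> (f b)" using eq g by simp
    then have "f a = f b" using inj fB ab by (auto dest: inj_onD)
    then show "x = y" using f(1) ab by (auto simp: bij_betw_def dest: inj_onD)
  qed
  have im_g: "?g ` \<Psi> ` A = \<Psi> ` B"
  proof -
    have "?g ` \<Psi> ` A = (\<lambda>a. \<Psi> (f a)) ` A" unfolding image_image using g by (intro image_cong) auto
    also have "\<dots> = \<Psi> ` f ` A" by (simp add: image_image)
    finally show ?thesis using f(1) by (simp add: bij_betw_def)
  qed
  have addg: "?g (x \<oplus>\<^bsub>S\<^esub> y) = ?g x \<oplus>\<^bsub>S\<^esub> ?g y" if xy: "x \<in> \<Psi> ` A" "y \<in> \<Psi> ` A" for x y
  proof -
    obtain a b where ab: "a \<in> A" "b \<in> A" "x = \<Psi> a" "y = \<Psi> b" using xy by blast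
    have "a \<oplus>\<^bsub>R\<^esub> b \<in> A"
      using A(2) ab(1,2) additive_subgroup.a_closed[of A R a b] unfolding right_ideal_def by simp
    then have "?g (\<Psi> (a \<oplus>\<^bsub>R\<^esub> b)) = \<Psi> (f a) \<oplus>\<^bsub>S\<^esub> \<Psi> (f b)"
      using g f(2)[OF ab(1,2)] hom_add[OF fB[OF ab(1)] fB[OF ab(2)]] by simp
    then show ?thesis
      unfolding ab(3,4) hom_add[OF Ac[OF ab(1)] Ac[OF ab(2)]] g[OF ab(1)] g[OF ab(2)] .
  qed
  have multg: "?g (x \<otimes>\<^bsub>S\<^esub> y) = ?g x \<otimes>\<^bsub>S\<^esub> y" if xy: "x \<in> \<Psi> ` A" "y \<in> carrier S" for x y
  proof -
    obtain a b where ab: "a \<in> A" "b \<in> carrier R" "x = \<Psi> a" "y = \<Psi> b" using xy img by blast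
    have "a \<otimes>\<^bsub>R\<^esub> b \<in> A" using A(2) ab unfolding right_ideal_def by blast
    then have "?g (\<Psi> (a \<otimes>\<^bsub>R\<^esub> b)) = \<Psi> (f a) \<otimes>\<^bsub>S\<^esub> \<Psi> b"
      using g f(3)[OF ab(1,2)] hom_mult[OF fB[OF ab(1)] ab(2)] by simp
    then show ?thesis
      unfolding ab(3,4) hom_mult[OF Ac[OF ab(1)] ab(2)] g[OF ab(1)] .
  qed
  show ?thesis unfolding right_module_iso_def bij_betw_def
    using inj_g im_g addg multg by blast
qed

lemma infinite_idempotent_img:
  assumes e: "infinite_idempotent R e" and ri: "right_ideal R (right_mult R e)"
  shows "infinite_idempotent S (\<Psi> e)"
proof -
  obtain A where A: "direct_summand R A (right_mult R e)" "A \<noteq> right_mult R e"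
    "right_module_iso R (right_mult R e) A" and ec: "e \<in> carrier R" "e \<otimes>\<^bsub>R\<^esub> e = e"
    using e unfolding infinite_idempotent_def by blast
  have As: "A \<subseteq> carrier R" using A(1) right_ideal_sub unfolding direct_summand_def by blast
  show ?thesis unfolding infinite_idempotent_def
  proof (intro conjI exI[of _ "\<Psi> ` A"])
    show "\<Psi> e \<in> carrier S" using ec by simp
    show "\<Psi> e \<otimes>\<^bsub>S\<^esub> \<Psi> e = \<Psi> e" using ec hom_mult by metis
    show "direct_summand S (\<Psi> ` A) (right_mult S (\<Psi> e))"
      using direct_summand_img[OF A(1)] right_mult_img[OF ec(1)] by simp
    show "\<Psi> ` A \<noteq> right_mult S (\<Psi> e)"
      using A(2) img_eq_iff[OF As right_mult_sub[OF ec(1)]] right_mult_img[OF ec(1)] by simp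
    show "right_module_iso S (right_mult S (\<Psi> e)) (\<Psi> ` A)"
      using right_module_iso_img[OF A(3) right_mult_sub[OF ec(1)] ri As] right_mult_img[OF ec(1)] by simp
  qed
qed

end

section \<open>Additive endomorphisms\<close>

text \<open>Calculations in a type-class ring carry no carrier conditions. Additivity keeps the
  field of scalars out of the type; multiplication by a scalar is itself an element, so scalar
  multiples become products.\<close>

typedef (overloaded) 'a add_endo = "{f :: 'a::ab_group_add \<Rightarrow> 'a. \<forall>x y. f (x + y) = f x + f y}"
  morphisms app Add_endo
  by (intro exI[of _ "\<lambda>x. x"]) simp

setup_lifting type_definition_add_endo

instantiation add_endo :: (ab_group_add) "{ring, monoid_mult}"
begin

lift_definition zero_add_endo :: "'a add_endo" is "\<lambda>_. 0" by simp
lift_definition one_add_endo :: "'a add_endo" is "\<lambda>x. x" by simp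
lift_definition plus_add_endo :: "'a add_endo \<Rightarrow> 'a add_endo \<Rightarrow> 'a add_endo"
  is "\<lambda>f g x. f x + g x" by (simp add: algebra_simps)
lift_definition minus_add_endo :: "'a add_endo \<Rightarrow> 'a add_endo \<Rightarrow> 'a add_endo"
  is "\<lambda>f g x. f x - g x" by (simp add: algebra_simps)
lift_definition uminus_add_endo :: "'a add_endo \<Rightarrow> 'a add_endo"
  is "\<lambda>f x. - f x" by simp
lift_definition times_add_endo :: "'a add_endo \<Rightarrow> 'a add_endo \<Rightarrow> 'a add_endo"
  is "\<lambda>f g x. f (g x)" by simp

instance
  by standard (transfer; auto simp: algebra_simps fun_eq_iff)+

end

lemma add_endo_eqI: "(\<And>x. app f x = app g x) \<Longrightarrow> f = g"
  by (metis app_inject ext)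

lemma app_simps [simp]:
  "app 0 x = 0" "app 1 x = x" "app (f + g) x = app f x + app g x" "app (f - g) x = app f x - app g x"
  "app (- f) x = - app f x" "app (f * g) x = app f (app g x)"
  by (simp_all add: zero_add_endo.rep_eq one_add_endo.rep_eq plus_add_endo.rep_eq
      minus_add_endo.rep_eq uminus_add_endo.rep_eq times_add_endo.rep_eq)

lemma app_Add_endo: "(\<And>x y. f (x + y) = f x + f y) \<Longrightarrow> app (Add_endo f) = f"
  by (simp add: Add_endo_inverse)

section \<open>Subrings of a type-class ring as records\<close>

text \<open>Sharing the operations of the type reduces all ideal conditions to closure of a
  subset.\<close>

locale subrng =
  fixes R :: "('a::ring, 'm) ring_scheme"
  assumes mult_eq: "monoid.mult R = (*)" and add_eq: "add R = (+)" and zero_eq: "zero R = 0"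
    and zero_c: "0 \<in> carrier R"
    and add_c: "\<lbrakk>x \<in> carrier R; y \<in> carrier R\<rbrakk> \<Longrightarrow> x + y \<in> carrier R"
    and uminus_c: "x \<in> carrier R \<Longrightarrow> - x \<in> carrier R"
    and mult_c: "\<lbrakk>x \<in> carrier R; y \<in> carrier R\<rbrakk> \<Longrightarrow> x * y \<in> carrier R"
begin

lemma abelian: "abelian_group R"
proof (rule abelian_groupI)
  fix x assume "x \<in> carrier R"
  then show "\<exists>y\<in>carrier R. y \<oplus>\<^bsub>R\<^esub> x = \<zero>\<^bsub>R\<^esub>"
    by (intro bexI[of _ "- x"]) (simp_all add: add_eq zero_eq uminus_c)
qed (simp_all add: add_eq zero_eq zero_c add_c add_ac)

lemma minus_c: "\<lbrakk>x \<in> carrier R; y \<in> carrier R\<rbrakk> \<Longrightarrow> x - y \<in> carrier R"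
  using add_c[OF _ uminus_c, of x y] by simp

lemma a_inv_eq: "x \<in> carrier R \<Longrightarrow> \<ominus>\<^bsub>R\<^esub> x = - x"
  using abelian_group.minus_equality[OF abelian, of "- x" x] by (simp add: add_eq zero_eq uminus_c)

lemma additive_subgroup_iff:
  "additive_subgroup I R \<longleftrightarrow> I \<subseteq> carrier R \<and> 0 \<in> I \<and> (\<forall>a\<in>I. \<forall>b\<in>I. a + b \<in> I) \<and> (\<forall>a\<in>I. - a \<in> I)"
proof -
  have "\<forall>a\<in>I. inv\<^bsub>add_monoid R\<^esub> a = - a" if "I \<subseteq> carrier R"
    using that a_inv_eq by (auto simp: a_inv_def)
  then show ?thesis
    unfolding additive_subgroup_def subgroup_def by (auto simp: add_eq zero_eq)
qed

lemma two_sided_ideal_iff: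
  "two_sided_ideal R I \<longleftrightarrow> I \<subseteq> carrier R \<and> 0 \<in> I \<and> (\<forall>a\<in>I. \<forall>b\<in>I. a + b \<in> I) \<and> (\<forall>a\<in>I. - a \<in> I) \<and>
     (\<forall>a\<in>I. \<forall>x\<in>carrier R. x * a \<in> I \<and> a * x \<in> I)"
  unfolding two_sided_ideal_def additive_subgroup_iff mult_eq by blast

lemma right_ideal_iff:
  "right_ideal R I \<longleftrightarrow> I \<subseteq> carrier R \<and> 0 \<in> I \<and> (\<forall>a\<in>I. \<forall>b\<in>I. a + b \<in> I) \<and> (\<forall>a\<in>I. - a \<in> I) \<and>
     (\<forall>a\<in>I. \<forall>x\<in>carrier R. a * x \<in> I)"
  unfolding right_ideal_def additive_subgroup_iff mult_eq by blast

lemma finsum_eq: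
  assumes "finite N" "\<And>n. n \<in> N \<Longrightarrow> h n \<in> carrier R"
  shows "finsum R h N = sum h N"
proof -
  interpret abelian_group R by (rule abelian)
  show ?thesis using assms
    by (induction N rule: finite_induct) (simp_all add: finsum_insert Pi_def add_eq zero_eq)
qed

lemma right_mult_right_ideal:
  assumes "e \<in> carrier R"
  shows "right_ideal R (right_mult R e)"
  unfolding right_ideal_iff right_mult_def mult_eq
proof (intro conjI ballI)
  show "(*) e ` carrier R \<subseteq> carrier R" using assms mult_c by blast
  show "0 \<in> (*) e ` carrier R" using zero_c by (intro image_eqI[of _ _ 0]) simp_all
  fix a assume "a \<in> (*) e ` carrier R"
  then obtain x where x: "x \<in> carrier R" "a = e * x" by blast
  show "- a \<in> (*) e ` carrier R" using x uminus_c by (intro image_eqI[of _ _ "- x"]) simp_all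
  show "a * y \<in> (*) e ` carrier R" if "y \<in> carrier R" for y
    using x mult_c that by (intro image_eqI[of _ _ "x * y"]) (simp_all add: mult.assoc)
  fix b assume "b \<in> (*) e ` carrier R"
  then obtain y where y: "y \<in> carrier R" "b = e * y" by blast
  show "a + b \<in> (*) e ` carrier R"
    using x y add_c by (intro image_eqI[of _ _ "x + y"]) (simp_all add: distrib_left)
qed

end

text \<open>The subring may have no unit; \<open>0\<close> is a placeholder in the field
  \<open>one\<close>.\<close>

definition ring_rec :: "'a::ring set \<Rightarrow> 'a ring" where
  "ring_rec C = \<lparr>carrier = C, monoid.mult = (*), one = 0, zero = 0, add = (+)\<rparr>"

section \<open>The free algebra and its representations\<close>

lemma poly_mapping_decomp: "f = (\<Sum>w\<in>Poly_Mapping.keys f. Poly_Mapping.single w (Poly_Mapping.lookup f w))"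
  by (rule poly_mapping_eqI) (auto simp: lookup_sum lookup_single when_def in_keys_iff)

text \<open>A constant is a multiple of the empty word, so scalar multiplication is a product in the
  unital algebra of all words. Constants are central because the field is commutative.\<close>

lemma scalar_commute:
  fixes f :: "'a::monoid_add \<Rightarrow>\<^sub>0 'k::field"
  shows "f * Poly_Mapping.single 0 c = Poly_Mapping.single 0 c * f"
proof -
  have "(\<Sum>w\<in>Poly_Mapping.keys f. Poly_Mapping.single w (Poly_Mapping.lookup f w)) * Poly_Mapping.single 0 c =
    Poly_Mapping.single 0 c * (\<Sum>w\<in>Poly_Mapping.keys f. Poly_Mapping.single w (Poly_Mapping.lookup f w))"
    by (simp add: sum_distrib_left sum_distrib_right mult_single mult.commute)
  then show ?thesis by (simp flip: poly_mapping_decomp)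
qed

lemma lookup_scalar:
  fixes f :: "'a::monoid_add \<Rightarrow>\<^sub>0 'k::field"
  shows "Poly_Mapping.lookup (Poly_Mapping.single 0 c * f) w = c * Poly_Mapping.lookup f w"
  unfolding mult_map_scale_conv_mult[symmetric] by (simp add: Poly_Mapping.map.rep_eq when_def)

lemma keys_scalar: "Poly_Mapping.keys (Poly_Mapping.single 0 c * f) \<subseteq> Poly_Mapping.keys (f :: 'a::monoid_add \<Rightarrow>\<^sub>0 'k::field)"
  by (auto simp: in_keys_iff lookup_scalar)

lemma wmon_append: "wmon (u @ w) = wmon u * (wmon w :: ('v, 'e) lword \<Rightarrow>\<^sub>0 'k::field)"
  by (simp add: wmon_def mult_single plus_lword_def)

interpretation pm: vector_space "\<lambda>c (f :: 'a::monoid_add \<Rightarrow>\<^sub>0 'k::field). Poly_Mapping.single 0 c * f"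
  by unfold_locales (simp_all add: algebra_simps single_add mult_single flip: mult.assoc)

context wf_digraph
begin

section \<open>The free algebra without unit and its relation ideal\<close>

definition fc :: "(('a, 'b) lword \<Rightarrow>\<^sub>0 'k::field) set" where
  "fc = {f. \<forall>w\<in>Poly_Mapping.keys f. letters w \<noteq> [] \<and> set (letters w) \<subseteq> graph_letters G}"

lemma fc_add: "f \<in> fc \<Longrightarrow> g \<in> fc \<Longrightarrow> f + g \<in> fc"
  unfolding fc_def using Poly_Mapping.keys_add[of f g] by blast

lemma fc_uminus: "f \<in> fc \<Longrightarrow> - f \<in> fc"
  unfolding fc_def by (simp add: in_keys_iff)

lemma fc_0: "0 \<in> fc" by (simp add: fc_def)

lemma fc_mult:
  assumes "f \<in> fc" "g \<in> fc" shows "f * g \<in> fc"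
proof -
  have "letters w \<noteq> [] \<and> set (letters w) \<subseteq> graph_letters G" if w: "w \<in> Poly_Mapping.keys (f * g)" for w
  proof -
    obtain u v where "w = u + v" "u \<in> Poly_Mapping.keys f" "v \<in> Poly_Mapping.keys g" using w keys_mult[of f g] by blast
    then show ?thesis using assms by (auto simp: fc_def plus_lword_def)
  qed
  then show ?thesis by (simp add: fc_def)
qed

lemma fc_scale: "f \<in> fc \<Longrightarrow> Poly_Mapping.single 0 c * f \<in> fc"
  unfolding fc_def using keys_scalar[of c f] by blast

lemma fc_wmon: "ls \<noteq> [] \<Longrightarrow> set ls \<subseteq> graph_letters G \<Longrightarrow> wmon ls \<in> fc"
  by (simp add: fc_def wmon_def)

lemma fc_sum: "(\<And>x. x \<in> A \<Longrightarrow> f x \<in> fc) \<Longrightarrow> sum f A \<in> fc"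
  by (induction A rule: infinite_finite_induct) (auto simp: fc_0 fc_add)

lemma fc_diff: "f \<in> fc \<Longrightarrow> g \<in> fc \<Longrightarrow> f - g \<in> fc"
  using fc_add[OF _ fc_uminus, of f g] by simp

lemma FA_simps:
  "carrier (free_algebra TYPE('k::field) G) = fc" "monoid.mult (free_algebra TYPE('k) G) = (*)"
  "add (free_algebra TYPE('k) G) = (+)" "zero (free_algebra TYPE('k) G) = 0"
  "smult (free_algebra TYPE('k) G) c f = Poly_Mapping.single 0 c * f"
  by (simp_all add: free_algebra_def fc_def mult_map_scale_conv_mult)

lemma FA_subrng: "subrng (free_algebra TYPE('k::field) G)"
  by unfold_locales (simp_all add: FA_simps fc_0 fc_add fc_uminus fc_mult)

lemma graph_letters_simps [simp]:
  "Vert v \<in> graph_letters G \<longleftrightarrow> v \<in> verts G" "Edge e \<in> graph_letters G \<longleftrightarrow> e \<in> arcs G"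
  "Ghost e \<in> graph_letters G \<longleftrightarrow> e \<in> arcs G"
  by (auto simp: graph_letters_def)

lemma relators_fc: "f \<in> relators G \<Longrightarrow> f \<in> fc"
proof (induction rule: relators.induct)
  case (CK2 v)
  then show ?case
    by (intro fc_diff fc_sum fc_wmon) (auto simp: regular_vertex_def)
qed (auto intro!: fc_diff fc_wmon)

definition lpa_ideal :: "(('a, 'b) lword \<Rightarrow>\<^sub>0 'k::field) set \<Rightarrow> bool" where
  "lpa_ideal I \<longleftrightarrow> I \<subseteq> fc \<and> 0 \<in> I \<and> (\<forall>a\<in>I. \<forall>b\<in>I. a + b \<in> I) \<and> (\<forall>a\<in>I. - a \<in> I) \<and>
     (\<forall>a\<in>I. \<forall>x\<in>fc. x * a \<in> I \<and> a * x \<in> I) \<and> (\<forall>c. \<forall>f\<in>I. Poly_Mapping.single 0 c * f \<in> I) \<and> relators G \<subseteq> I"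

lemma relation_ideal_eq: "relation_ideal TYPE('k::field) G = \<Inter>{I. lpa_ideal I}"
proof -
  interpret subrng "free_algebra TYPE('k) G" by (rule FA_subrng)
  show ?thesis unfolding relation_ideal_def two_sided_ideal_iff lpa_ideal_def FA_simps by (simp add: conj_ac)
qed

lemma fc_lpa_ideal: "lpa_ideal fc"
  by (auto simp: lpa_ideal_def fc_0 fc_add fc_uminus fc_mult fc_scale relators_fc)

abbreviation N :: "(('a, 'b) lword \<Rightarrow>\<^sub>0 'k::field) set" where "N \<equiv> relation_ideal TYPE('k) G"

lemma N_least: "lpa_ideal I \<Longrightarrow> N \<subseteq> I"
  unfolding relation_ideal_eq by blast

lemma lpa_idealD:
  assumes "lpa_ideal I"
  shows "f \<in> I \<Longrightarrow> f \<in> fc" "0 \<in> I" "f \<in> I \<Longrightarrow> g \<in> I \<Longrightarrow> f + g \<in> I" "f \<in> I \<Longrightarrow> - f \<in> I"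
    "f \<in> I \<Longrightarrow> x \<in> fc \<Longrightarrow> x * f \<in> I" "f \<in> I \<Longrightarrow> x \<in> fc \<Longrightarrow> f * x \<in> I"
    "f \<in> I \<Longrightarrow> Poly_Mapping.single 0 c * f \<in> I" "f \<in> relators G \<Longrightarrow> f \<in> I"
  using assms unfolding lpa_ideal_def by auto

lemma mem_N_iff: "f \<in> N \<longleftrightarrow> (\<forall>I. lpa_ideal I \<longrightarrow> f \<in> I)"
  unfolding relation_ideal_eq by simp

lemma N_fc: "f \<in> N \<Longrightarrow> f \<in> fc"
  using fc_lpa_ideal unfolding mem_N_iff by blast

lemma N_simps:
  "f \<in> N \<Longrightarrow> f \<in> fc" "0 \<in> N" "f \<in> N \<Longrightarrow> g \<in> N \<Longrightarrow> f + g \<in> N" "f \<in> N \<Longrightarrow> - f \<in> N"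
  "f \<in> N \<Longrightarrow> x \<in> fc \<Longrightarrow> x * f \<in> N" "f \<in> N \<Longrightarrow> x \<in> fc \<Longrightarrow> f * x \<in> N"
  "f \<in> N \<Longrightarrow> Poly_Mapping.single 0 c * f \<in> N" "f \<in> relators G \<Longrightarrow> f \<in> N"
  by (simp add: N_fc) (simp_all add: mem_N_iff lpa_idealD)

end

text \<open>The target has a unit and contains the scalars through \<open>sc\<close>.
  Multiplicativity and scaling are asked only on \<open>fc\<close>: in the regular representation a
  constant acts through \<kappa> and \<pi>, not as a plain scalar.\<close>

locale lpa_rep = wf_digraph G for G :: "('v, 'e) pre_digraph" +
  fixes \<phi> :: "(('v, 'e) lword \<Rightarrow>\<^sub>0 'k::field) \<Rightarrow> 'r::{ring, monoid_mult}" and sc :: "'k \<Rightarrow> 'r"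
  assumes \<phi>_add: "\<phi> (f + g) = \<phi> f + \<phi> g"
    and \<phi>_mult: "\<lbrakk>f \<in> fc; g \<in> fc\<rbrakk> \<Longrightarrow> \<phi> (f * g) = \<phi> f * \<phi> g"
    and \<phi>_scale: "f \<in> fc \<Longrightarrow> \<phi> (Poly_Mapping.single 0 c * f) = sc c * \<phi> f"
    and sc_comm: "f \<in> fc \<Longrightarrow> \<phi> f * sc c = sc c * \<phi> f"
    and sc_add: "sc (c + d) = sc c + sc d" and sc_mult: "sc (c * d) = sc c * sc d" and sc_1: "sc 1 = 1"
    and \<phi>_rel: "f \<in> relators G \<Longrightarrow> \<phi> f = 0"
begin

lemma \<phi>_0 [simp]: "\<phi> 0 = 0"
  using \<phi>_add[of 0 0] by simp

lemma \<phi>_uminus: "\<phi> (- f) = - \<phi> f"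
  using \<phi>_add[of f "- f"] by (simp add: eq_neg_iff_add_eq_0 add.commute)

lemma \<phi>_diff: "\<phi> (f - g) = \<phi> f - \<phi> g"
  using \<phi>_add[of f "- g"] by (simp add: \<phi>_uminus)

lemma \<phi>_sum: "\<phi> (sum h A) = (\<Sum>x\<in>A. \<phi> (h x))"
  by (induction A rule: infinite_finite_induct) (auto simp: \<phi>_add)

lemma \<phi>_N: "f \<in> N \<Longrightarrow> \<phi> f = 0"
proof -
  have "lpa_ideal {f \<in> fc. \<phi> f = 0}"
    unfolding lpa_ideal_def
    by (auto simp: fc_0 fc_add fc_uminus fc_mult fc_scale relators_fc \<phi>_add \<phi>_uminus \<phi>_mult \<phi>_scale \<phi>_rel)
  then show "f \<in> N \<Longrightarrow> \<phi> f = 0" using N_least by blast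
qed

end

text \<open>Together with \<open>\<phi>_N\<close> the kernel on \<open>fc\<close> is exactly the
  relation ideal, so the image of \<open>fc\<close> is a copy of the Leavitt path algebra.\<close>

locale univ_rep = lpa_rep G \<phi> sc
  for G :: "('v, 'e) pre_digraph" and \<phi> :: "(('v, 'e) lword \<Rightarrow>\<^sub>0 'k::field) \<Rightarrow> 'r::{ring, monoid_mult}"
    and sc :: "'k \<Rightarrow> 'r" +
  assumes faithful: "f \<in> fc \<Longrightarrow> \<phi> f = 0 \<Longrightarrow> f \<in> N"

text \<open>
  The regular representation on \<open>A / N\<close>, realised on the type \<open>A\<close> by means of a linear projection
  \<open>\<pi>\<close> with kernel \<open>N\<close>; \<open>\<kappa>\<close> deletes the words with letters outside the graph.
\<close>

lemma linear_projection:
  fixes S :: "('a::monoid_add \<Rightarrow>\<^sub>0 'k::field) set"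
  assumes "pm.subspace S"
  obtains \<pi> :: "('a \<Rightarrow>\<^sub>0 'k) \<Rightarrow> ('a \<Rightarrow>\<^sub>0 'k)" where "\<And>f g. \<pi> (f + g) = \<pi> f + \<pi> g" "\<And>f. f \<in> S \<Longrightarrow> \<pi> f = 0"
    "\<And>f. f - \<pi> f \<in> S" "\<And>c f. \<pi> (Poly_Mapping.single 0 c * f) = Poly_Mapping.single 0 c * \<pi> f"
proof -
  interpret vector_space_pair
    "\<lambda>c (f :: 'a \<Rightarrow>\<^sub>0 'k). Poly_Mapping.single 0 c * f" "\<lambda>c (f :: 'a \<Rightarrow>\<^sub>0 'k). Poly_Mapping.single 0 c * f" ..
  obtain p where p: "range p \<subseteq> S" "Vector_Spaces.linear (\<lambda>c f. Poly_Mapping.single 0 c * f) (\<lambda>c f. Poly_Mapping.single 0 c * f) p"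
    "\<forall>v\<in>S. p v = v"
    using linear_exists_left_inverse_on[OF pm.linear_id assms inj_on_id] by auto
  interpret p: Vector_Spaces.linear "\<lambda>c (f :: 'a \<Rightarrow>\<^sub>0 'k). Poly_Mapping.single 0 c * f"
    "\<lambda>c (f :: 'a \<Rightarrow>\<^sub>0 'k). Poly_Mapping.single 0 c * f" p by (rule p)
  show ?thesis
  proof (rule that[of "\<lambda>f. f - p f"])
    show "f - (f - p f) \<in> S" for f using p(1) by auto
  qed (use p(3) in \<open>simp_all add: p.add p.scale right_diff_distrib\<close>)
qed

context wf_digraph
begin

definition letters_ok :: "('a, 'b) lword \<Rightarrow> bool" where
  "letters_ok w \<longleftrightarrow> set (letters w) \<subseteq> graph_letters G"

definition \<kappa> :: "(('a, 'b) lword \<Rightarrow>\<^sub>0 'k::field) \<Rightarrow> (('a, 'b) lword \<Rightarrow>\<^sub>0 'k)" where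
  "\<kappa> f = Poly_Mapping.mapp (\<lambda>w c. if letters_ok w then c else 0) f"

lemma lookup_\<kappa>: "Poly_Mapping.lookup (\<kappa> f) w = (if letters_ok w then Poly_Mapping.lookup f w else 0)"
  by (auto simp: \<kappa>_def lookup_mapp when_def in_keys_iff)

lemma \<kappa>_add: "\<kappa> (f + g) = \<kappa> f + \<kappa> g"
  by (rule poly_mapping_eqI) (simp add: lookup_\<kappa> lookup_add)

lemma \<kappa>_scale: "\<kappa> (Poly_Mapping.single 0 c * f) = Poly_Mapping.single 0 c * \<kappa> f"
  by (rule poly_mapping_eqI) (simp add: lookup_\<kappa> lookup_scalar)

text \<open>The unital companion of \<open>fc\<close>; its element \<open>1\<close> is the vector on
  which faithfulness is tested.\<close>

definition fc1 :: "(('a, 'b) lword \<Rightarrow>\<^sub>0 'k::field) set" where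
  "fc1 = {f. \<forall>w\<in>Poly_Mapping.keys f. letters_ok w}"

lemma fc_fc1: "f \<in> fc \<Longrightarrow> f \<in> fc1"
  by (simp add: fc_def fc1_def letters_ok_def)

lemma \<kappa>_fc1: "\<kappa> f \<in> fc1"
  by (auto simp: fc1_def in_keys_iff lookup_\<kappa> split: if_splits)

lemma \<kappa>_id: "f \<in> fc1 \<Longrightarrow> \<kappa> f = f"
  by (rule poly_mapping_eqI) (auto simp: lookup_\<kappa> fc1_def in_keys_iff)

lemma one_fc1: "1 \<in> fc1"
  by (auto simp: fc1_def letters_ok_def zero_lword_def)

lemma fc1_diff: "f \<in> fc1 \<Longrightarrow> g \<in> fc1 \<Longrightarrow> f - g \<in> fc1"
  by (auto simp: fc1_def in_keys_iff lookup_minus)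

lemma fc1_decomp:
  assumes "f \<in> fc1"
  obtains c g where "f = Poly_Mapping.single 0 c + g" "g \<in> fc"
proof
  let ?g = "f - Poly_Mapping.single 0 (Poly_Mapping.lookup f 0)"
  show "f = Poly_Mapping.single 0 (Poly_Mapping.lookup f 0) + ?g" by simp
  show "?g \<in> fc"
  proof -
    have "letters w \<noteq> [] \<and> set (letters w) \<subseteq> graph_letters G" if "w \<in> Poly_Mapping.keys ?g" for w
    proof -
      have "w \<noteq> 0" "w \<in> Poly_Mapping.keys f"
        using that by (auto simp: in_keys_iff lookup_minus lookup_single when_def split: if_splits)
      then show ?thesis using assms
        by (cases w) (simp add: fc1_def letters_ok_def zero_lword_def, fastforce)
    qed
    then show ?thesis by (simp add: fc_def)
  qed
qed

lemma fc_mult_fc1: "f \<in> fc \<Longrightarrow> g \<in> fc1 \<Longrightarrow> f * g \<in> fc"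
  by (elim fc1_decomp) (simp add: distrib_left scalar_commute fc_add fc_scale fc_mult)

lemma N_mult_fc1: "f \<in> N \<Longrightarrow> g \<in> fc1 \<Longrightarrow> f * g \<in> N"
  by (elim fc1_decomp) (simp add: distrib_left scalar_commute N_simps)

text \<open>Left multiplication followed by \<pi> acts on representatives modulo \<open>N\<close>.
  The map \<kappa> is applied first because \<open>N\<close> absorbs only products with elements
  over the letters of the graph.\<close>

lemma univ_rep_exists:
  "\<exists>(\<phi> :: (('a, 'b) lword \<Rightarrow>\<^sub>0 'k::field) \<Rightarrow> (('a, 'b) lword \<Rightarrow>\<^sub>0 'k) add_endo) sc. univ_rep G \<phi> sc"
proof -
  have "pm.subspace (N :: (('a, 'b) lword \<Rightarrow>\<^sub>0 'k) set)"
    by (auto simp: pm.subspace_def N_simps)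
  then obtain \<pi> :: "(('a, 'b) lword \<Rightarrow>\<^sub>0 'k) \<Rightarrow> _" where
    add: "\<And>f g. \<pi> (f + g) = \<pi> f + \<pi> g" and ker: "\<And>f. f \<in> N \<Longrightarrow> \<pi> f = 0"
    and diff: "\<And>f. f - \<pi> f \<in> N"
    and scale: "\<And>c f. \<pi> (Poly_Mapping.single 0 c * f) = Poly_Mapping.single 0 c * \<pi> f"
    using linear_projection by blast
  have \<pi>_diff: "\<pi> (f - g) = \<pi> f - \<pi> g" for f g
    using add[of "f - g" g] by (simp add: algebra_simps)
  have \<pi>_cong: "\<pi> f = \<pi> g" if "f - g \<in> N" for f g
    using ker[OF that] by (simp add: \<pi>_diff)
  have \<pi>_zero: "f \<in> N" if "\<pi> f = 0" for f using diff[of f] that by simp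
  have \<pi>_fc1: "\<pi> f \<in> fc1" if "f \<in> fc1" for f
    using fc1_diff[OF that fc_fc1[OF N_simps(1)[OF diff[of f]]]] by simp
  define \<phi> where "\<phi> f = Add_endo (\<lambda>x. \<pi> (f * \<pi> (\<kappa> x)))" for f :: "('a, 'b) lword \<Rightarrow>\<^sub>0 'k"
  define sc where "sc c = Add_endo (\<lambda>x :: ('a, 'b) lword \<Rightarrow>\<^sub>0 'k. Poly_Mapping.single 0 c * x)" for c
  have app_\<phi>: "app (\<phi> f) x = \<pi> (f * \<pi> (\<kappa> x))" for f x
    unfolding \<phi>_def by (subst app_Add_endo) (simp_all add: \<kappa>_add add distrib_left)
  have app_sc: "app (sc c) x = Poly_Mapping.single 0 c * x" for c x
    unfolding sc_def by (subst app_Add_endo) (simp_all add: distrib_left)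
  have "univ_rep G \<phi> sc"
  proof (unfold_locales, goal_cases)
    case (1 f g)
    then show ?case by (intro add_endo_eqI) (simp add: app_\<phi> distrib_right add)
  next
    case (2 f g)
    show ?case
    proof (rule add_endo_eqI)
      fix x
      let ?x = "\<pi> (\<kappa> x)"
      have x: "?x \<in> fc1" by (intro \<pi>_fc1 \<kappa>_fc1)
      then have gx: "g * ?x \<in> fc" using 2 fc_mult_fc1 by blast
      then have "\<kappa> (\<pi> (g * ?x)) = \<pi> (g * ?x)" by (intro \<kappa>_id \<pi>_fc1 fc_fc1)
      moreover have "\<pi> (\<pi> (g * ?x)) = \<pi> (g * ?x)"
        using ker[OF diff[of "g * ?x"]] by (simp add: \<pi>_diff)
      moreover have "\<pi> (f * \<pi> (g * ?x)) = \<pi> (f * (g * ?x))"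
        using N_simps(5)[OF diff[of "g * ?x"] 2(1)] \<pi>_cong[of "f * (g * ?x)" "f * \<pi> (g * ?x)"]
        by (simp add: right_diff_distrib)
      ultimately show "app (\<phi> (f * g)) x = app (\<phi> f * \<phi> g) x"
        by (simp add: app_\<phi> mult.assoc)
    qed
  next
    case (3 f c)
    show ?case by (rule add_endo_eqI) (simp add: app_\<phi> app_sc scale mult.assoc)
  next
    case (4 f c)
    show ?case
    proof (rule add_endo_eqI)
      fix x
      have "f * (Poly_Mapping.single 0 c * \<pi> (\<kappa> x)) = Poly_Mapping.single 0 c * (f * \<pi> (\<kappa> x))"
        using scalar_commute[of f c] by (simp flip: mult.assoc)
      then show "app (\<phi> f * sc c) x = app (sc c * \<phi> f) x"
        by (simp add: app_\<phi> app_sc scale \<kappa>_scale)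
    qed
  next
    case (5 c d)
    show ?case by (rule add_endo_eqI) (simp add: app_sc single_add distrib_right)
  next
    case (6 c d)
    show ?case by (rule add_endo_eqI) (simp add: app_sc mult_single flip: mult.assoc)
  next
    case 7
    show ?case by (rule add_endo_eqI) (simp add: app_sc)
  next
    case (8 f)
    then show ?case
      by (intro add_endo_eqI) (simp add: app_\<phi> ker N_mult_fc1 N_simps(8) \<pi>_fc1 \<kappa>_fc1)
  next
    case (9 f)
    \<comment> \<open>Evaluating at the empty word puts \<open>f * \<pi> 1\<close> into
      \<open>N\<close>; since \<open>1 - \<pi> 1\<close> lies in \<open>N\<close> as well, so does
      \<open>f\<close>.\<close>
    have "\<pi> (f * \<pi> 1) = 0"
      using arg_cong[OF 9(2), of "\<lambda>h. app h 1"] by (simp add: app_\<phi> \<kappa>_id one_fc1)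
    then have "f * \<pi> 1 \<in> N" by (rule \<pi>_zero)
    moreover have "f * (1 - \<pi> 1) \<in> N" using diff[of 1] 9(1) N_simps(5) by blast
    ultimately show ?case using N_simps(3) by (fastforce simp: right_diff_distrib)
  qed
  then show ?thesis by blast
qed

end

section \<open>Monomials in a representation\<close>

context lpa_rep
begin

definition V :: "'v \<Rightarrow> 'r" where "V v = \<phi> (wmon [Vert v])"
definition Ed :: "'e \<Rightarrow> 'r" where "Ed e = \<phi> (wmon [Edge e])"
definition Gs :: "'e \<Rightarrow> 'r" where "Gs e = \<phi> (wmon [Ghost e])"

lemma \<phi>_append:
  assumes "u \<noteq> []" "w \<noteq> []" "set u \<subseteq> graph_letters G" "set w \<subseteq> graph_letters G"
  shows "\<phi> (wmon (u @ w)) = \<phi> (wmon u) * \<phi> (wmon w)"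
  unfolding wmon_append using assms by (intro \<phi>_mult fc_wmon)

lemma \<phi>_pair: "a \<in> graph_letters G \<Longrightarrow> b \<in> graph_letters G \<Longrightarrow> \<phi> (wmon [a, b]) = \<phi> (wmon [a]) * \<phi> (wmon [b])"
  using \<phi>_append[of "[a]" "[b]"] by simp

lemma V_orth: "v \<in> verts G \<Longrightarrow> w \<in> verts G \<Longrightarrow> v \<noteq> w \<Longrightarrow> V v * V w = 0"
  using \<phi>_rel[OF relators.vert_orth[of v G w]] by (simp add: \<phi>_pair V_def)

lemma V_idem: "v \<in> verts G \<Longrightarrow> V v * V v = V v"
  using \<phi>_rel[OF relators.vert_idem[of v G]] by (simp add: \<phi>_pair V_def \<phi>_diff)

lemma V_Ed: "e \<in> arcs G \<Longrightarrow> V (tail G e) * Ed e = Ed e"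
  using \<phi>_rel[OF relators.edge_source[of e G]] by (simp add: \<phi>_pair V_def Ed_def \<phi>_diff)

lemma Ed_V: "e \<in> arcs G \<Longrightarrow> Ed e * V (head G e) = Ed e"
  using \<phi>_rel[OF relators.edge_range[of e G]] by (simp add: \<phi>_pair V_def Ed_def \<phi>_diff)

lemma V_Gs: "e \<in> arcs G \<Longrightarrow> V (head G e) * Gs e = Gs e"
  using \<phi>_rel[OF relators.ghost_range[of e G]] by (simp add: \<phi>_pair V_def Gs_def \<phi>_diff)

lemma Gs_V: "e \<in> arcs G \<Longrightarrow> Gs e * V (tail G e) = Gs e"
  using \<phi>_rel[OF relators.ghost_source[of e G]] by (simp add: \<phi>_pair V_def Gs_def \<phi>_diff)

lemma Gs_Ed: "e \<in> arcs G \<Longrightarrow> f \<in> arcs G \<Longrightarrow> e \<noteq> f \<Longrightarrow> Gs e * Ed f = 0"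
  using \<phi>_rel[OF relators.CK1_orth[of e G f]] by (simp add: \<phi>_pair Ed_def Gs_def \<phi>_diff)

lemma Gs_Ed_same: "e \<in> arcs G \<Longrightarrow> Gs e * Ed e = V (head G e)"
  using \<phi>_rel[OF relators.CK1[of e G]] by (simp add: \<phi>_pair V_def Ed_def Gs_def \<phi>_diff)

lemma CK2:
  assumes "regular_vertex G v"
  shows "V v = (\<Sum>e\<in>out_arcs G v. Ed e * Gs e)"
proof -
  have "(\<Sum>e\<in>out_arcs G v. \<phi> (wmon [Edge e, Ghost e])) = (\<Sum>e\<in>out_arcs G v. Ed e * Gs e)"
    by (intro sum.cong refl) (auto simp: \<phi>_pair Ed_def Gs_def)
  then show ?thesis
    using \<phi>_rel[OF relators.CK2[OF assms]] by (simp add: V_def \<phi>_diff \<phi>_sum)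
qed

sublocale vs: vector_space "\<lambda>c (x :: 'r). sc c * x"
  by unfold_locales (simp_all add: distrib_left distrib_right sc_add sc_mult sc_1 mult.assoc)

definition B :: "'r set" where "B = \<phi> ` fc"

lemma B_I: "f \<in> fc \<Longrightarrow> \<phi> f \<in> B" by (simp add: B_def)

lemma B_simps:
  "0 \<in> B" "x \<in> B \<Longrightarrow> y \<in> B \<Longrightarrow> x + y \<in> B" "x \<in> B \<Longrightarrow> y \<in> B \<Longrightarrow> x * y \<in> B" "x \<in> B \<Longrightarrow> - x \<in> B"
  "x \<in> B \<Longrightarrow> sc c * x \<in> B"
proof -
  show "0 \<in> B" using B_I[OF fc_0] by simp
  show "x \<in> B \<Longrightarrow> y \<in> B \<Longrightarrow> x + y \<in> B" by (auto simp: B_def simp flip: \<phi>_add intro: fc_add)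
  show "x \<in> B \<Longrightarrow> y \<in> B \<Longrightarrow> x * y \<in> B" by (auto simp: B_def simp flip: \<phi>_mult intro: fc_mult)
  show "x \<in> B \<Longrightarrow> - x \<in> B" by (auto simp: B_def simp flip: \<phi>_uminus intro: fc_uminus)
  show "x \<in> B \<Longrightarrow> sc c * x \<in> B" by (auto simp: B_def simp flip: \<phi>_scale intro: fc_scale)
qed

lemma B_sum: "(\<And>x. x \<in> A \<Longrightarrow> f x \<in> B) \<Longrightarrow> sum f A \<in> B"
  by (induction A rule: infinite_finite_induct) (auto simp: B_simps)

lemma B_subspace: "vs.subspace B"
  by (simp add: vs.subspace_def B_simps)

lemma B_comm: "x \<in> B \<Longrightarrow> x * sc c = sc c * x"
  by (auto simp: B_def sc_comm)

lemma letters_B: "v \<in> verts G \<Longrightarrow> V v \<in> B" "e \<in> arcs G \<Longrightarrow> Ed e \<in> B" "e \<in> arcs G \<Longrightarrow> Gs e \<in> B"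
  unfolding V_def Ed_def Gs_def by (auto intro!: B_I fc_wmon)

lemma \<phi>_span:
  assumes "f \<in> fc" "\<And>w. w \<in> Poly_Mapping.keys f \<Longrightarrow> \<phi> (wmon (letters w)) \<in> vs.span S"
  shows "\<phi> f \<in> vs.span S"
proof -
  have "\<phi> f = (\<Sum>w\<in>Poly_Mapping.keys f. \<phi> (Poly_Mapping.single w (Poly_Mapping.lookup f w)))"
    by (subst poly_mapping_decomp) (rule \<phi>_sum)
  also have "\<dots> \<in> vs.span S"
  proof (rule vs.span_sum)
    fix w assume w: "w \<in> Poly_Mapping.keys f"
    let ?c = "Poly_Mapping.lookup f w"
    have eq: "Poly_Mapping.single w ?c = Poly_Mapping.single 0 ?c * wmon (letters w)"
      by (simp add: wmon_def mult_single)
    have "wmon (letters w) \<in> fc" using assms(1) w by (intro fc_wmon) (auto simp: fc_def)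
    then show "\<phi> (Poly_Mapping.single w ?c) \<in> vs.span S"
      unfolding eq \<phi>_scale[OF \<open>wmon (letters w) \<in> fc\<close>] by (intro vs.span_scale assms(2) w)
  qed
  finally show ?thesis .
qed

section \<open>Products of paths and adjoint paths\<close>

primrec pe :: "'v \<Rightarrow> 'e list \<Rightarrow> 'r" where
  "pe u [] = V u"
| "pe u (e # p) = Ed e * pe (head G e) p"

text \<open>The adjoint of a path: the factors come in reverse order, from the end of the walk back
  to \<open>u\<close>.\<close>

primrec gs :: "'v \<Rightarrow> 'e list \<Rightarrow> 'r" where
  "gs u [] = V u"
| "gs u (e # p) = gs (head G e) p * Gs e"

lemma V_pe: "awalk u p v \<Longrightarrow> V u * pe u p = pe u p"
  by (cases p) (auto simp: awalk_Nil_iff awalk_Cons_iff V_idem V_Ed simp flip: mult.assoc)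

lemma gs_V: "awalk u p v \<Longrightarrow> gs u p * V u = gs u p"
  by (cases p) (auto simp: awalk_Nil_iff awalk_Cons_iff V_idem Gs_V mult.assoc)

lemma pe_V: "awalk u p v \<Longrightarrow> pe u p * V v = pe u p"
  by (induction p arbitrary: u) (auto simp: awalk_Nil_iff awalk_Cons_iff V_idem mult.assoc)

lemma V_gs: "awalk u p v \<Longrightarrow> V v * gs u p = gs u p"
  by (induction p arbitrary: u) (auto simp: awalk_Nil_iff awalk_Cons_iff V_idem simp flip: mult.assoc)

lemma pe_B: "awalk u p v \<Longrightarrow> pe u p \<in> B"
  by (induction p arbitrary: u) (auto simp: awalk_Nil_iff awalk_Cons_iff letters_B B_simps)

lemma gs_B: "awalk u p v \<Longrightarrow> gs u p \<in> B"
  by (induction p arbitrary: u) (auto simp: awalk_Nil_iff awalk_Cons_iff letters_B B_simps)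

lemma pe_append: "awalk u p v \<Longrightarrow> awalk v q w \<Longrightarrow> pe u (p @ q) = pe u p * pe v q"
  by (induction p arbitrary: u) (auto simp: awalk_Nil_iff awalk_Cons_iff mult.assoc V_pe)

lemma gs_append: "awalk u p v \<Longrightarrow> awalk v q w \<Longrightarrow> gs u (p @ q) = gs v q * gs u p"
  by (induction p arbitrary: u) (auto simp: awalk_Nil_iff awalk_Cons_iff gs_V simp flip: mult.assoc)

lemma gs_pe_same: "awalk u p v \<Longrightarrow> gs u p * pe u p = V v"
proof (induction p arbitrary: u)
  case (Cons e p)
  then have e: "e \<in> arcs G" "awalk (head G e) p v" by (auto simp: awalk_Cons_iff)
  have "gs u (e # p) * pe u (e # p) = gs (head G e) p * (Gs e * Ed e) * pe (head G e) p"
    by (simp add: mult.assoc)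
  also have "\<dots> = V v" using Cons.IH[OF e(2)] e gs_V by (simp add: Gs_Ed_same)
  finally show ?case .
qed (auto simp: awalk_Nil_iff V_idem)

lemma gs_pe_prefix:
  assumes "awalk u p v" "awalk v r w"
  shows "gs u p * pe u (p @ r) = pe v r" "gs u (p @ r) * pe u p = gs v r"
  using gs_pe_same[OF assms(1)] V_pe[OF assms(2)] gs_V[OF assms(2)]
  by (simp_all add: pe_append[OF assms] gs_append[OF assms] mult.assoc) (simp flip: mult.assoc)

text \<open>Excluding prefixes both ways guarantees a first edge at which the paths part, and there
  the inner product vanishes by \<open>CK1_orth\<close>.\<close>

lemma gs_pe_zero:
  assumes "awalk u p v" "awalk u q w" "\<And>r. q \<noteq> p @ r" "\<And>r. p \<noteq> q @ r"
  shows "gs u p * pe u q = 0"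
  using assms
proof (induction p arbitrary: u q)
  case (Cons e p)
  then obtain f q' where q: "q = f # q'" by (cases q) auto
  have e: "e \<in> arcs G" "awalk (head G e) p v" "f \<in> arcs G" "awalk (head G f) q' w"
    using Cons.prems unfolding q by (auto simp: awalk_Cons_iff)
  have eq: "gs u (e # p) * pe u q = gs (head G e) p * (Gs e * Ed f) * pe (head G f) q'"
    unfolding q by (simp add: mult.assoc)
  show ?case
  proof (cases "e = f")
    case True
    have "gs (head G e) p * pe (head G e) q' = 0"
      using Cons.prems True e unfolding q by (intro Cons.IH) auto
    then show ?thesis unfolding eq using True e gs_V by (simp add: Gs_Ed_same)
  next
    case False
    then show ?thesis unfolding eq using e by (simp add: Gs_Ed)
  qed
qed (metis append_Nil)

lemma gs_pe_diff:
  assumes "awalk u p v" "awalk w q z" "u \<noteq> w"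
  shows "gs u p * pe w q = 0"
proof -
  have "gs u p * pe w q = gs u p * (V u * V w) * pe w q"
    using gs_V[OF assms(1)] V_pe[OF assms(2)] by (metis mult.assoc)
  then show ?thesis using V_orth assms awalk_hd_in_verts by simp
qed

text \<open>The inner factor vanishes unless one of \<open>q\<close> and \<open>p'\<close> extends
  the other; the surplus \<open>r\<close> is then appended to an outer path. The walk
  \<open>r\<close> between the meeting vertices is kept in the conclusion for use with hereditary
  sets.\<close>

lemma monomial_mult:
  assumes "awalk u p v" "awalk w q v" "awalk u' p' v'" "awalk w' q' v'"
  shows "(pe u p * gs w q) * (pe u' p' * gs w' q') = 0 \<or>
    (\<exists>r. u' = w \<and> p' = q @ r \<and> awalk v r v' \<and> awalk u (p @ r) v' \<and>
       (pe u p * gs w q) * (pe u' p' * gs w' q') = pe u (p @ r) * gs w' q') \<or>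
    (\<exists>r. u' = w \<and> q = p' @ r \<and> awalk v' r v \<and> awalk w' (q' @ r) v \<and>
       (pe u p * gs w q) * (pe u' p' * gs w' q') = pe u p * gs w' (q' @ r))"
proof -
  have eq: "(pe u p * gs w q) * (pe u' p' * gs w' q') = pe u p * (gs w q * pe u' p') * gs w' q'"
    by (simp add: mult.assoc)
  consider "w \<noteq> u'" | "w = u'" "\<And>r. p' \<noteq> q @ r" "\<And>r. q \<noteq> p' @ r" | r where "w = u'" "p' = q @ r"
    | r where "w = u'" "q = p' @ r" by blast
  then show ?thesis
  proof cases
    case 1
    then show ?thesis unfolding eq using gs_pe_diff assms by simp
  next
    case 2
    then show ?thesis unfolding eq using gs_pe_zero[of w q v p' v'] assms by simp
  next
    case (3 r)
    have r: "awalk v r v'" using assms(2,3) 3 awlast_of_awalk[OF assms(2)]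
      by (auto simp: awalk_append_iff)
    then have "awalk u (p @ r) v'" using assms(1) by (auto intro: awalk_appendI)
    moreover have "pe u p * (gs w q * pe u' p') = pe u (p @ r)"
      using 3 gs_pe_prefix(1)[OF assms(2) r] pe_append[OF assms(1) r] by simp
    ultimately show ?thesis unfolding eq using 3 r by auto
  next
    case (4 r)
    have r: "awalk v' r v" using assms(2,3) 4 awlast_of_awalk[OF assms(3)]
      by (auto simp: awalk_append_iff)
    then have "awalk w' (q' @ r) v" using assms(4) by (auto intro: awalk_appendI)
    moreover have "(gs w q * pe u' p') * gs w' q' = gs w' (q' @ r)"
      using 4 gs_pe_prefix(2)[OF assms(3) r] gs_append[OF assms(4) r] by simp
    ultimately show ?thesis unfolding eq using 4 r by (auto simp: mult.assoc)
  qed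
qed

text \<open>Only the vertex where both paths meet is confined to \<open>H\<close>. The monomial
  factors through that vertex, so for hereditary \<open>H\<close> these monomials span the graded
  ideal generated by \<open>H\<close>.\<close>

definition Mon :: "'v set \<Rightarrow> int \<Rightarrow> 'r set" where
  "Mon H n = {pe u p * gs w q |u p w q v. awalk u p v \<and> awalk w q v \<and> v \<in> H \<and>
     int (length p) - int (length q) = n}"

lemma Mon_mono: "H \<subseteq> H' \<Longrightarrow> Mon H n \<subseteq> Mon H' n"
  unfolding Mon_def by blast

lemma Mon_B: "Mon H n \<subseteq> B"
  unfolding Mon_def by (auto intro: B_simps pe_B gs_B)

lemma reach_hereditary:
  assumes "\<forall>e\<in>arcs G. tail G e \<in> H \<longrightarrow> head G e \<in> H" "awalk u p v" "u \<in> H"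
  shows "v \<in> H"
  using assms(2,3)
  by (induction p arbitrary: u) (use assms(1) in \<open>auto simp: awalk_Nil_iff awalk_Cons_iff\<close>)

lemma Mon_mult:
  assumes H: "\<forall>e\<in>arcs G. tail G e \<in> H \<longrightarrow> head G e \<in> H"
    and x: "x \<in> Mon H n" and y: "y \<in> Mon (verts G) m"
  shows "x * y \<in> insert 0 (Mon H (n + m))" "y * x \<in> insert 0 (Mon H (m + n))"
proof -
  obtain u p w q v where x: "x = pe u p * gs w q" "awalk u p v" "awalk w q v" "v \<in> H" "int (length p) - int (length q) = n"
    using x unfolding Mon_def by blast
  obtain u' p' w' q' v' where y: "y = pe u' p' * gs w' q'" "awalk u' p' v'" "awalk w' q' v'"
    "int (length p') - int (length q') = m"
    using y unfolding Mon_def by blast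
  have reach: "v' \<in> H" if "awalk v r v'" for r using reach_hereditary[OF H that x(4)] .
  have "x * y = 0 \<or> x * y \<in> Mon H (n + m)"
    using monomial_mult[OF x(2,3) y(2,3)]
  proof (elim disjE exE conjE)
    fix r assume r: "p' = q @ r" "awalk v r v'" "awalk u (p @ r) v'"
      "(pe u p * gs w q) * (pe u' p' * gs w' q') = pe u (p @ r) * gs w' q'"
    have "int (length (p @ r)) - int (length q') = n + m" using x(5) y(4) r(1) by simp
    then show ?thesis unfolding x(1) y(1) r(4) Mon_def using r y reach by blast
  next
    fix r assume r: "q = p' @ r" "awalk v' r v" "awalk w' (q' @ r) v"
      "(pe u p * gs w q) * (pe u' p' * gs w' q') = pe u p * gs w' (q' @ r)"
    have "int (length p) - int (length (q' @ r)) = n + m" using x(5) y(4) r(1) by simp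
    then show ?thesis unfolding x(1) y(1) r(4) Mon_def using r x by blast
  qed (simp add: x y)
  then show "x * y \<in> insert 0 (Mon H (n + m))" by blast
  have "y * x = 0 \<or> y * x \<in> Mon H (m + n)"
    using monomial_mult[OF y(2,3) x(2,3)]
  proof (elim disjE exE conjE)
    fix r assume r: "p = q' @ r" "awalk v' r v" "awalk u' (p' @ r) v"
      "(pe u' p' * gs w' q') * (pe u p * gs w q) = pe u' (p' @ r) * gs w q"
    have "int (length (p' @ r)) - int (length q) = m + n" using x(5) y(4) r(1) by simp
    then show ?thesis unfolding x(1) y(1) r(4) Mon_def using r x by blast
  next
    fix r assume r: "q' = p @ r" "awalk v r v'" "awalk w (q @ r) v'"
      "(pe u' p' * gs w' q') * (pe u p * gs w q) = pe u' p' * gs w (q @ r)"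
    have "int (length p') - int (length (q @ r)) = m + n" using x(5) y(4) r(1) by simp
    then show ?thesis unfolding x(1) y(1) r(4) Mon_def using r y reach by blast
  qed (simp add: x y)
  then show "y * x \<in> insert 0 (Mon H (m + n))" by blast
qed

lemma letters_Mon:
  "v \<in> verts G \<Longrightarrow> V v \<in> Mon (verts G) 0" "e \<in> arcs G \<Longrightarrow> Ed e \<in> Mon (verts G) 1"
  "e \<in> arcs G \<Longrightarrow> Gs e \<in> Mon (verts G) (-1)"
proof -
  show "V v \<in> Mon (verts G) 0" if "v \<in> verts G"
    unfolding Mon_def using that
    by (intro CollectI exI[of _ v] exI[of _ "[]"] conjI) (auto simp: V_idem awalk_Nil_iff)
  show "Ed e \<in> Mon (verts G) 1" if "e \<in> arcs G"
    unfolding Mon_def using that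
    by (intro CollectI exI[of _ "tail G e"] exI[of _ "[e]"] exI[of _ "head G e"] exI[of _ "[]"] conjI)
      (auto simp: Ed_V awalk_Nil_iff awalk_Cons_iff mult.assoc V_idem)
  show "Gs e \<in> Mon (verts G) (-1)" if "e \<in> arcs G"
    unfolding Mon_def using that
    by (intro CollectI exI[of _ "head G e"] exI[of _ "[]"] exI[of _ "tail G e"] exI[of _ "[e]"] conjI)
      (auto simp: V_Gs awalk_Nil_iff awalk_Cons_iff V_idem simp flip: mult.assoc)
qed

lemma letter_Mon: "l \<in> graph_letters G \<Longrightarrow> \<exists>n. \<phi> (wmon [l]) \<in> Mon (verts G) n"
  using letters_Mon by (cases l) (auto simp: V_def Ed_def Gs_def)

lemma word_Mon:
  assumes "ls \<noteq> []" "set ls \<subseteq> graph_letters G"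
  shows "\<phi> (wmon ls) \<in> insert 0 (\<Union>n. Mon (verts G) n)"
  using assms
proof (induction ls rule: list_nonempty_induct)
  case (single l)
  then show ?case using letter_Mon by auto
next
  case (cons l ls)
  then have ls: "\<phi> (wmon ls) \<in> insert 0 (\<Union>n. Mon (verts G) n)" by auto
  have "\<phi> (wmon (l # ls)) = \<phi> (wmon [l]) * \<phi> (wmon ls)"
    using \<phi>_append[of "[l]" ls] cons by simp
  moreover obtain n where "\<phi> (wmon [l]) \<in> Mon (verts G) n" using letter_Mon cons by auto
  ultimately show ?case using ls Mon_mult(1)[of "verts G" "\<phi> (wmon [l])" n "\<phi> (wmon ls)"] by auto
qed

text \<open>The monomials span but are in general dependent, since CK2 expresses a regular vertex by
  longer monomials. Nonvanishing is therefore never read off from coefficients.\<close>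

lemma B_span: "B = vs.span (\<Union>n. Mon (verts G) n)"
proof
  show "B \<subseteq> vs.span (\<Union>n. Mon (verts G) n)"
  proof
    fix x assume "x \<in> B"
    then obtain f where f: "f \<in> fc" "x = \<phi> f" by (auto simp: B_def)
    show "x \<in> vs.span (\<Union>n. Mon (verts G) n)" unfolding f(2)
    proof (rule \<phi>_span[OF f(1)])
      fix w assume "w \<in> Poly_Mapping.keys f"
      then have "\<phi> (wmon (letters w)) \<in> insert 0 (\<Union>n. Mon (verts G) n)"
        using f(1) by (intro word_Mon) (auto simp: fc_def)
      then show "\<phi> (wmon (letters w)) \<in> vs.span (\<Union>n. Mon (verts G) n)"
        by (elim insertE) (simp_all only: vs.span_zero vs.span_base)
    qed
  qed
  show "vs.span (\<Union>n. Mon (verts G) n) \<subseteq> B"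
    using Mon_B by (intro vs.span_minimal B_subspace) blast
qed

lemma span_B: "X \<subseteq> B \<Longrightarrow> vs.span X \<subseteq> B"
  by (intro vs.span_minimal B_subspace)

text \<open>Bilinear extension; the inclusion \<open>X \<subseteq> B\<close> is what allows scalars
  to be moved past \<open>a\<close>.\<close>

lemma span_mult:
  assumes X: "X \<subseteq> B" and "a \<in> vs.span X" "b \<in> vs.span Y"
    and XY: "\<And>x y. x \<in> X \<Longrightarrow> y \<in> Y \<Longrightarrow> x * y \<in> vs.span Z"
  shows "a * b \<in> vs.span Z"
  using assms(3)
proof (induction rule: vs.span_induct_alt)
  case base
  then show ?case by (simp add: vs.span_zero)
next
  case (step c y b)
  have "a * y \<in> vs.span Z" using assms(2)
  proof (induction rule: vs.span_induct_alt)
    case base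
    then show ?case by (simp add: vs.span_zero)
  next
    case (step d x a)
    then show ?case using XY \<open>y \<in> Y\<close>
      by (simp add: distrib_right mult.assoc vs.span_add vs.span_scale)
  qed
  moreover have "a * (sc c * y) = sc c * (a * y)"
    using B_comm[of a c] assms(2) span_B[OF X] by (metis mult.assoc subsetD)
  ultimately show ?case using step by (simp add: distrib_left vs.span_add vs.span_scale)
qed

section \<open>Homogeneous components\<close>

lemma path_word_letters: "awalk u p v \<Longrightarrow> path_word u p \<noteq> [] \<and> set (path_word u p) \<subseteq> graph_letters G"
  by (auto simp: path_word_def awalk_Nil_iff awalk_def)

lemma ghost_word_letters: "awalk u p v \<Longrightarrow> ghost_word u p \<noteq> [] \<and> set (ghost_word u p) \<subseteq> graph_letters G"
  by (auto simp: ghost_word_def awalk_Nil_iff awalk_def)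

lemma \<phi>_path: "awalk u p v \<Longrightarrow> \<phi> (wmon (path_word u p)) = pe u p"
proof (induction p arbitrary: u)
  case (Cons e p)
  then have e: "e \<in> arcs G" "awalk (head G e) p v" by (auto simp: awalk_Cons_iff)
  show ?case
  proof (cases "p = []")
    case True
    then show ?thesis using e by (simp add: path_word_def Ed_V flip: Ed_def)
  next
    case False
    then have "path_word u (e # p) = [Edge e] @ path_word (head G e) p" by (simp add: path_word_def)
    then show ?thesis
      using \<phi>_append[of "[Edge e]" "path_word (head G e) p"] path_word_letters[OF e(2)] e Cons.IH[OF e(2)]
      by (simp flip: Ed_def)
  qed
qed (simp add: path_word_def V_def)

lemma \<phi>_ghost: "awalk u p v \<Longrightarrow> \<phi> (wmon (ghost_word u p)) = gs u p"
proof (induction p arbitrary: u)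
  case (Cons e p)
  then have e: "e \<in> arcs G" "awalk (head G e) p v" by (auto simp: awalk_Cons_iff)
  show ?case
  proof (cases "p = []")
    case True
    then show ?thesis using e by (simp add: ghost_word_def V_Gs flip: Gs_def)
  next
    case False
    then have "ghost_word u (e # p) = ghost_word (head G e) p @ [Ghost e]" by (simp add: ghost_word_def)
    then show ?thesis
      using \<phi>_append[of "ghost_word (head G e) p" "[Ghost e]"] ghost_word_letters[OF e(2)] e Cons.IH[OF e(2)]
      by (simp flip: Gs_def)
  qed
qed (simp add: ghost_word_def V_def)

lemma \<phi>_monomial:
  assumes "awalk u p v" "awalk w q v'"
  shows "\<phi> (wmon (path_word u p @ ghost_word w q)) = pe u p * gs w q"
  using \<phi>_append path_word_letters[OF assms(1)] ghost_word_letters[OF assms(2)] \<phi>_path[OF assms(1)] \<phi>_ghost[OF assms(2)]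
  by simp

lemma homogeneous_fc:
  assumes "Poly_Mapping.keys f \<subseteq> homogeneous_words G n"
  shows "f \<in> fc"
  unfolding fc_def
proof (intro CollectI ballI)
  fix w assume "w \<in> Poly_Mapping.keys f"
  then obtain u p u' w1 q w' where "w = Word (path_word u p @ ghost_word w1 q)" "awalk u p u'" "awalk w1 q w'"
    using assms unfolding homogeneous_words_def by blast
  then show "letters w \<noteq> [] \<and> set (letters w) \<subseteq> graph_letters G"
    using path_word_letters[of u p u'] ghost_word_letters[of w1 q w'] by simp
qed

lemma component_eq: "\<phi> ` {f. Poly_Mapping.keys f \<subseteq> homogeneous_words G n} = vs.span (Mon (verts G) n)"
  (is "\<phi> ` ?F = _")
proof
  show "\<phi> ` ?F \<subseteq> vs.span (Mon (verts G) n)"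
  proof clarify
    fix f :: "('v, 'e) lword \<Rightarrow>\<^sub>0 'k" assume f: "Poly_Mapping.keys f \<subseteq> homogeneous_words G n"
    show "\<phi> f \<in> vs.span (Mon (verts G) n)"
    proof (rule \<phi>_span[OF homogeneous_fc[OF f]])
      fix w assume "w \<in> Poly_Mapping.keys f"
      then obtain u p u' w1 q w' where w: "w = Word (path_word u p @ ghost_word w1 q)" "awalk u p u'" "awalk w1 q w'"
        "int (length p) - int (length q) = n"
        using f unfolding homogeneous_words_def by blast
      have eq: "\<phi> (wmon (letters w)) = pe u p * gs w1 q" using w by (simp add: \<phi>_monomial)
      show "\<phi> (wmon (letters w)) \<in> vs.span (Mon (verts G) n)"
      proof (cases "u' = w'")
        case True
        then have "pe u p * gs w1 q \<in> Mon (verts G) n"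
          unfolding Mon_def using w awalk_last_in_verts by blast
        then show ?thesis unfolding eq by (rule vs.span_base)
      next
        case False
        \<comment> \<open>A component also admits pairs of paths with different ends; such a product
          vanishes by orthogonality of the end vertices.\<close>
        have "pe u p * gs w1 q = pe u p * (V u' * V w') * gs w1 q"
          using pe_V[OF w(2)] V_gs[OF w(3)] by (metis mult.assoc)
        also have "\<dots> = 0" using V_orth False w awalk_last_in_verts by simp
        finally show ?thesis unfolding eq by (simp add: vs.span_zero)
      qed
    qed
  qed
  have "vs.subspace (\<phi> ` ?F)"
    unfolding vs.subspace_def
  proof (intro conjI ballI allI)
    show "0 \<in> \<phi> ` ?F" by (intro image_eqI[of _ _ 0]) simp_all
    fix x assume "x \<in> \<phi> ` ?F"
    then obtain f where f: "f \<in> ?F" "x = \<phi> f" by blast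
    show "sc c * x \<in> \<phi> ` ?F" for c
      using f keys_scalar[of c f] \<phi>_scale[OF homogeneous_fc[of f n], of c]
      by (intro image_eqI[of _ _ "Poly_Mapping.single 0 c * f"]) auto
    fix y assume "y \<in> \<phi> ` ?F"
    then obtain g where g: "g \<in> ?F" "y = \<phi> g" by blast
    show "x + y \<in> \<phi> ` ?F"
      using f g Poly_Mapping.keys_add[of f g] by (intro image_eqI[of _ _ "f + g"]) (auto simp: \<phi>_add)
  qed
  moreover have "Mon (verts G) n \<subseteq> \<phi> ` ?F"
  proof
    fix x assume "x \<in> Mon (verts G) n"
    then obtain u p w q v where x: "x = pe u p * gs w q" "awalk u p v" "awalk w q v" "int (length p) - int (length q) = n"
      unfolding Mon_def by blast
    then have "Word (path_word u p @ ghost_word w q) \<in> homogeneous_words G n"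
      unfolding homogeneous_words_def by blast
    then show "x \<in> \<phi> ` ?F" unfolding x(1) \<phi>_monomial[OF x(2,3), symmetric]
      by (intro imageI) (simp add: wmon_def)
  qed
  ultimately show "vs.span (Mon (verts G) n) \<subseteq> \<phi> ` ?F" by (rule vs.span_minimal[rotated])
qed

section \<open>The graded ideal of a hereditary set\<close>

definition J :: "'v set \<Rightarrow> 'r set" where "J H = vs.span (\<Union>n. Mon H n)"

lemma J_B: "J H \<subseteq> B"
  unfolding J_def using Mon_B by (intro span_B) blast

lemma J_ideal:
  assumes H: "\<forall>e\<in>arcs G. tail G e \<in> H \<longrightarrow> head G e \<in> H" and "a \<in> J H" "b \<in> B"
  shows "a * b \<in> J H" "b * a \<in> J H"
proof -
  have m: "x * y \<in> vs.span (\<Union>n. Mon H n)" "y * x \<in> vs.span (\<Union>n. Mon H n)"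
    if xy: "x \<in> (\<Union>n. Mon H n)" "y \<in> (\<Union>n. Mon (verts G) n)" for x y
  proof -
    obtain n k where "x \<in> Mon H n" "y \<in> Mon (verts G) k" using xy by blast
    then have "x * y \<in> insert 0 (Mon H (n + k))" "y * x \<in> insert 0 (Mon H (k + n))"
      using Mon_mult[OF H] by blast+
    then show "x * y \<in> vs.span (\<Union>n. Mon H n)" "y * x \<in> vs.span (\<Union>n. Mon H n)"
      by (auto intro: vs.span_base simp: vs.span_zero)
  qed
  have B: "(\<Union>n. Mon H n) \<subseteq> B" "(\<Union>n. Mon (verts G) n) \<subseteq> B" using Mon_B by blast+
  show "a * b \<in> J H"
    unfolding J_def using assms(2,3) unfolding J_def B_span by (rule span_mult[OF B(1)]) (rule m(1))
  show "b * a \<in> J H"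
    unfolding J_def using assms(3,2) unfolding J_def B_span by (rule span_mult[OF B(2)]) (rule m(2))
qed

lemma span_Union_decomp:
  fixes S :: "int \<Rightarrow> 'r set"
  assumes "a \<in> vs.span (\<Union>n. S n)"
  shows "\<exists>A h. finite A \<and> (\<forall>n. h n \<in> vs.span (S n)) \<and> a = (\<Sum>n\<in>A. h n)"
  using assms
proof (induction rule: vs.span_induct_alt)
  case base
  show ?case by (intro exI[of _ "{}"] exI[of _ "\<lambda>_. 0"]) (simp add: vs.span_zero)
next
  case (step c x a)
  then obtain A h m where A: "finite A" "\<And>n. h n \<in> vs.span (S n)" "a = (\<Sum>n\<in>A. h n)" and m: "x \<in> S m" by blast
  let ?h = "\<lambda>n. (if n \<in> A then h n else 0) + (if n = m then sc c * x else 0)"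
  have "(\<Sum>n\<in>insert m A. if n \<in> A then h n else 0) = a"
    unfolding A(3) using A(1) by (intro sum.mono_neutral_cong_right) auto
  moreover have "(\<Sum>n\<in>insert m A. if n = m then sc c * x else 0) = sc c * x" using A(1) by simp
  ultimately have "sc c * x + a = (\<Sum>n\<in>insert m A. ?h n)" by (simp only: sum.distrib add.commute)
  moreover have "?h n \<in> vs.span (S n)" for n
    using A(2)[of n] m by (auto simp: vs.span_zero vs.span_base vs.span_scale vs.span_add)
  ultimately show ?case using A(1) by (intro exI[of _ "insert m A"] exI[of _ ?h]) blast
qed

end

context rng_iso
begin

lemma purely_infinite_simple_preimg:
  assumes S: "purely_infinite_simple S"
    and rm: "\<And>e. e \<in> carrier R \<Longrightarrow> right_ideal R (right_mult R e)"
  shows "purely_infinite_simple R"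
  unfolding purely_infinite_simple_def
proof (intro conjI allI impI)
  show "simple_ring R" using S simple_ring_preimg by (simp add: purely_infinite_simple_def)
  fix I assume "right_ideal R I \<and> I \<noteq> {\<zero>\<^bsub>R\<^esub>}"
  then have I: "right_ideal R I" "I \<noteq> {\<zero>\<^bsub>R\<^esub>}" by auto
  interpret T: rng_iso S R "the_inv_into (carrier R) \<Psi>" by (rule inverse_iso)
  have "right_ideal S (\<Psi> ` I)" "\<Psi> ` I \<noteq> {\<zero>\<^bsub>S\<^esub>}"
    using I right_ideal_img img_zero_iff right_ideal_sub by auto
  then obtain e where e: "e \<in> I" "infinite_idempotent S (\<Psi> e)"
    using S unfolding purely_infinite_simple_def by blast
  have ec: "e \<in> carrier R" using e(1) right_ideal_sub[OF I(1)] by blast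
  have "right_ideal S (right_mult S (\<Psi> e))"
    using right_ideal_img[OF rm[OF ec]] right_mult_img[OF ec] by simp
  then have "infinite_idempotent R (the_inv_into (carrier R) \<Psi> (\<Psi> e))"
    by (rule T.infinite_idempotent_img[OF e(2)])
  then show "\<exists>e\<in>I. infinite_idempotent R e" using e(1) ec inj by (auto simp: the_inv_into_f_f)
qed

end

section \<open>The Leavitt path algebra as a subring of a type-class ring\<close>

context univ_rep
begin

text \<open>By faithfulness a fibre of \<phi> in \<open>fc\<close> over \<open>B\<close> is a coset
  of \<open>N\<close>, so this is the inverse of the map that \<phi> induces on the
  quotient.\<close>

definition \<Psi> :: "'r \<Rightarrow> (('v, 'e) lword \<Rightarrow>\<^sub>0 'k) set" where
  "\<Psi> b = {f \<in> fc. \<phi> f = b}"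

abbreviation "LL \<equiv> leavitt_path_algebra TYPE('k) G"
abbreviation "RB \<equiv> ring_rec B"

lemma coset_eq:
  assumes "f \<in> fc"
  shows "N +>\<^bsub>free_algebra TYPE('k) G\<^esub> f = \<Psi> (\<phi> f)"
proof -
  have "N +>\<^bsub>free_algebra TYPE('k) G\<^esub> f = (\<Union>h\<in>N. {h + f})"
    unfolding a_r_coset_def' FA_simps ..
  also have "\<dots> = \<Psi> (\<phi> f)"
  proof
    show "(\<Union>h\<in>N. {h + f}) \<subseteq> \<Psi> (\<phi> f)"
      using assms by (auto simp: \<Psi>_def \<phi>_add \<phi>_N intro: fc_add N_fc)
    show "\<Psi> (\<phi> f) \<subseteq> (\<Union>h\<in>N. {h + f})"
    proof
      fix g assume "g \<in> \<Psi> (\<phi> f)"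
      then have "g - f \<in> N"
        using assms by (intro faithful) (auto simp: \<Psi>_def \<phi>_diff intro: fc_diff)
      then show "g \<in> (\<Union>h\<in>N. {h + f})" by (intro UN_I[of "g - f"]) simp_all
    qed
  qed
  finally show ?thesis .
qed

lemma \<Psi>_ne: "b \<in> B \<Longrightarrow> \<Psi> b \<noteq> {}"
  by (auto simp: B_def \<Psi>_def)

lemma \<Psi>_inj: "a \<in> B \<Longrightarrow> \<Psi> a = \<Psi> b \<Longrightarrow> a = b"
  using \<Psi>_ne[of a] by (auto simp: \<Psi>_def)

lemma LL_carrier: "carrier LL = \<Psi> ` B"
proof -
  have "carrier LL = (\<Union>f\<in>fc. {N +>\<^bsub>free_algebra TYPE('k) G\<^esub> f})"
    by (simp add: leavitt_path_algebra_def Let_def FactRing_def A_RCOSETS_def' FA_simps)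
  also have "\<dots> = (\<Union>f\<in>fc. {\<Psi> (\<phi> f)})" by (intro SUP_cong) (simp_all add: coset_eq)
  also have "\<dots> = \<Psi> ` B" by (auto simp: B_def)
  finally show ?thesis .
qed

lemma LL_mult:
  assumes "a \<in> B" "b \<in> B"
  shows "\<Psi> a \<otimes>\<^bsub>LL\<^esub> \<Psi> b = \<Psi> (a * b)"
proof -
  have "\<Psi> a \<otimes>\<^bsub>LL\<^esub> \<Psi> b = (\<Union>f\<in>\<Psi> a. \<Union>g\<in>\<Psi> b. N +>\<^bsub>free_algebra TYPE('k) G\<^esub> (f * g))"
    by (simp add: leavitt_path_algebra_def Let_def FactRing_def rcoset_mult_def FA_simps)
  also have "\<dots> = \<Psi> (a * b)"
    by (intro UN_const_on \<Psi>_ne assms) (auto simp: \<Psi>_def[of a] \<Psi>_def[of b] coset_eq fc_mult \<phi>_mult)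
  finally show ?thesis .
qed

lemma LL_add:
  assumes "a \<in> B" "b \<in> B"
  shows "\<Psi> a \<oplus>\<^bsub>LL\<^esub> \<Psi> b = \<Psi> (a + b)"
proof -
  have "\<Psi> a \<oplus>\<^bsub>LL\<^esub> \<Psi> b = {f + g |f g. f \<in> \<Psi> a \<and> g \<in> \<Psi> b}"
    unfolding leavitt_path_algebra_def Let_def FactRing_def
    by (simp add: set_add_image FA_simps)
  also have "\<dots> = \<Psi> (a + b)"
  proof
    show "{f + g |f g. f \<in> \<Psi> a \<and> g \<in> \<Psi> b} \<subseteq> \<Psi> (a + b)"
      by (auto simp: \<Psi>_def \<phi>_add intro: fc_add)
    show "\<Psi> (a + b) \<subseteq> {f + g |f g. f \<in> \<Psi> a \<and> g \<in> \<Psi> b}"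
    proof
      fix h assume h: "h \<in> \<Psi> (a + b)"
      obtain f where f: "f \<in> \<Psi> a" using \<Psi>_ne[OF assms(1)] by blast
      have "h - f \<in> \<Psi> b" using h f by (auto simp: \<Psi>_def \<phi>_diff intro: fc_diff)
      moreover have "h = f + (h - f)" by simp
      ultimately show "h \<in> {f + g |f g. f \<in> \<Psi> a \<and> g \<in> \<Psi> b}" using f by blast
    qed
  qed
  finally show ?thesis .
qed

lemma LL_zero: "\<zero>\<^bsub>LL\<^esub> = \<Psi> 0"
proof -
  have "\<zero>\<^bsub>LL\<^esub> = N" by (simp add: leavitt_path_algebra_def Let_def FactRing_def)
  also have "\<dots> = \<Psi> 0" by (auto simp: \<Psi>_def \<phi>_N faithful N_fc)
  finally show ?thesis .
qed

lemma RB_simps [simp]: "carrier RB = B" "monoid.mult RB = (*)" "add RB = (+)" "zero RB = 0"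
  by (simp_all add: ring_rec_def)

lemma RB_subrng: "subrng RB"
  by unfold_locales (simp_all add: B_simps)

lemma LL_abelian: "abelian_group LL"
proof (rule abelian_groupI)
  fix x y z assume "x \<in> carrier LL" "y \<in> carrier LL" "z \<in> carrier LL"
  then show "(x \<oplus>\<^bsub>LL\<^esub> y) \<oplus>\<^bsub>LL\<^esub> z = x \<oplus>\<^bsub>LL\<^esub> (y \<oplus>\<^bsub>LL\<^esub> z)"
    unfolding LL_carrier by (auto simp: LL_add B_simps add.assoc)
next
  fix x y assume "x \<in> carrier LL" "y \<in> carrier LL"
  then show "x \<oplus>\<^bsub>LL\<^esub> y \<in> carrier LL" "x \<oplus>\<^bsub>LL\<^esub> y = y \<oplus>\<^bsub>LL\<^esub> x"
    unfolding LL_carrier by (auto simp: LL_add B_simps add.commute)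
next
  show "\<zero>\<^bsub>LL\<^esub> \<in> carrier LL" unfolding LL_carrier LL_zero using B_simps(1) by blast
next
  fix x assume "x \<in> carrier LL"
  then obtain a where a: "a \<in> B" "x = \<Psi> a" unfolding LL_carrier by blast
  show "\<zero>\<^bsub>LL\<^esub> \<oplus>\<^bsub>LL\<^esub> x = x" unfolding LL_zero a(2) using a(1) by (simp add: LL_add B_simps)
  show "\<exists>y\<in>carrier LL. y \<oplus>\<^bsub>LL\<^esub> x = \<zero>\<^bsub>LL\<^esub>"
    unfolding LL_zero LL_carrier a(2) using a(1)
    by (intro bexI[of _ "\<Psi> (- a)"]) (simp_all add: LL_add B_simps)
qed

lemma LL_iso: "rng_iso RB LL \<Psi>"
proof -
  interpret RB: abelian_group RB using subrng.abelian[OF RB_subrng] .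
  interpret LL: abelian_group LL by (rule LL_abelian)
  show ?thesis
  proof
    show "bij_betw \<Psi> (carrier RB) (carrier LL)"
      unfolding bij_betw_def LL_carrier by (auto intro!: inj_onI dest: \<Psi>_inj)
  qed (simp_all add: LL_add LL_mult B_simps)
qed

lemma component_LL: "lpa_component TYPE('k) G n = \<Psi> ` vs.span (Mon (verts G) n)"
proof -
  have "lpa_component TYPE('k) G n = (\<lambda>f. N +>\<^bsub>free_algebra TYPE('k) G\<^esub> f) ` {f. Poly_Mapping.keys f \<subseteq> homogeneous_words G n}"
    unfolding lpa_component_def by blast
  also have "\<dots> = (\<lambda>f. \<Psi> (\<phi> f)) ` {f. Poly_Mapping.keys f \<subseteq> homogeneous_words G n}"
    by (rule image_cong[OF HOL.refl], rule coset_eq, rule homogeneous_fc, erule CollectD)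
  also have "\<dots> = \<Psi> ` vs.span (Mon (verts G) n)"
    unfolding component_eq[symmetric] image_image ..
  finally show ?thesis .
qed

lemma simple_LL_iff: "simple_ring LL \<longleftrightarrow> simple_ring RB"
proof -
  interpret I: rng_iso RB LL \<Psi> by (rule LL_iso)
  interpret T: rng_iso LL RB "the_inv_into (carrier RB) \<Psi>" by (rule I.inverse_iso)
  show ?thesis using I.simple_ring_preimg T.simple_ring_preimg by blast
qed

lemma graded_simple_LL_iff:
  "graded_simple LL (lpa_component TYPE('k) G) \<longleftrightarrow> graded_simple RB (\<lambda>n. vs.span (Mon (verts G) n))"
proof -
  interpret I: rng_iso RB LL \<Psi> by (rule LL_iso)
  interpret T: rng_iso LL RB "the_inv_into (carrier RB) \<Psi>" by (rule I.inverse_iso)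
  have "vs.span (Mon (verts G) n) \<subseteq> carrier RB" for n using span_B[OF Mon_B] by simp
  then have e: "(\<lambda>n. the_inv_into (carrier RB) \<Psi> ` lpa_component TYPE('k) G n) = (\<lambda>n. vs.span (Mon (verts G) n))"
    unfolding component_LL using I.the_inv_img by (intro ext) blast
  have c: "lpa_component TYPE('k) G = (\<lambda>n. \<Psi> ` vs.span (Mon (verts G) n))"
    by (rule ext) (rule component_LL)
  show ?thesis
    using I.graded_simple_preimg[of "\<lambda>n. vs.span (Mon (verts G) n)"]
      T.graded_simple_preimg[of "lpa_component TYPE('k) G"] unfolding e unfolding c by blast
qed

lemma pis_LL_iff: "purely_infinite_simple LL \<longleftrightarrow> purely_infinite_simple RB"
proof -
  interpret I: rng_iso RB LL \<Psi> by (rule LL_iso)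
  interpret T: rng_iso LL RB "the_inv_into (carrier RB) \<Psi>" by (rule I.inverse_iso)
  have R: "right_ideal RB (right_mult RB e)" if "e \<in> carrier RB" for e
    using subrng.right_mult_right_ideal[OF RB_subrng that] .
  have L: "right_ideal LL (right_mult LL e)" if e: "e \<in> carrier LL" for e
  proof -
    obtain b where b: "b \<in> carrier RB" "e = \<Psi> b" using e I.img by blast
    then show ?thesis using I.right_ideal_img[OF R[OF b(1)]] I.right_mult_img[OF b(1)] by simp
  qed
  show ?thesis using I.purely_infinite_simple_preimg[OF _ R] T.purely_infinite_simple_preimg[OF _ L] by blast
qed

end

section \<open>Boundary path representations\<close>

text \<open>The universal property of the free algebra: operators for the letters that commute with
  scalars extend to all combinations of words. For a representation only the relators remain to be
  checked.\<close>

locale letter_rep =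
  fixes \<theta> :: "('v, 'e) letter \<Rightarrow> 'r::{ring, monoid_mult}" and sc :: "'k::field \<Rightarrow> 'r"
  assumes sc_add: "sc (c + d) = sc c + sc d" and sc_mult: "sc (c * d) = sc c * sc d" and sc_1: "sc 1 = 1"
    and sc_comm: "\<theta> l * sc c = sc c * \<theta> l"
begin

definition word :: "('v, 'e) lword \<Rightarrow> 'r" where
  "word w = prod_list (map \<theta> (letters w))"

definition ext :: "(('v, 'e) lword \<Rightarrow>\<^sub>0 'k) \<Rightarrow> 'r" where
  "ext f = (\<Sum>w\<in>Poly_Mapping.keys f. sc (Poly_Mapping.lookup f w) * word w)"

lemma sc_0: "sc 0 = 0"
  using sc_add[of 0 0] by simp

lemma word_add: "word (u + w) = word u * word w"
  by (simp add: word_def plus_lword_def)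

lemma word_comm: "word w * sc c = sc c * word w"
proof -
  have "prod_list (map \<theta> ls) * sc c = sc c * prod_list (map \<theta> ls)" for ls
    by (induction ls) (simp_all add: mult.assoc sc_comm, metis mult.assoc sc_comm)
  then show ?thesis by (simp add: word_def)
qed

lemma ext_superset:
  assumes "finite S" "Poly_Mapping.keys f \<subseteq> S"
  shows "ext f = (\<Sum>w\<in>S. sc (Poly_Mapping.lookup f w) * word w)"
  unfolding ext_def using assms by (intro sum.mono_neutral_left) (auto simp: in_keys_iff sc_0)

lemma ext_add: "ext (f + g) = ext f + ext g"
proof -
  let ?S = "Poly_Mapping.keys f \<union> Poly_Mapping.keys g"
  have "ext (f + g) = (\<Sum>w\<in>?S. sc (Poly_Mapping.lookup (f + g) w) * word w)"
    by (rule ext_superset) (auto simp: Poly_Mapping.keys_add)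
  also have "\<dots> = (\<Sum>w\<in>?S. sc (Poly_Mapping.lookup f w) * word w) + (\<Sum>w\<in>?S. sc (Poly_Mapping.lookup g w) * word w)"
    by (simp add: lookup_add sc_add distrib_right sum.distrib)
  also have "\<dots> = ext f + ext g" by (simp flip: ext_superset)
  finally show ?thesis .
qed

lemma ext_single: "ext (Poly_Mapping.single w c) = sc c * word w"
  using ext_superset[of "{w}" "Poly_Mapping.single w c"] by simp

lemma ext_wmon: "ext (wmon ls) = prod_list (map \<theta> ls)"
  by (simp add: wmon_def ext_single sc_1 word_def)

lemma ext_sum: "ext (sum h A) = (\<Sum>x\<in>A. ext (h x))"
  using ext_single[of 0 0] by (induction A rule: infinite_finite_induct) (auto simp: ext_add sc_0)

lemma ext_mult: "ext (f * g) = ext f * ext g"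
proof -
  let ?s = "Poly_Mapping.single" and ?l = "Poly_Mapping.lookup"
  have "f * g = (\<Sum>u\<in>Poly_Mapping.keys f. ?s u (?l f u)) * (\<Sum>v\<in>Poly_Mapping.keys g. ?s v (?l g v))"
    by (simp flip: poly_mapping_decomp)
  also have "\<dots> = (\<Sum>u\<in>Poly_Mapping.keys f. \<Sum>v\<in>Poly_Mapping.keys g. ?s (u + v) (?l f u * ?l g v))"
    by (simp add: sum_product mult_single)
  finally have "ext (f * g) = (\<Sum>u\<in>Poly_Mapping.keys f. \<Sum>v\<in>Poly_Mapping.keys g. sc (?l f u * ?l g v) * word (u + v))"
    by (simp add: ext_sum ext_single)
  also have "\<dots> = (\<Sum>u\<in>Poly_Mapping.keys f. \<Sum>v\<in>Poly_Mapping.keys g. (sc (?l f u) * word u) * (sc (?l g v) * word v))"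
  proof (intro sum.cong HOL.refl)
    fix u v
    have "sc (?l f u * ?l g v) * word (u + v) = sc (?l f u) * (sc (?l g v) * word u) * word v"
      by (simp add: sc_mult word_add mult.assoc)
    then show "sc (?l f u * ?l g v) * word (u + v) = (sc (?l f u) * word u) * (sc (?l g v) * word v)"
      unfolding word_comm[of u "?l g v", symmetric] by (simp only: mult.assoc)
  qed
  also have "\<dots> = ext f * ext g" by (simp add: ext_def sum_product)
  finally show ?thesis .
qed

lemma ext_comm: "ext f * sc c = sc c * ext f"
proof -
  have "(sc d * word w) * sc c = sc c * (sc d * word w)" for d w
  proof -
    have "(sc d * word w) * sc c = sc d * (sc c * word w)" by (simp add: mult.assoc word_comm)
    also have "\<dots> = sc c * (sc d * word w)"
      by (simp only: mult.assoc[symmetric] sc_mult[symmetric] mult.commute[of c d])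
    finally show ?thesis .
  qed
  then show ?thesis by (simp add: ext_def sum_distrib_left sum_distrib_right)
qed

lemma lpa_repI:
  assumes "wf_digraph G" "\<And>f. f \<in> relators G \<Longrightarrow> ext f = 0"
  shows "lpa_rep G ext sc"
proof -
  interpret wf_digraph G by fact
  have "ext (Poly_Mapping.single 0 c * f) = sc c * ext f" for c f
    by (simp add: ext_mult ext_single word_def zero_lword_def)
  then show ?thesis
    by unfold_locales (simp_all add: ext_add ext_mult ext_comm sc_add sc_mult sc_1 assms(2))
qed

end

lemma app_sum: "app (sum h A) x = (\<Sum>a\<in>A. app (h a) x)"
  by (induction A rule: infinite_finite_induct) auto

lemma sum_fun_at: "(\<Sum>a\<in>A. h a) y = (\<Sum>a\<in>A. h a y)"
  by (induction A rule: infinite_finite_induct) auto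

type_synonym ('v, 'e) bpath = "(nat \<Rightarrow> 'v \<times> 'e option) \<times> int"

context wf_digraph
begin

text \<open>
  A boundary path outside \<open>H\<close>: an infinite path, or a finite one that ends in a vertex that is not
  regular and stays there. The integer component of \<^typ>\<open>('v, 'e) bpath\<close> records a degree, which an
  edge raises by \<open>\<delta>\<close>.
\<close>

definition bvalid :: "'a set \<Rightarrow> (nat \<Rightarrow> 'a \<times> 'b option) \<Rightarrow> bool" where
  "bvalid H w \<longleftrightarrow> (\<forall>n. fst (w n) \<in> verts G - H \<and> (case snd (w n) of
      Some e \<Rightarrow> e \<in> arcs G \<and> tail G e = fst (w n) \<and> fst (w (Suc n)) = head G e
    | None \<Rightarrow> \<not> regular_vertex G (fst (w n)) \<and> w (Suc n) = w n))"

definition bcons :: "'b \<Rightarrow> (nat \<Rightarrow> 'a \<times> 'b option) \<Rightarrow> (nat \<Rightarrow> 'a \<times> 'b option)" where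
  "bcons e w = case_nat (tail G e, Some e) w"

lemma bcons_simps [simp]: "bcons e w 0 = (tail G e, Some e)" "bcons e w (Suc n) = w n" "bcons e w \<circ> Suc = w"
  by (auto simp: bcons_def)

lemma bvalid_tl: "bvalid H w \<Longrightarrow> bvalid H (w \<circ> Suc)"
  unfolding bvalid_def comp_def by blast

lemma bvalid_shift: "bvalid H w \<Longrightarrow> bvalid H (\<lambda>n. w (k + n))"
  unfolding bvalid_def by (metis add_Suc_right)

lemma bvalid_vert: "bvalid H w \<Longrightarrow> fst (w n) \<in> verts G - H"
  unfolding bvalid_def by blast

lemma bvalid_Some:
  assumes "bvalid H w" "snd (w n) = Some e"
  shows "e \<in> arcs G" "tail G e = fst (w n)" "fst (w (Suc n)) = head G e"
proof -
  have "case snd (w n) of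
      Some e \<Rightarrow> e \<in> arcs G \<and> tail G e = fst (w n) \<and> fst (w (Suc n)) = head G e
    | None \<Rightarrow> \<not> regular_vertex G (fst (w n)) \<and> w (Suc n) = w n"
    using assms(1) unfolding bvalid_def by blast
  then show "e \<in> arcs G" "tail G e = fst (w n)" "fst (w (Suc n)) = head G e" using assms(2) by auto
qed

lemma bvalid_None:
  assumes "bvalid H w" "snd (w n) = None"
  shows "\<not> regular_vertex G (fst (w n))"
proof -
  have "case snd (w n) of
      Some e \<Rightarrow> e \<in> arcs G \<and> tail G e = fst (w n) \<and> fst (w (Suc n)) = head G e
    | None \<Rightarrow> \<not> regular_vertex G (fst (w n)) \<and> w (Suc n) = w n"
    using assms(1) unfolding bvalid_def by blast
  then show ?thesis using assms(2) by simp
qed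

lemma bvalid_bcons:
  "bvalid H (bcons e w) \<longleftrightarrow> e \<in> arcs G \<and> tail G e \<notin> H \<and> fst (w 0) = head G e \<and> bvalid H w"
proof
  assume v: "bvalid H (bcons e w)"
  have "snd (bcons e w 0) = Some e" unfolding bcons_simps snd_conv ..
  note f = bvalid_Some[OF v this, unfolded bcons_simps]
  note g = bvalid_vert[OF v, of 0, unfolded bcons_simps fst_conv]
  note h = bvalid_tl[OF v, unfolded bcons_simps]
  show "e \<in> arcs G \<and> tail G e \<notin> H \<and> fst (w 0) = head G e \<and> bvalid H w"
    using f(1,3) g h by blast
next
  assume *: "e \<in> arcs G \<and> tail G e \<notin> H \<and> fst (w 0) = head G e \<and> bvalid H w"
  show "bvalid H (bcons e w)"
    unfolding bvalid_def
  proof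
    fix n
    show "fst (bcons e w n) \<in> verts G - H \<and> (case snd (bcons e w n) of
      Some e' \<Rightarrow> e' \<in> arcs G \<and> tail G e' = fst (bcons e w n) \<and> fst (bcons e w (Suc n)) = head G e'
    | None \<Rightarrow> \<not> regular_vertex G (fst (bcons e w n)) \<and> bcons e w (Suc n) = bcons e w n)"
    proof (cases n)
      case 0
      then show ?thesis using * by simp
    next
      case (Suc m)
      show ?thesis unfolding Suc bcons_simps using * unfolding bvalid_def by blast
    qed
  qed
qed

lemma bcons_tl: "bvalid H w \<Longrightarrow> snd (w 0) = Some e \<Longrightarrow> bcons e (w \<circ> Suc) = w"
  using bvalid_Some[of H w 0 e] by (auto simp: bcons_def prod_eq_iff split: nat.split)

text \<open>Saturation lets every regular vertex outside \<open>H\<close> choose an edge whose range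
  is outside \<open>H\<close>. Iterating the choice gives a path, which stops as soon as a vertex is
  not regular.\<close>

lemma bvalid_exists:
  assumes H: "hereditary_saturated G H" and v: "v \<in> verts G" "v \<notin> H"
  shows "\<exists>w. bvalid H w \<and> fst (w 0) = v"
proof -
  have "\<exists>e\<in>out_arcs G u. head G e \<notin> H" if "regular_vertex G u" "u \<notin> H" for u
    using H that unfolding hereditary_saturated_def by blast
  then obtain ch where ch: "\<And>u. regular_vertex G u \<Longrightarrow> u \<notin> H \<Longrightarrow> ch u \<in> out_arcs G u \<and> head G (ch u) \<notin> H"
    by metis
  define nxt where "nxt u = (if regular_vertex G u then head G (ch u) else u)" for u
  define w where "w n = ((nxt ^^ n) v, if regular_vertex G ((nxt ^^ n) v) then Some (ch ((nxt ^^ n) v)) else None)" for n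
  have nxt: "nxt u \<in> verts G - H" if "u \<in> verts G - H" for u
    using that ch[of u] out_arcs_head[of "ch u" u] by (auto simp: nxt_def)
  have it: "(nxt ^^ n) v \<in> verts G - H" for n
  proof (induction n)
    case 0
    then show ?case using v by simp
  next
    case (Suc n)
    then show ?case using nxt by simp
  qed
  have "bvalid H w"
    unfolding bvalid_def
  proof
    fix n
    let ?u = "(nxt ^^ n) v"
    show "fst (w n) \<in> verts G - H \<and> (case snd (w n) of
      Some e \<Rightarrow> e \<in> arcs G \<and> tail G e = fst (w n) \<and> fst (w (Suc n)) = head G e
    | None \<Rightarrow> \<not> regular_vertex G (fst (w n)) \<and> w (Suc n) = w n)"
    proof (cases "regular_vertex G ?u")
      case True
      then show ?thesis using it[of n] ch[of ?u] by (simp add: w_def nxt_def)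
    next
      case False
      then have "nxt ?u = ?u" by (simp add: nxt_def)
      then show ?thesis using it[of n] False by (simp add: w_def)
    qed
  qed
  moreover have "fst (w 0) = v" by (simp add: w_def)
  ultimately show ?thesis by blast
qed

text \<open>The operators act on arbitrary functions on boundary paths, since each value of the
  result depends on at most one value of \<open>F\<close>. An edge reads the path with its first
  edge removed, a ghost edge the path prolonged by that edge. Reading at \<open>d - \<delta>\<close>
  moves functions concentrated in one degree up by \<delta>.\<close>

fun rho_fun :: "'a set \<Rightarrow> int \<Rightarrow> ('a, 'b) letter \<Rightarrow> (('a, 'b) bpath \<Rightarrow> 'k::field) \<Rightarrow> ('a, 'b) bpath \<Rightarrow> 'k" where
  "rho_fun H \<delta> (Vert v) F (w, d) = (if bvalid H w \<and> fst (w 0) = v then F (w, d) else 0)"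
| "rho_fun H \<delta> (Edge e) F (w, d) = (if bvalid H w \<and> snd (w 0) = Some e then F (w \<circ> Suc, d - \<delta>) else 0)"
| "rho_fun H \<delta> (Ghost e) F (w, d) = (if bvalid H (bcons e w) then F (bcons e w, d + \<delta>) else 0)"

definition rho_letter :: "'a set \<Rightarrow> int \<Rightarrow> ('a, 'b) letter \<Rightarrow> (('a, 'b) bpath \<Rightarrow> 'k::field) add_endo" where
  "rho_letter H \<delta> l = Add_endo (rho_fun H \<delta> l)"

definition rho_sc :: "'k \<Rightarrow> (('a, 'b) bpath \<Rightarrow> 'k::field) add_endo" where
  "rho_sc c = Add_endo (\<lambda>F y. c * F y)"

lemma app_rho_letter: "app (rho_letter H \<delta> l :: (('a, 'b) bpath \<Rightarrow> 'k::field) add_endo) = rho_fun H \<delta> l"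
  unfolding rho_letter_def
proof (rule app_Add_endo)
  fix F F' :: "('a, 'b) bpath \<Rightarrow> 'k"
  show "rho_fun H \<delta> l (F + F') = rho_fun H \<delta> l F + rho_fun H \<delta> l F'"
    by (cases l) (auto simp: fun_eq_iff)
qed

lemma app_rho_sc: "app (rho_sc c) F y = c * F y"
  unfolding rho_sc_def by (subst app_Add_endo) (auto simp: fun_eq_iff distrib_left)

lemma rho_endo_eqI: "(\<And>F w d. app f F (w, d) = app g F (w, d)) \<Longrightarrow> f = g"
  by (intro add_endo_eqI ext) auto

lemma rho_letter_rep: "letter_rep (rho_letter H \<delta> :: _ \<Rightarrow> (('a, 'b) bpath \<Rightarrow> 'k::field) add_endo) rho_sc"
proof (unfold_locales, goal_cases)
  case (4 l c)
  show ?case by (rule rho_endo_eqI, cases l) (auto simp: app_rho_letter app_rho_sc)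
qed (rule rho_endo_eqI, simp add: app_rho_sc distrib_right)+

abbreviation "rho_ext H \<delta> \<equiv> letter_rep.ext (rho_letter H \<delta>) rho_sc"

text \<open>By heredity, prepending an edge to a path outside \<open>H\<close> stays outside
  \<open>H\<close>, which gives CK1. A path may stop only at a vertex that is not regular, which
  gives CK2.\<close>

lemma rho_rep:
  assumes H: "hereditary_saturated G H"
  shows "lpa_rep G (rho_ext H \<delta> :: _ \<Rightarrow> (('a, 'b) bpath \<Rightarrow> 'k::field) add_endo) rho_sc"
proof -
  interpret L: letter_rep "rho_letter H \<delta> :: _ \<Rightarrow> (('a, 'b) bpath \<Rightarrow> 'k::field) add_endo" rho_sc
    by (rule rho_letter_rep)
  have ext_diff: "L.ext (f - g) = L.ext f - L.ext g" for f g
    using L.ext_add[of "f - g" g] by (simp add: algebra_simps)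
  note ev = app_rho_letter L.ext_wmon ext_diff
  have her: "tail G e \<notin> H" if "e \<in> arcs G" "head G e \<notin> H" for e
    using H that unfolding hereditary_saturated_def by blast
  have "L.ext f = 0" if "f \<in> relators G" for f
    using that
  proof (induction rule: relators.induct)
    case (vert_orth v w)
    then show ?case by (intro rho_endo_eqI) (simp add: ev)
  next
    case (vert_idem v)
    then show ?case by (intro rho_endo_eqI) (simp add: ev)
  next
    case (edge_source e)
    then show ?case by (intro rho_endo_eqI) (auto simp: ev dest: bvalid_Some)
  next
    case (edge_range e)
    then show ?case by (intro rho_endo_eqI) (auto simp: ev bvalid_tl bvalid_Some)
  next
    case (ghost_range e)
    then show ?case by (intro rho_endo_eqI) (auto simp: ev bvalid_bcons)
  next
    case (ghost_source e)
    then show ?case by (intro rho_endo_eqI) (auto simp: ev)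
  next
    case (CK1_orth e f)
    then show ?case by (intro rho_endo_eqI) (auto simp: ev)
  next
    case (CK1 e)
    then show ?case using her[of e] bvalid_vert[of H _ 0]
      by (intro rho_endo_eqI) (force simp: ev bvalid_bcons)
  next
    case (CK2 v)
    have fin: "finite (out_arcs G v)" using CK2 by (simp add: regular_vertex_def)
    show ?case
    proof (rule rho_endo_eqI)
      fix F :: "('a, 'b) bpath \<Rightarrow> 'k" and w d
      let ?g = "\<lambda>e. if bvalid H w \<and> snd (w 0) = Some e then F (w, d) else 0"
      have "app (L.ext (wmon [Edge e, Ghost e])) F (w, d) = ?g e" for e
        using bcons_tl[of H w e] by (auto simp: ev)
      then have "app (L.ext (\<Sum>e\<in>out_arcs G v. wmon [Edge e, Ghost e])) F (w, d) = (\<Sum>e\<in>out_arcs G v. ?g e)"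
        by (simp add: L.ext_sum app_sum sum_fun_at)
      also have "\<dots> = (if bvalid H w \<and> fst (w 0) = v then F (w, d) else 0)"
      proof (cases "bvalid H w")
        case True
        show ?thesis
        proof (cases "snd (w 0)")
          case None
          then have "fst (w 0) \<noteq> v" using bvalid_None[OF True] CK2 by blast
          then show ?thesis using None by simp
        next
          case (Some e)
          then have e: "e \<in> arcs G" "tail G e = fst (w 0)" using bvalid_Some[OF True] by auto
          show ?thesis using Some True fin e by (auto simp: sum.delta)
        qed
      qed simp
      finally show "app (L.ext (wmon [Vert v] - (\<Sum>e\<in>out_arcs G v. wmon [Edge e, Ghost e]))) F (w, d) = app 0 F (w, d)"
        by (simp add: ev)
    qed
  qed
  then show ?thesis by (intro L.lpa_repI wf_digraph_axioms)
qed

lemma rho_letters: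
  fixes H \<delta>
  defines "\<rho> \<equiv> rho_ext H \<delta> :: _ \<Rightarrow> (('a, 'b) bpath \<Rightarrow> 'k::field) add_endo"
  shows "app (\<rho> (wmon [l])) F = rho_fun H \<delta> l F"
proof -
  interpret L: letter_rep "rho_letter H \<delta> :: _ \<Rightarrow> (('a, 'b) bpath \<Rightarrow> 'k::field) add_endo" rho_sc
    by (rule rho_letter_rep)
  show ?thesis by (simp add: \<rho>_def L.ext_wmon app_rho_letter)
qed

lemma rho_vertex_zero_iff:
  assumes H: "hereditary_saturated G H" and v: "v \<in> verts G"
  shows "(rho_ext H \<delta> (wmon [Vert v]) :: (('a, 'b) bpath \<Rightarrow> 'k::field) add_endo) = 0 \<longleftrightarrow> v \<in> H"
proof
  assume "v \<in> H"
  then show "(rho_ext H \<delta> (wmon [Vert v]) :: (('a, 'b) bpath \<Rightarrow> 'k::field) add_endo) = 0"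
    by (intro rho_endo_eqI) (auto simp: rho_letters dest: bvalid_vert[of _ _ 0])
next
  assume 0: "(rho_ext H \<delta> (wmon [Vert v]) :: (('a, 'b) bpath \<Rightarrow> 'k::field) add_endo) = 0"
  show "v \<in> H"
  proof (rule ccontr)
    assume "v \<notin> H"
    then obtain w where w: "bvalid H w" "fst (w 0) = v" using bvalid_exists[OF H v] by blast
    have "app (rho_ext H \<delta> (wmon [Vert v]) :: (('a, 'b) bpath \<Rightarrow> 'k::field) add_endo) (\<lambda>_. 1) (w, 0) = 1"
      using w by (simp add: rho_letters)
    then show False using 0 by simp
  qed
qed

text \<open>The degree component shows that a vertex is independent of the closed walks of positive length.\<close>

lemma rho_path_degree:
  fixes F :: "('a, 'b) bpath \<Rightarrow> 'k::field"
  assumes "\<And>w d. d \<noteq> k \<Longrightarrow> F (w, d) = 0" "d \<noteq> k + int (length p)" "hereditary_saturated G H"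
  shows "app (lpa_rep.pe G (rho_ext H 1) u p) F (w, d) = 0"
proof -
  interpret R: lpa_rep G "rho_ext H 1 :: _ \<Rightarrow> (('a, 'b) bpath \<Rightarrow> 'k) add_endo" rho_sc
    by (rule rho_rep) fact
  show ?thesis using assms(2)
    by (induction p arbitrary: u w d) (auto simp: R.V_def R.Ed_def rho_letters assms(1))
qed

text \<open>Without exits, a boundary path that starts at \<open>v\<close> is forced to follow
  \<open>p\<close>, so the operator is translation by the length of \<open>p\<close>.\<close>

lemma exitless_path_rep:
  fixes F :: "('a, 'b) bpath \<Rightarrow> 'k::field"
  assumes "hereditary_saturated G H" "awalk v p v'" "exitless G p"
  shows "app (lpa_rep.pe G (rho_ext H \<delta>) v p) F (w, d) =
    (if bvalid H w \<and> fst (w 0) = v then F (\<lambda>n. w (length p + n), d - \<delta> * int (length p)) else 0)"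
    and "bvalid H w \<Longrightarrow> fst (w 0) = v \<Longrightarrow> fst (w (length p)) = v'"
proof -
  interpret R: lpa_rep G "rho_ext H \<delta> :: _ \<Rightarrow> (('a, 'b) bpath \<Rightarrow> 'k) add_endo" rho_sc
    by (rule rho_rep) fact
  have step: "snd (w 0) = Some e \<longleftrightarrow> fst (w 0) = tail G e" if bv: "bvalid H w" "out_arcs G (tail G e) = {e}" for w e
  proof
    show "snd (w 0) = Some e \<Longrightarrow> fst (w 0) = tail G e" using bvalid_Some[OF bv(1)] by simp
    assume f: "fst (w 0) = tail G e"
    have "e \<in> arcs G" using bv(2) unfolding out_arcs_def by blast
    then have "regular_vertex G (tail G e)" using bv(2) by (simp add: regular_vertex_def)
    then obtain e' where e': "snd (w 0) = Some e'" using bvalid_None[OF bv(1), of 0] f by (cases "snd (w 0)") auto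
    then have "e' \<in> out_arcs G (tail G e)" using bvalid_Some[OF bv(1) e'] f by simp
    then show "snd (w 0) = Some e" using bv(2) e' by simp
  qed
  show "app (R.pe v p) F (w, d) =
    (if bvalid H w \<and> fst (w 0) = v then F (\<lambda>n. w (length p + n), d - \<delta> * int (length p)) else 0)"
    using assms(2,3)
  proof (induction p arbitrary: v w d)
    case Nil
    then show ?case by (simp add: R.V_def rho_letters)
  next
    case (Cons e p)
    then have e: "e \<in> arcs G" "v = tail G e" "awalk (head G e) p v'" "exitless G p" "out_arcs G v = {e}"
      by (auto simp: awalk_Cons_iff exitless_def)
    have "app (R.pe v (e # p)) F (w, d) = (if bvalid H w \<and> snd (w 0) = Some e then app (R.pe (head G e) p) F (w \<circ> Suc, d - \<delta>) else 0)"
      by (simp add: R.Ed_def rho_letters)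
    also have "\<dots> = (if bvalid H w \<and> fst (w 0) = v then F (\<lambda>n. w (length (e # p) + n), d - \<delta> * int (length (e # p))) else 0)"
    proof (cases "bvalid H w \<and> fst (w 0) = v")
      case True
      then have s: "snd (w 0) = Some e" using step e(2,5) by simp
      have h: "fst ((w \<circ> Suc) 0) = head G e" using bvalid_Some(3)[of H w 0 e] True s by simp
      have t: "bvalid H (w \<circ> Suc)" using bvalid_tl True by blast
      have "app (R.pe (head G e) p) F (w \<circ> Suc, d - \<delta>) =
          F (\<lambda>n. (w \<circ> Suc) (length p + n), d - \<delta> - \<delta> * int (length p))"
        unfolding Cons.IH[OF e(3,4)] using h t by simp
      then show ?thesis using True s by (simp add: algebra_simps)
    next
      case False
      then have "\<not> (bvalid H w \<and> snd (w 0) = Some e)" using step e(2,5) by blast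
      then show ?thesis using False by (simp only: if_False)
    qed
    finally show ?case .
  qed
  show "fst (w (length p)) = v'" if "bvalid H w" "fst (w 0) = v"
    using assms(2,3) that
  proof (induction p arbitrary: v w)
    case (Cons e p)
    then have e: "e \<in> arcs G" "v = tail G e" "awalk (head G e) p v'" "exitless G p" "out_arcs G v = {e}"
      by (auto simp: awalk_Cons_iff exitless_def)
    have "snd (w 0) = Some e" using step Cons.prems e by simp
    then have "fst ((w \<circ> Suc) 0) = head G e" using bvalid_Some Cons.prems by simp
    then show ?case using Cons.IH[OF e(3,4) bvalid_tl[OF Cons.prems(3)]] by simp
  qed (simp add: awalk_Nil_iff)
qed

text \<open>A vertex on the walk determines the next edge, and closedness keeps the boundary path on
  the walk forever.\<close>

lemma exitless_closed_unique:
  assumes p: "awalk v p v" "p \<noteq> []" "exitless G p" and w: "bvalid H w" "bvalid H w'" "fst (w 0) = v" "fst (w' 0) = v"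
  shows "w = w'"
proof -
  define S where "S = tail G ` set p"
  have vS: "v \<in> S" using p by (cases p) (auto simp: S_def awalk_Cons_iff)
  \<comment> \<open>An edge of the walk ends in the source of another edge, except possibly the
    last, which ends in \<open>v\<close>, the source of the first.\<close>
  have hS: "head G e \<in> S" if "e \<in> set p" for e
  proof -
    have "head G e \<in> set (awalk_verts v p)" using awalk_verts_arc2[OF p(1) that] .
    then have "head G e \<in> S \<or> head G e = head G (last p)" using p(2) by (auto simp: awalk_verts_conv S_def)
    moreover have "head G (last p) = v" using awlast_of_awalk[OF p(1)] p(1,2) by (auto simp: awalk_verts_conv awalk_conv)
    ultimately show ?thesis using vS by auto
  qed
  have det: "snd (x n) = Some e \<and> fst (x (Suc n)) = head G e" if bv: "bvalid H x" "e \<in> set p" "fst (x n) = tail G e" for x n e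
  proof -
    have o: "out_arcs G (tail G e) = {e}" using p(3) bv(2) by (simp add: exitless_def)
    have "e \<in> arcs G" using o unfolding out_arcs_def by blast
    then have "regular_vertex G (tail G e)" using o by (simp add: regular_vertex_def)
    then obtain e' where e': "snd (x n) = Some e'" using bvalid_None[OF bv(1), of n] bv(3) by (cases "snd (x n)") auto
    then have "e' \<in> out_arcs G (tail G e)" using bvalid_Some[OF bv(1) e'] bv(3) by simp
    then show ?thesis using o e' bvalid_Some[OF bv(1) e'] by simp
  qed
  have same: "fst (w n) \<in> S \<and> fst (w n) = fst (w' n)" for n
  proof (induction n)
    case 0
    then show ?case using w vS by simp
  next
    case (Suc n)
    then obtain e where e: "e \<in> set p" "fst (w n) = tail G e" by (auto simp: S_def)
    then show ?case using det[OF w(1) e] det[OF w(2) e(1)] Suc hS[OF e(1)] by simp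
  qed
  show ?thesis
  proof
    fix n
    obtain e where e: "e \<in> set p" "fst (w n) = tail G e" using same[of n] by (auto simp: S_def)
    then show "w n = w' n" using det[OF w(1) e] det[OF w(2) e(1)] same[of n] by (simp add: prod_eq_iff)
  qed
qed

text \<open>With increment \<open>0\<close> the walk acts by translation alone, and the unique
  boundary path at \<open>v\<close> is invariant under it. The difference of vertex and walk thus
  lies in the kernel.\<close>

lemma exitless_closed_rep:
  assumes H: "hereditary_saturated G H" and p: "awalk v p v" "p \<noteq> []" "exitless G p"
  shows "lpa_rep.pe G (rho_ext H 0) v p = (rho_ext H 0 (wmon [Vert v]) :: (('a, 'b) bpath \<Rightarrow> 'k::field) add_endo)"
proof (rule rho_endo_eqI)
  fix F :: "('a, 'b) bpath \<Rightarrow> 'k" and w d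
  have "(\<lambda>n. w (length p + n)) = w" if "bvalid H w" "fst (w 0) = v"
    using that exitless_path_rep(2)[OF H p(1,3) that] bvalid_shift[OF that(1), of "length p"]
    by (intro exitless_closed_unique[OF p, of H]) simp_all
  then show "app (lpa_rep.pe G (rho_ext H 0) v p) F (w, d) = app (rho_ext H 0 (wmon [Vert v])) F (w, d)"
    using exitless_path_rep(1)[OF H p(1,3), of 0 F w d] by (simp add: rho_letters)
qed

end

section \<open>Reduction of nonzero elements to vertices\<close>

context univ_rep
begin

text \<open>The kernel of \<phi> on \<open>fc\<close> is \<open>N\<close>, which every
  representation kills. Identities in \<open>B\<close> can thus be tested on boundary paths, by way
  of preimages in the free algebra.\<close>

lemma transfer_zero:
  assumes "lpa_rep G \<psi> s" "f \<in> fc" "\<phi> f = 0"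
  shows "\<psi> f = 0"
  using lpa_rep.\<phi>_N[OF assms(1)] faithful assms(2,3) by blast

lemma V_ne0:
  assumes "v \<in> verts G" shows "V v \<noteq> 0"
proof
  assume "V v = 0"
  then have "(rho_ext {} 1 (wmon [Vert v]) :: (('v, 'e) bpath \<Rightarrow> 'k) add_endo) = 0"
    using assms unfolding V_def
    by (intro transfer_zero[OF rho_rep[OF hereditary_saturated_empty]] fc_wmon) simp_all
  then show False using rho_vertex_zero_iff[OF hereditary_saturated_empty assms] by blast
qed

lemma vertex_closed_walk_independent:
  assumes "finite Q" "\<And>i. i \<in> Q \<Longrightarrow> awalk w (h i) w \<and> h i \<noteq> []" "w \<in> verts G"
    and zero: "sc c * V w + (\<Sum>i\<in>Q. sc (d i) * pe w (h i)) = 0"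
  shows "c = 0"
proof -
  let ?\<rho> = "rho_ext {} 1 :: _ \<Rightarrow> (('v, 'e) bpath \<Rightarrow> 'k) add_endo"
  interpret R: lpa_rep G ?\<rho> rho_sc by (rule rho_rep[OF hereditary_saturated_empty])
  define f where "f = Poly_Mapping.single 0 c * wmon [Vert w] +
    (\<Sum>i\<in>Q. Poly_Mapping.single 0 (d i) * wmon (path_word w (h i)))"
  have V: "wmon [Vert w] \<in> fc" using assms(3) by (intro fc_wmon) simp_all
  have P: "wmon (path_word w (h i)) \<in> fc" if "i \<in> Q" for i
    using path_word_letters[of w "h i" w] assms(2)[OF that] by (intro fc_wmon) auto
  have f: "f \<in> fc" unfolding f_def using V P by (intro fc_add fc_sum fc_scale)
  have "\<phi> f = sc c * V w + (\<Sum>i\<in>Q. sc (d i) * pe w (h i))"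
    unfolding f_def \<phi>_add \<phi>_sum
    by (simp add: \<phi>_scale V P V_def \<phi>_path[of w _ w] assms(2))
  then have "?\<rho> f = 0" using zero by (intro transfer_zero[OF R.lpa_rep_axioms f]) simp
  moreover have "?\<rho> f = rho_sc c * R.V w + (\<Sum>i\<in>Q. rho_sc (d i) * R.pe w (h i))"
    unfolding f_def R.\<phi>_add R.\<phi>_sum
    by (simp add: R.\<phi>_scale V P R.V_def R.\<phi>_path[of w _ w] assms(2))
  ultimately have 0: "rho_sc c * R.V w + (\<Sum>i\<in>Q. rho_sc (d i) * R.pe w (h i)) = 0" by simp
  obtain x where x: "bvalid {} x" "fst (x 0) = w"
    using bvalid_exists[OF hereditary_saturated_empty assms(3)] by blast
  \<comment> \<open>\<open>F\<close> is the indicator of degree \<open>0\<close>. With increment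
    \<open>1\<close> a closed walk of positive length moves it to another degree, so evaluation at
    degree \<open>0\<close> sees the vertex alone.\<close>
  define F :: "('v, 'e) bpath \<Rightarrow> 'k" where "F = (\<lambda>y. if snd y = 0 then 1 else 0)"
  have "app (R.pe w (h i)) F (x, 0) = 0" if "i \<in> Q" for i
    using assms(2)[OF that]
    by (intro rho_path_degree[where k = 0] hereditary_saturated_empty) (auto simp: F_def)
  then have "app (rho_sc c * R.V w + (\<Sum>i\<in>Q. rho_sc (d i) * R.pe w (h i))) F (x, 0) = c * app (R.V w) F (x, 0)"
    by (simp add: app_sum sum_fun_at app_rho_sc)
  moreover have "app (R.V w) F (x, 0) = 1" using x by (simp add: R.V_def rho_letters F_def)
  ultimately show "c = 0" unfolding 0 by simp
qed

definition REset :: "int set \<Rightarrow> int \<Rightarrow> 'r set" where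
  "REset D k = {pe u p |u p v. awalk u p v \<and> int (length p) - k \<in> D}"

definition RE :: "int set \<Rightarrow> int \<Rightarrow> 'r set" where
  "RE D k = vs.span (REset D k)"

lemma REset_B: "REset D k \<subseteq> B"
  unfolding REset_def using pe_B by blast

lemma pe_mult_zero:
  assumes "awalk u p v" "awalk v' q w" "v \<noteq> v'"
  shows "pe u p * pe v' q = 0"
proof -
  have "pe u p * pe v' q = pe u p * (V v * V v') * pe v' q"
    using pe_V[OF assms(1)] V_pe[OF assms(2)] by (metis mult.assoc)
  also have "\<dots> = 0" using V_orth assms awalk_hd_in_verts awalk_last_in_verts by simp
  finally show ?thesis .
qed

lemma RE_mult:
  assumes "x \<in> RE D k" "awalk v q w"
  shows "x * pe v q \<in> RE D (k + int (length q))"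
  unfolding RE_def
proof (rule span_mult[OF REset_B])
  show "x \<in> vs.span (REset D k)" using assms(1) by (simp add: RE_def)
  show "pe v q \<in> vs.span {pe v q}" by (simp add: vs.span_base)
  fix a y assume "a \<in> REset D k" and y: "y \<in> {pe v q}"
  then obtain u p v' where a: "a = pe u p" "awalk u p v'" "int (length p) - k \<in> D"
    unfolding REset_def by blast
  show "a * y \<in> vs.span (REset D (k + int (length q)))"
  proof (cases "v' = v")
    case True
    then have "a * y = pe u (p @ q)" "awalk u (p @ q) w"
      using a y assms(2) pe_append by (auto intro: awalk_appendI)
    moreover have "int (length (p @ q)) - (k + int (length q)) \<in> D" using a(3) by simp
    ultimately have "a * y \<in> REset D (k + int (length q))" unfolding REset_def by blast
    then show ?thesis by (rule vs.span_base)
  next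
    case False
    then show ?thesis using pe_mult_zero a(1,2) assms(2) y by (simp add: vs.span_zero)
  qed
qed

lemma RE_V: "x \<in> RE D k \<Longrightarrow> v \<in> verts G \<Longrightarrow> x * V v \<in> RE D k"
  using RE_mult[of x D k v "[]" v] by (simp add: awalk_Nil_iff)

lemma pe_single: "e \<in> arcs G \<Longrightarrow> pe (tail G e) [e] = Ed e"
  by (simp add: Ed_V)

lemma RE_Ed: "x \<in> RE D k \<Longrightarrow> e \<in> arcs G \<Longrightarrow> x * Ed e \<in> RE D (k + 1)"
  using RE_mult[of x D k "tail G e" "[e]" "head G e"] pe_single[of e] arc_implies_awalk[of e] by simp

text \<open>Elements with ghost degree at most \<open>m\<close>, presented with the last ghost edge split off.\<close>

primrec Gh :: "int set \<Rightarrow> nat \<Rightarrow> int \<Rightarrow> 'r set" where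
  "Gh D 0 k = RE D k"
| "Gh D (Suc m) k = {g + (\<Sum>e\<in>S. a e * Gs e) |g S a. g \<in> RE D k \<and> finite S \<and> S \<subseteq> arcs G \<and>
     (\<forall>e\<in>S. a e \<in> Gh D m (k + 1))}"

lemma Gh_SucI:
  "g \<in> RE D k \<Longrightarrow> finite S \<Longrightarrow> S \<subseteq> arcs G \<Longrightarrow> (\<And>e. e \<in> S \<Longrightarrow> a e \<in> Gh D m (k + 1)) \<Longrightarrow>
    g + (\<Sum>e\<in>S. a e * Gs e) \<in> Gh D (Suc m) k"
  unfolding Gh.simps by blast

lemma RE_subspace: "vs.subspace (RE D k)"
  unfolding RE_def by (rule vs.subspace_span)

lemma Gh_subspace: "vs.subspace (Gh D m k)"
proof (induction m arbitrary: k)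
  case 0
  then show ?case by (simp add: RE_subspace)
next
  case (Suc m)
  note IH = Suc.IH[of "k + 1"]
  have 0: "0 \<in> Gh D (Suc m) k"
    using Gh_SucI[of 0 D k "{}"] vs.subspace_0[OF RE_subspace] by simp
  have add: "x + y \<in> Gh D (Suc m) k" if x: "x \<in> Gh D (Suc m) k" and y: "y \<in> Gh D (Suc m) k" for x y
  proof -
    obtain g S a where x: "x = g + (\<Sum>e\<in>S. a e * Gs e)" "g \<in> RE D k" "finite S" "S \<subseteq> arcs G"
      "\<forall>e\<in>S. a e \<in> Gh D m (k + 1)" using x by auto
    obtain g' S' a' where y: "y = g' + (\<Sum>e\<in>S'. a' e * Gs e)" "g' \<in> RE D k" "finite S'" "S' \<subseteq> arcs G"
      "\<forall>e\<in>S'. a' e \<in> Gh D m (k + 1)" using y by auto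
    let ?a = "\<lambda>e. (if e \<in> S then a e else 0) + (if e \<in> S' then a' e else 0)"
    have "(\<Sum>e\<in>S \<union> S'. (if e \<in> S then a e else 0) * Gs e) = (\<Sum>e\<in>S. a e * Gs e)"
      using x(3) y(3) by (intro sum.mono_neutral_cong_right) auto
    moreover have "(\<Sum>e\<in>S \<union> S'. (if e \<in> S' then a' e else 0) * Gs e) = (\<Sum>e\<in>S'. a' e * Gs e)"
      using x(3) y(3) by (intro sum.mono_neutral_cong_right) auto
    ultimately have eq: "x + y = (g + g') + (\<Sum>e\<in>S \<union> S'. ?a e * Gs e)"
      unfolding x(1) y(1) distrib_right sum.distrib by simp
    have "?a e \<in> Gh D m (k + 1)" for e
      using x(5) y(5) vs.subspace_0[OF IH] vs.subspace_add[OF IH] by simp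
    then show ?thesis unfolding eq using x(2-4) y(2-4) vs.subspace_add[OF RE_subspace]
      by (intro Gh_SucI) auto
  qed
  have scale: "sc c * x \<in> Gh D (Suc m) k" if x: "x \<in> Gh D (Suc m) k" for c x
  proof -
    obtain g S a where x: "x = g + (\<Sum>e\<in>S. a e * Gs e)" "g \<in> RE D k" "finite S" "S \<subseteq> arcs G"
      "\<forall>e\<in>S. a e \<in> Gh D m (k + 1)" using x by auto
    have eq: "sc c * x = sc c * g + (\<Sum>e\<in>S. (sc c * a e) * Gs e)"
      unfolding x(1) by (simp add: distrib_left sum_distrib_left mult.assoc)
    show ?thesis unfolding eq using x vs.subspace_scale[OF RE_subspace] vs.subspace_scale[OF IH]
      by (intro Gh_SucI) auto
  qed
  show ?case unfolding vs.subspace_def using 0 add scale by blast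
qed

lemma RE_Gh: "RE D k \<subseteq> Gh D m k"
proof (cases m)
  case (Suc n)
  then show ?thesis using Gh_SucI[of _ D k "{}" _ n] by fastforce
qed simp

lemma Gh_Suc: "Gh D m k \<subseteq> Gh D (Suc m) k"
proof (induction m arbitrary: k)
  case 0
  then show ?case using RE_Gh[of D k "Suc 0"] by simp
next
  case (Suc m)
  show ?case
  proof
    fix x assume "x \<in> Gh D (Suc m) k"
    then obtain g S a where x: "x = g + (\<Sum>e\<in>S. a e * Gs e)" "g \<in> RE D k" "finite S" "S \<subseteq> arcs G"
      "\<forall>e\<in>S. a e \<in> Gh D m (k + 1)" by auto
    show "x \<in> Gh D (Suc (Suc m)) k" unfolding x(1) using x(2-5) Suc.IH[of "k + 1"] by (intro Gh_SucI) auto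
  qed
qed

lemma Gh_mono: "m \<le> m' \<Longrightarrow> Gh D m k \<subseteq> Gh D m' k"
  using lift_Suc_mono_le[of "\<lambda>m. Gh D m k"] Gh_Suc by blast

lemma sum_Gs_Ed:
  assumes "finite S" "S \<subseteq> arcs G" "f \<in> arcs G"
  shows "(\<Sum>e\<in>S. a e * Gs e) * Ed f = (if f \<in> S then a f * V (head G f) else 0)"
proof -
  have "(\<Sum>e\<in>S. a e * Gs e) * Ed f = (\<Sum>e\<in>S. if e = f then a f * V (head G f) else 0)"
    unfolding sum_distrib_right using assms
    by (intro sum.cong HOL.refl) (auto simp: mult.assoc Gs_Ed Gs_Ed_same)
  then show ?thesis using assms(1) by simp
qed

lemma sum_Gs_V:
  assumes "finite S" "S \<subseteq> arcs G" "v \<in> verts G"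
  shows "(\<Sum>e\<in>S. a e * Gs e) * V v = (\<Sum>e\<in>S \<inter> out_arcs G v. a e * Gs e)"
proof -
  have "a e * Gs e * V v = (if e \<in> out_arcs G v then a e * Gs e else 0)" if "e \<in> S" for e
  proof (cases "e \<in> out_arcs G v")
    case True
    then show ?thesis using Gs_V[of e] by (auto simp: mult.assoc)
  next
    case False
    have e: "e \<in> arcs G" using that assms(2) by blast
    then have "tail G e \<noteq> v" using False by simp
    then have "Gs e * V v = 0"
      using Gs_V[OF e] V_orth[of "tail G e" v] e assms(3) by (metis mult.assoc mult_zero_right tail_in_verts)
    then show ?thesis using False by (simp only: mult.assoc mult_zero_right if_False)
  qed
  then have "(\<Sum>e\<in>S. a e * Gs e) * V v = (\<Sum>e\<in>S. if e \<in> out_arcs G v then a e * Gs e else 0)"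
    unfolding sum_distrib_right by (intro sum.cong HOL.refl) simp
  then show ?thesis using assms(1) by (simp add: sum.inter_restrict)
qed

lemma Gh_V: "x \<in> Gh D m k \<Longrightarrow> v \<in> verts G \<Longrightarrow> x * V v \<in> Gh D m k"
proof (induction m)
  case 0
  then show ?case using RE_V by simp
next
  case (Suc m)
  then obtain g S a where x: "x = g + (\<Sum>e\<in>S. a e * Gs e)" "g \<in> RE D k" "finite S" "S \<subseteq> arcs G"
    "\<forall>e\<in>S. a e \<in> Gh D m (k + 1)" by auto
  show ?case unfolding x(1) distrib_right sum_Gs_V[OF x(3,4) Suc.prems(2)]
    using x RE_V Suc.prems(2) by (intro Gh_SucI) auto
qed

lemma Gh_Ed:
  assumes "x \<in> Gh D (Suc m) k" "f \<in> arcs G"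
  shows "x * Ed f \<in> Gh D m (k + 1)"
proof -
  obtain g S a where x: "x = g + (\<Sum>e\<in>S. a e * Gs e)" "g \<in> RE D k" "finite S" "S \<subseteq> arcs G"
    "\<forall>e\<in>S. a e \<in> Gh D m (k + 1)" using assms(1) by auto
  have "g * Ed f \<in> Gh D m (k + 1)" using RE_Ed[OF x(2) assms(2)] RE_Gh by blast
  moreover have "(if f \<in> S then a f * V (head G f) else 0) \<in> Gh D m (k + 1)"
    using x(5) Gh_V assms(2) vs.subspace_0[OF Gh_subspace] by simp
  ultimately show ?thesis
    unfolding x(1) distrib_right sum_Gs_Ed[OF x(3,4) assms(2)] by (rule vs.subspace_add[OF Gh_subspace])
qed

lemma monomial_Gh:
  assumes "awalk u p v" "awalk w q v" "int (length p) - int (length q) - k \<in> D"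
  shows "pe u p * gs w q \<in> Gh D (length q) k"
  using assms(2,3)
proof (induction q arbitrary: w k)
  case Nil
  then have "pe u p \<in> REset D k" using assms(1) unfolding REset_def by auto
  then show ?case using Nil pe_V[OF assms(1)] by (simp add: awalk_Nil_iff RE_def vs.span_base)
next
  case (Cons e q)
  then have e: "e \<in> arcs G" "awalk (head G e) q v" by (auto simp: awalk_Cons_iff)
  have "int (length p) - int (length q) - (k + 1) \<in> D" using Cons.prems(2) by (simp add: algebra_simps)
  then have "pe u p * gs (head G e) q \<in> Gh D (length q) (k + 1)" using Cons.IH[OF e(2)] by blast
  then have "0 + (\<Sum>e\<in>{e}. (pe u p * gs (head G e) q) * Gs e) \<in> Gh D (Suc (length q)) k"
    using e(1) vs.subspace_0[OF RE_subspace] by (intro Gh_SucI) auto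
  then show ?case by (simp add: mult.assoc)
qed

lemma span_Gh:
  assumes "X \<subseteq> (\<Union>m. Gh D m k)" "x \<in> vs.span X"
  shows "\<exists>m. x \<in> Gh D m k"
  using assms(2)
proof (induction rule: vs.span_induct_alt)
  case base
  then show ?case using vs.subspace_0[OF Gh_subspace] by blast
next
  case (step c y x)
  obtain m m' where "y \<in> Gh D m k" "x \<in> Gh D m' k" using step assms(1) by blast
  then have "y \<in> Gh D (max m m') k" "x \<in> Gh D (max m m') k"
    by (meson Gh_mono max.cobounded1 max.cobounded2 subsetD)+
  then show ?case using vs.subspace_add[OF Gh_subspace] vs.subspace_scale[OF Gh_subspace] by blast
qed

lemma Mon_Gh: "n - k \<in> D \<Longrightarrow> Mon H n \<subseteq> (\<Union>m. Gh D m k)"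
proof
  fix x assume n: "n - k \<in> D" and "x \<in> Mon H n"
  then obtain u p w q v where x: "x = pe u p * gs w q" "awalk u p v" "awalk w q v" "int (length p) - int (length q) = n"
    unfolding Mon_def by blast
  then have "x \<in> Gh D (length q) k" using monomial_Gh[OF x(2,3), of k D] n by simp
  then show "x \<in> (\<Union>m. Gh D m k)" by blast
qed

lemma B_Gh: "x \<in> B \<Longrightarrow> \<exists>m. x \<in> Gh UNIV m 0"
  unfolding B_span by (rule span_Gh[OF UN_least[OF Mon_Gh]]) simp_all

lemma homogeneous_Gh: "x \<in> vs.span (Mon (verts G) n) \<Longrightarrow> \<exists>m. x \<in> Gh {n} m 0"
  by (rule span_Gh[OF Mon_Gh]) simp_all

text \<open>Vertices are local units: the finitely many monomials in \<open>x\<close> have finitely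
  many right end vertices.\<close>

lemma right_unit:
  assumes "x \<in> B"
  shows "\<exists>F. finite F \<and> F \<subseteq> verts G \<and> x = (\<Sum>v\<in>F. x * V v)"
proof -
  \<comment> \<open>Strengthened to all larger finite sets, so that the set may grow when a summand
    is added.\<close>
  have "\<exists>F0. finite F0 \<and> F0 \<subseteq> verts G \<and> (\<forall>F. finite F \<and> F0 \<subseteq> F \<and> F \<subseteq> verts G \<longrightarrow> x = (\<Sum>v\<in>F. x * V v))"
    using assms unfolding B_span
  proof (induction rule: vs.span_induct_alt)
    case base
    then show ?case by (intro exI[of _ "{}"]) simp
  next
    case (step c y x)
    obtain F0 where F0': "finite F0 \<and> F0 \<subseteq> verts G \<and>
        (\<forall>F. finite F \<and> F0 \<subseteq> F \<and> F \<subseteq> verts G \<longrightarrow> x = (\<Sum>v\<in>F. x * V v))"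
      using step(2) by (rule exE)
    then have F0: "finite F0" "F0 \<subseteq> verts G"
      and xF: "\<And>F. finite F \<Longrightarrow> F0 \<subseteq> F \<Longrightarrow> F \<subseteq> verts G \<Longrightarrow> (\<Sum>v\<in>F. x * V v) = x"
      by simp_all
    obtain u p w q v where y: "y = pe u p * gs w q" "awalk u p v" "awalk w q v"
      using step(1) unfolding Mon_def by blast
    have w: "w \<in> verts G" using awalk_hd_in_verts[OF y(3)] .
    have "y * V w = y" unfolding y(1) using gs_V[OF y(3)] by (simp add: mult.assoc)
    moreover have "y * V v = 0" if "v \<noteq> w" "v \<in> verts G" for v
    proof -
      have "y * V v = pe u p * (gs w q * (V w * V v))"
        unfolding y(1) by (subst gs_V[OF y(3), symmetric]) (simp only: mult.assoc)
      then show ?thesis using V_orth[of w v] that w by simp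
    qed
    ultimately have yF: "(\<Sum>v\<in>F. y * V v) = y" if "finite F" "w \<in> F" "F \<subseteq> verts G" for F
      using that by (subst sum.remove[of F w]) (auto intro!: sum.neutral)
    show ?case
    proof (intro exI[of _ "insert w F0"] conjI allI impI)
      show "finite (insert w F0)" "insert w F0 \<subseteq> verts G" using F0 w by auto
      fix F assume F: "finite F \<and> insert w F0 \<subseteq> F \<and> F \<subseteq> verts G"
      have "(\<Sum>v\<in>F. (sc c * y + x) * V v) = sc c * (\<Sum>v\<in>F. y * V v) + (\<Sum>v\<in>F. x * V v)"
        by (simp add: distrib_right sum.distrib sum_distrib_left mult.assoc)
      also have "\<dots> = sc c * y + x" using yF[of F] xF[of F] F by simp
      finally show "sc c * y + x = (\<Sum>v\<in>F. (sc c * y + x) * V v)" by simp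
    qed
  qed
  then show ?thesis by blast
qed

lemma nonzero_right_vertex:
  assumes "x \<in> B" "x \<noteq> 0"
  shows "\<exists>v\<in>verts G. x * V v \<noteq> 0"
proof (rule ccontr)
  assume n: "\<not> (\<exists>v\<in>verts G. x * V v \<noteq> 0)"
  obtain F where "F \<subseteq> verts G" "x = (\<Sum>v\<in>F. x * V v)" using right_unit[OF assms(1)] by blast
  moreover have "(\<Sum>v\<in>F. x * V v) = 0" using n calculation(1) by (intro sum.neutral) blast
  ultimately show False using assms(2) by simp
qed

section \<open>Combinations of a vertex and closed walks\<close>

definition closed_comb :: "'v \<Rightarrow> 'k \<Rightarrow> 'i set \<Rightarrow> ('i \<Rightarrow> 'k) \<Rightarrow> ('i \<Rightarrow> 'e list) \<Rightarrow> 'r" where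
  "closed_comb v c Q d h = sc c * V v + (\<Sum>i\<in>Q. sc (d i) * pe v (h i))"

text \<open>
  Multiplying by the adjoint of a path of minimal length that occurs in a combination of paths turns
  its term into a vertex, and the others into closed walks.
\<close>

lemma real_reduce:
  assumes x: "x \<in> RE D k" and v: "v \<in> verts G" and ne: "x * V v \<noteq> 0"
  shows "\<exists>u0 p0 c Q (d :: 'r \<Rightarrow> 'k) h. awalk u0 p0 v \<and> c \<noteq> 0 \<and> finite Q \<and>
     (\<forall>i\<in>Q. awalk v (h i) v \<and> h i \<noteq> []) \<and> gs u0 p0 * (x * V v) = closed_comb v c Q d h \<and>
     ((\<exists>n. D \<subseteq> {n}) \<longrightarrow> Q = {})"
proof -
  obtain t r where t: "finite t" "t \<subseteq> REset D k" "x = (\<Sum>a\<in>t. sc (r a) * a)"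
    using x unfolding RE_def vs.span_explicit by blast
  \<comment> \<open>Dropping the terms that vanish leaves paths that all end in
    \<open>v\<close>.\<close>
  define T where "T = {a \<in> t. r a \<noteq> 0 \<and> a * V v \<noteq> 0}"
  have T: "finite T" "T \<subseteq> t" using t(1) by (auto simp: T_def)
  have "\<exists>u p. a = pe u p \<and> awalk u p v \<and> int (length p) - k \<in> D" if a: "a \<in> T" for a
  proof -
    obtain u p v' where p: "a = pe u p" "awalk u p v'" "int (length p) - k \<in> D"
      using a T(2) t(2) unfolding REset_def by blast
    have "v' = v"
      using a pe_mult_zero[OF p(2), of v "[]" v] v p(1) by (auto simp: T_def awalk_Nil_iff)
    then show ?thesis using p by blast
  qed
  then obtain us ps where up: "\<And>a. a \<in> T \<Longrightarrow> a = pe (us a) (ps a)" "\<And>a. a \<in> T \<Longrightarrow> awalk (us a) (ps a) v"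
    "\<And>a. a \<in> T \<Longrightarrow> int (length (ps a)) - k \<in> D" by metis
  have xV: "x * V v = (\<Sum>a\<in>T. sc (r a) * a)"
  proof -
    have "x * V v = (\<Sum>a\<in>t. sc (r a) * (a * V v))" by (simp add: t(3) sum_distrib_right mult.assoc)
    also have "\<dots> = (\<Sum>a\<in>T. sc (r a) * (a * V v))"
      using t(1) T by (intro sum.mono_neutral_right) (auto simp: T_def sc_add intro: vs.scale_zero_left)
    also have "\<dots> = (\<Sum>a\<in>T. sc (r a) * a)"
    proof (intro sum.cong HOL.refl)
      fix a assume "a \<in> T"
      then have "a * V v = a" using up(1,2) pe_V by metis
      then show "sc (r a) * (a * V v) = sc (r a) * a" by simp
    qed
    finally show ?thesis .
  qed
  then have "T \<noteq> {}" using ne by auto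
  define a0 where "a0 = arg_min_on (length \<circ> ps) T"
  have a0: "a0 \<in> T" "\<And>a. a \<in> T \<Longrightarrow> length (ps a0) \<le> length (ps a)"
    using arg_min_if_finite[OF T(1) \<open>T \<noteq> {}\<close>, of "length \<circ> ps"] by (auto simp: a0_def not_less[symmetric])
  let ?g = "gs (us a0) (ps a0)"
  \<comment> \<open>Besides the shortest path itself, only its proper extensions survive
    multiplication by its adjoint.\<close>
  define Q where "Q = {a \<in> T - {a0}. us a = us a0 \<and> (\<exists>s. ps a = ps a0 @ s)}"
  define h where "h a = drop (length (ps a0)) (ps a)" for a
  have hQ: "awalk v (h a) v \<and> h a \<noteq> [] \<and> ?g * a = pe v (h a)" if a: "a \<in> Q" for a
  proof -
    obtain s where s: "ps a = ps a0 @ s" "us a = us a0" "a \<in> T" "a \<noteq> a0" using a by (auto simp: Q_def)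
    have h: "h a = s" by (simp add: h_def s(1))
    have w: "awalk v s v" using up(2)[OF s(3)] up(2)[OF a0(1)] s(1,2) awlast_of_awalk[OF up(2)[OF a0(1)]]
      by (auto simp: awalk_append_iff)
    have "s \<noteq> []" using s up(1)[OF s(3)] up(1)[OF a0(1)] by auto
    moreover have "?g * a = pe v s"
      using gs_pe_prefix(1)[OF up(2)[OF a0(1)] w] up(1)[OF s(3)] s(1,2) by metis
    ultimately show ?thesis using w h by simp
  qed
  have other: "?g * a = 0" if a: "a \<in> T" "a \<noteq> a0" "a \<notin> Q" for a
  proof (cases "us a = us a0")
    case True
    have "?g * pe (us a0) (ps a) = 0"
    proof (rule gs_pe_zero[OF up(2)[OF a0(1)]])
      show "awalk (us a0) (ps a) v" using up(2)[OF a(1)] True by simp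
      show np: "ps a \<noteq> ps a0 @ s" for s using a True by (auto simp: Q_def)
      show "ps a0 \<noteq> ps a @ s" for s
      proof
        assume s: "ps a0 = ps a @ s"
        then have "s = []" using a0(2)[OF a(1)] by simp
        then show False using s np[of "[]"] by simp
      qed
    qed
    then show ?thesis using up(1)[OF a(1)] True by simp
  next
    case False
    then show ?thesis using gs_pe_diff[OF up(2)[OF a0(1)] up(2)[OF a(1)]] up(1)[OF a(1)] by auto
  qed
  have gB: "?g * sc c = sc c * ?g" for c using B_comm gs_B[OF up(2)[OF a0(1)]] by blast
  have "?g * (x * V v) = (\<Sum>a\<in>T. sc (r a) * (?g * a))"
    unfolding xV sum_distrib_left by (intro sum.cong HOL.refl) (metis gB mult.assoc)
  also have "\<dots> = sc (r a0) * (?g * a0) + (\<Sum>a\<in>T - {a0}. sc (r a) * (?g * a))"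
    using T(1) a0(1) by (rule sum.remove)
  also have "(\<Sum>a\<in>T - {a0}. sc (r a) * (?g * a)) = (\<Sum>a\<in>Q. sc (r a) * (?g * a))"
    using T(1) other by (intro sum.mono_neutral_right) (auto simp: Q_def)
  also have "\<dots> = (\<Sum>a\<in>Q. sc (r a) * pe v (h a))"
    using hQ by (intro sum.cong HOL.refl) simp
  also have "?g * a0 = V v" using gs_pe_same[OF up(2)[OF a0(1)]] up(1)[OF a0(1)] by simp
  finally have "?g * (x * V v) = closed_comb v (r a0) Q r h" by (simp add: closed_comb_def)
  \<comment> \<open>In the homogeneous case all paths have the same length, so none extends the
    shortest one properly.\<close>
  moreover have "Q = {}" if D: "D \<subseteq> {n}" for n
  proof (rule ccontr)
    assume "Q \<noteq> {}"
    then obtain a where a: "a \<in> Q" by blast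
    then have "a \<in> T" "h a \<noteq> []" using hQ by (auto simp: Q_def)
    then have "length (ps a0) < length (ps a)" by (simp add: h_def)
    moreover have "int (length (ps a)) - k = n" "int (length (ps a0)) - k = n"
      using up(3)[OF \<open>a \<in> T\<close>] up(3)[OF a0(1)] D by auto
    ultimately show False by simp
  qed
  moreover have "r a0 \<noteq> 0" using a0(1) by (simp add: T_def)
  moreover have "finite Q" using T(1) by (simp add: Q_def)
  ultimately show ?thesis using up(2)[OF a0(1)] hQ by blast
qed

text \<open>Conjugation by \<tau> keeps the coefficient of the vertex and kills every closed walk
  whose prolongation by \<tau> does not begin with \<tau>. A surviving walk keeps its length and
  hence stays nonempty.\<close>

lemma closed_comb_conj:
  assumes \<tau>: "awalk v \<tau> w" and Q: "finite Q" "\<And>i. i \<in> Q \<Longrightarrow> awalk v (h i) v \<and> h i \<noteq> []"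
  defines "Q' \<equiv> {i \<in> Q. \<exists>r. h i @ \<tau> = \<tau> @ r}" and "h' \<equiv> \<lambda>i. drop (length \<tau>) (h i @ \<tau>)"
  shows "gs v \<tau> * closed_comb v c Q d h * pe v \<tau> = closed_comb w c Q' d h'"
    and "i \<in> Q' \<Longrightarrow> awalk w (h' i) w \<and> h' i \<noteq> []"
proof -
  have walk: "awalk v (h i @ \<tau>) w" if "i \<in> Q" for i using Q(2)[OF that] \<tau> by (auto intro: awalk_appendI)
  have in_Q': "awalk w (h' i) w \<and> h' i \<noteq> [] \<and> gs v \<tau> * (pe v (h i) * pe v \<tau>) = pe w (h' i)" if i: "i \<in> Q'" for i
  proof -
    obtain r where r: "h i @ \<tau> = \<tau> @ r" "i \<in> Q" using i by (auto simp: Q'_def)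
    have h': "h' i = r" unfolding h'_def r(1) by simp
    have w: "awalk w r w" using walk[OF r(2)] \<tau> unfolding r(1)
      using awlast_of_awalk[OF \<tau>] by (auto simp: awalk_append_iff)
    have "length (h i) = length r" using arg_cong[OF r(1), of length] by simp
    then have "r \<noteq> []" using Q(2)[OF r(2)] by auto
    moreover have "pe v (h i) * pe v \<tau> = pe v (\<tau> @ r)"
      using pe_append[OF _ \<tau>, of v "h i"] Q(2)[OF r(2)] r(1) by simp
    ultimately show ?thesis using gs_pe_prefix(1)[OF \<tau> w] w h' by simp
  qed
  then show "i \<in> Q' \<Longrightarrow> awalk w (h' i) w \<and> h' i \<noteq> []" by blast
  have zero: "gs v \<tau> * (pe v (h i) * pe v \<tau>) = 0" if i: "i \<in> Q" "i \<notin> Q'" for i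
  proof -
    have "gs v \<tau> * pe v (h i @ \<tau>) = 0"
    proof (rule gs_pe_zero[OF \<tau> walk[OF i(1)]])
      show "h i @ \<tau> \<noteq> \<tau> @ r" for r using i by (auto simp: Q'_def)
      show "\<tau> \<noteq> (h i @ \<tau>) @ r" for r
      proof
        assume "\<tau> = (h i @ \<tau>) @ r"
        from arg_cong[OF this, of length] show False using Q(2)[OF i(1)] by simp
      qed
    qed
    then show ?thesis using pe_append[OF _ \<tau>, of v "h i"] Q(2)[OF i(1)] by simp
  qed
  have gB: "gs v \<tau> * sc c = sc c * gs v \<tau>" for c using B_comm gs_B[OF \<tau>] by blast
  have move: "gs v \<tau> * (sc b * y) * z = sc b * (gs v \<tau> * (y * z))" for b y z
    using gB[of b] by (simp add: mult.assoc) (simp flip: mult.assoc)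
  have "gs v \<tau> * closed_comb v c Q d h * pe v \<tau> =
     sc c * (gs v \<tau> * (V v * pe v \<tau>)) + (\<Sum>i\<in>Q. sc (d i) * (gs v \<tau> * (pe v (h i) * pe v \<tau>)))"
    unfolding closed_comb_def distrib_left distrib_right sum_distrib_left sum_distrib_right move ..
  also have "gs v \<tau> * (V v * pe v \<tau>) = V w" using V_pe[OF \<tau>] gs_pe_same[OF \<tau>] by simp
  also have "(\<Sum>i\<in>Q. sc (d i) * (gs v \<tau> * (pe v (h i) * pe v \<tau>))) =
     (\<Sum>i\<in>Q'. sc (d i) * (gs v \<tau> * (pe v (h i) * pe v \<tau>)))"
    using Q(1) zero by (intro sum.mono_neutral_right) (auto simp: Q'_def)
  also have "\<dots> = (\<Sum>i\<in>Q'. sc (d i) * pe w (h' i))"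
    using in_Q' by (intro sum.cong HOL.refl) simp
  finally show "gs v \<tau> * closed_comb v c Q d h * pe v \<tau> = closed_comb w c Q' d h'"
    by (simp add: closed_comb_def)
qed

text \<open>If the product with the source vertex were nonzero, it could be reduced to a vertex plus
  closed walks. Conjugating by \<open>f\<close> keeps the coefficient of the vertex but yields zero,
  against \<open>vertex_closed_walk_independent\<close>.\<close>

lemma RE_cancel:
  assumes g: "g \<in> RE D k" and f: "f \<in> arcs G" and 0: "g * Ed f = 0"
  shows "g * V (tail G f) = 0"
proof (rule ccontr)
  let ?v = "tail G f"
  assume "g * V ?v \<noteq> 0"
  then obtain u0 p0 c Q d h where r: "awalk u0 p0 ?v" "c \<noteq> 0" "finite Q"
     "\<forall>i\<in>(Q :: 'r set). awalk ?v (h i) ?v \<and> h i \<noteq> []" "gs u0 p0 * (g * V ?v) = closed_comb ?v c Q d h"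
    using real_reduce[OF g, of ?v] f by (metis tail_in_verts)
  have \<tau>: "awalk ?v [f] (head G f)" using arc_implies_awalk[OF f] .
  have "closed_comb ?v c Q d h * pe ?v [f] = gs u0 p0 * (g * (V ?v * Ed f))"
    unfolding r(5)[symmetric] pe_single[OF f] by (simp add: mult.assoc)
  also have "\<dots> = 0" using V_Ed[OF f] 0 by simp
  finally have z: "gs ?v [f] * closed_comb ?v c Q d h * pe ?v [f] = 0" by (simp add: mult.assoc)
  define Q' where "Q' = {i \<in> Q. \<exists>r. h i @ [f] = [f] @ r}"
  define h' where "h' = (\<lambda>i. drop (length [f]) (h i @ [f]))"
  have conj: "gs ?v [f] * closed_comb ?v c Q d h * pe ?v [f] = closed_comb (head G f) c Q' d h'"
    and walks: "\<And>i. i \<in> Q' \<Longrightarrow> awalk (head G f) (h' i) (head G f) \<and> h' i \<noteq> []"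
    using closed_comb_conj[OF \<tau> r(3), of h] r(4) unfolding Q'_def h'_def by blast+
  have "c = 0"
  proof (rule vertex_closed_walk_independent[OF _ walks])
    show "finite Q'" using r(3) by (simp add: Q'_def)
    show "sc c * V (head G f) + (\<Sum>i\<in>Q'. sc (d i) * pe (head G f) (h' i)) = 0"
      using z conj unfolding closed_comb_def by simp
  qed (use f in auto)
  then show False using r(2) by simp
qed

section \<open>Removing ghost edges\<close>

lemma Gh_B: "Gh D m k \<subseteq> B"
proof (induction m arbitrary: k)
  case 0
  then show ?case unfolding Gh.simps RE_def by (rule span_B[OF REset_B])
next
  case (Suc m)
  show ?case
  proof
    fix x assume "x \<in> Gh D (Suc m) k"
    then obtain g S a where x: "x = g + (\<Sum>e\<in>S. a e * Gs e)" "g \<in> RE D k" "S \<subseteq> arcs G"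
      "\<forall>e\<in>S. a e \<in> Gh D m (k + 1)" by auto
    have "g \<in> B" using x(2) span_B[OF REset_B] unfolding RE_def by blast
    moreover have "a e * Gs e \<in> B" if "e \<in> S" for e
      using that x(3,4) Suc.IH[of "k + 1"] letters_B(3) B_simps(3) by blast
    ultimately show "x \<in> B" unfolding x(1) by (intro B_simps(2) B_sum)
  qed
qed

text \<open>Multiplying by an edge lowers the ghost degree. If all edges annihilate
  \<open>x\<close>, its ghost terms are determined by the real part \<open>g\<close>, and a vertex
  \<open>v\<close> with \<open>x * V v\<close> nonzero must be a sink, at which no ghost term is
  left.\<close>

lemma Gh_to_RE:
  assumes "x \<in> Gh D m k" "x \<noteq> 0"
  shows "\<exists>u \<eta> v. awalk u \<eta> v \<and> x * pe u \<eta> \<noteq> 0 \<and> x * pe u \<eta> \<in> RE D (k + int (length \<eta>))"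
  using assms
proof (induction m arbitrary: k x)
  case 0
  obtain v where v: "v \<in> verts G" "x * V v \<noteq> 0"
    using nonzero_right_vertex[OF _ 0(2)] Gh_B 0(1) by blast
  then show ?case using RE_V[of x D k v] 0
    by (intro exI[of _ v] exI[of _ "[]"]) (auto simp: awalk_Nil_iff)
next
  case (Suc m)
  show ?case
  proof (cases "\<exists>f\<in>arcs G. x * Ed f \<noteq> 0")
    case True
    then obtain f where f: "f \<in> arcs G" "x * Ed f \<noteq> 0" by blast
    obtain u \<eta> v where \<eta>: "awalk u \<eta> v" "x * Ed f * pe u \<eta> \<noteq> 0" "x * Ed f * pe u \<eta> \<in> RE D (k + 1 + int (length \<eta>))"
      using Suc.IH[OF Gh_Ed[OF Suc.prems(1) f(1)] f(2)] by blast
    have "u = head G f"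
    proof (rule ccontr)
      assume "u \<noteq> head G f"
      then have "pe (tail G f) [f] * pe u \<eta> = 0"
        using pe_mult_zero[OF arc_implies_awalk[OF f(1)] \<eta>(1)] by blast
      then have "Ed f * pe u \<eta> = 0" unfolding pe_single[OF f(1)] .
      then show False using \<eta>(2) by (simp add: mult.assoc)
    qed
    then have "awalk (tail G f) (f # \<eta>) v" "x * pe (tail G f) (f # \<eta>) = x * Ed f * pe u \<eta>"
      using \<eta>(1) f(1) by (auto simp: awalk_Cons_iff mult.assoc)
    then show ?thesis using \<eta> by (intro exI[of _ "tail G f"] exI[of _ "f # \<eta>"] exI[of _ v]) (simp add: algebra_simps)
  next
    case False
    then have xEd: "x * Ed f = 0" if "f \<in> arcs G" for f using that by blast
    obtain g S a where x: "x = g + (\<Sum>e\<in>S. a e * Gs e)" "g \<in> RE D k" "finite S" "S \<subseteq> arcs G"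
      "\<forall>e\<in>S. a e \<in> Gh D m (k + 1)" using Suc.prems(1) by auto
    obtain v where v: "v \<in> verts G" "x * V v \<noteq> 0"
      using nonzero_right_vertex[OF _ Suc.prems(2)] Gh_B Suc.prems(1) by blast
    have aG: "a e * Gs e = - (g * (Ed e * Gs e))" if e: "e \<in> S" for e
    proof -
      have ea: "e \<in> arcs G" using e x(4) by blast
      have "g * Ed e + a e * V (head G e) = 0"
        using xEd[OF ea] e unfolding x(1) distrib_right sum_Gs_Ed[OF x(3,4) ea] by simp
      then have "a e * V (head G e) = - (g * Ed e)" by (simp add: add_eq_0_iff)
      then have "a e * V (head G e) * Gs e = - (g * (Ed e * Gs e))" by (simp add: mult.assoc)
      then show ?thesis using V_Gs[OF ea] by (simp add: mult.assoc)
    qed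
    have "(\<Sum>e\<in>S \<inter> out_arcs G v. a e * Gs e) = (\<Sum>e\<in>S \<inter> out_arcs G v. - (g * (Ed e * Gs e)))"
      using aG by (intro sum.cong HOL.refl) simp
    then have xV: "x * V v = g * V v - (\<Sum>e\<in>S \<inter> out_arcs G v. g * (Ed e * Gs e))"
      unfolding x(1) distrib_right sum_Gs_V[OF x(3,4) v(1)] by (simp add: sum_negf)
    have "out_arcs G v = {}"
    proof (rule ccontr)
      assume ne: "out_arcs G v \<noteq> {}"
      show False
      \<comment> \<open>If all edges at \<open>v\<close> occur in the finite \<open>S\<close>, then
        \<open>v\<close> is regular and CK2 makes the product zero. Otherwise an edge outside
        \<open>S\<close> meets only \<open>g\<close>, and \<open>RE_cancel\<close> applies.\<close>
      proof (cases "out_arcs G v \<subseteq> S")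
        case True
        then have "S \<inter> out_arcs G v = out_arcs G v" by blast
        moreover have "regular_vertex G v"
          using True ne v(1) x(3) finite_subset unfolding regular_vertex_def by blast
        ultimately have "x * V v = 0"
          unfolding xV using CK2[of v] by (simp flip: sum_distrib_left)
        then show False using v(2) by simp
      next
        case False
        then obtain f where "f \<in> out_arcs G v" "f \<notin> S" by blast
        then have f: "f \<in> arcs G" "tail G f = v" "f \<notin> S" by simp_all
        have "g * Ed f = 0"
          using xEd[OF f(1)] f(3) unfolding x(1) distrib_right sum_Gs_Ed[OF x(3,4) f(1)] by simp
        then have gV: "g * V v = 0" using RE_cancel[OF x(2) f(1)] f(2) by simp
        have "g * (Ed e * Gs e) = 0" if e: "e \<in> out_arcs G v" for e
        proof -
          have "Ed e = V v * Ed e" using V_Ed[of e] e by auto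
          then have "g * (Ed e * Gs e) = g * V v * Ed e * Gs e" by (metis mult.assoc)
          then show ?thesis using gV by simp
        qed
        then have "x * V v = 0" unfolding xV gV by simp
        then show False using v(2) by simp
      qed
    qed
    then have "x * V v = g * V v" unfolding xV by simp
    then have "x * V v \<in> RE D k" using RE_V[OF x(2) v(1)] by simp
    then show ?thesis using v by (intro exI[of _ v] exI[of _ "[]"] exI[of _ v]) (simp add: awalk_Nil_iff)
  qed
qed

text \<open>The path that follows one of the closed walks up to an exit and leaves there conjugates
  the term of that walk to zero. Induction on the number of closed walks leaves the vertex
  alone.\<close>

lemma closed_comb_reduce:
  fixes Q :: "'i set"
  assumes L: "condition_L G" and v: "v \<in> verts G"
    and Q: "finite Q" "\<And>i. i \<in> Q \<Longrightarrow> awalk v (h i) v \<and> h i \<noteq> []"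
  shows "\<exists>\<tau> w. awalk v \<tau> w \<and> gs v \<tau> * closed_comb v c Q d h * pe v \<tau> = sc c * V w"
  using v Q
proof (induction "card Q" arbitrary: Q v h rule: less_induct)
  case less
  show ?case
  proof (cases "Q = {}")
    case True
    have "V v * (sc c * V v) * V v = sc c * V v"
      using B_comm[OF letters_B(1)[OF less.prems(1)], of c] V_idem[OF less.prems(1)] by (metis mult.assoc)
    then show ?thesis using True less.prems(1)
      by (intro exI[of _ "[]"] exI[of _ v]) (simp add: awalk_Nil_iff closed_comb_def)
  next
    case False
    then obtain i0 where i0: "i0 \<in> Q" by blast
    then have "awalk v (h i0) v" "\<not> exitless G (h i0)"
      using less.prems(3) L unfolding condition_L_def by blast+
    then obtain e where "e \<in> set (h i0)" "out_arcs G (tail G e) \<noteq> {e}" "e \<in> out_arcs G (tail G e)"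
      unfolding exitless_def awalk_def by auto
    then obtain f where e: "e \<in> set (h i0)" "f \<in> out_arcs G (tail G e)" "f \<noteq> e" by blast
    obtain p q where pq: "h i0 = p @ e # q" using split_list[OF e(1)] by blast
    have "awalk v p (tail G e)" using \<open>awalk v (h i0) v\<close> unfolding pq
      by (auto simp: awalk_append_iff awalk_Cons_iff dest: awlast_of_awalk)
    then have \<tau>: "awalk v (p @ [f]) (head G f)"
      using e(2) by (auto intro!: awalk_appendI simp: awalk_Cons_iff awalk_Nil_iff)
    define \<tau> where "\<tau> = p @ [f]"
    define Q' where "Q' = {i \<in> Q. \<exists>r. h i @ \<tau> = \<tau> @ r}"
    define h' where "h' = (\<lambda>i. drop (length \<tau>) (h i @ \<tau>))"
    have \<tau>w: "awalk v \<tau> (head G f)" using \<tau> by (simp add: \<tau>_def)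
    have conj: "gs v \<tau> * closed_comb v c Q d h * pe v \<tau> = closed_comb (head G f) c Q' d h'"
      and walks: "\<And>i. i \<in> Q' \<Longrightarrow> awalk (head G f) (h' i) (head G f) \<and> h' i \<noteq> []"
      using closed_comb_conj[OF \<tau>w less.prems(2), of h] less.prems(3) unfolding Q'_def h'_def by blast+
    \<comment> \<open>After \<open>p\<close> the prolonged walk continues with \<open>e\<close>,
      whereas \<tau> continues with \<open>f\<close>.\<close>
    have "i0 \<notin> Q'" using e(3) by (simp add: Q'_def pq \<tau>_def)
    then have "Q' \<subset> Q" using i0 by (auto simp: Q'_def)
    then have "card Q' < card Q" using less.prems(2) by (rule psubset_card_mono[rotated])
    moreover have "finite Q'" using less.prems(2) by (simp add: Q'_def)
    ultimately obtain \<sigma> w where \<sigma>: "awalk (head G f) \<sigma> w"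
      "gs (head G f) \<sigma> * closed_comb (head G f) c Q' d h' * pe (head G f) \<sigma> = sc c * V w"
      using less.hyps[of Q' "head G f" h'] walks awalk_last_in_verts[OF \<tau>w] by blast
    have "gs v (\<tau> @ \<sigma>) * closed_comb v c Q d h * pe v (\<tau> @ \<sigma>) = sc c * V w"
      unfolding gs_append[OF \<tau>w \<sigma>(1)] pe_append[OF \<tau>w \<sigma>(1)] \<sigma>(2)[symmetric] conj[symmetric]
      by (simp add: mult.assoc)
    then show ?thesis using awalk_appendI[OF \<tau>w \<sigma>(1)] by blast
  qed
qed

section \<open>Reduction of homogeneous and of arbitrary elements\<close>

lemma reduction_aux:
  assumes "x \<in> Gh D m k" "x \<noteq> 0"
  shows "\<exists>a\<in>B. \<exists>b\<in>B. \<exists>v\<in>verts G. \<exists>c Q (d :: 'r \<Rightarrow> 'k) h. c \<noteq> 0 \<and> finite Q \<and>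
     (\<forall>i\<in>Q. awalk v (h i) v \<and> h i \<noteq> []) \<and> a * x * b = closed_comb v c Q d h \<and> ((\<exists>n. D \<subseteq> {n}) \<longrightarrow> Q = {})"
proof -
  obtain u \<eta> v where \<eta>: "awalk u \<eta> v" "x * pe u \<eta> \<noteq> 0" "x * pe u \<eta> \<in> RE D (k + int (length \<eta>))"
    using Gh_to_RE[OF assms] by blast
  have v: "v \<in> verts G" using awalk_last_in_verts[OF \<eta>(1)] .
  have "x * pe u \<eta> * V v = x * pe u \<eta>" using pe_V[OF \<eta>(1)] by (simp add: mult.assoc)
  then obtain u0 p0 c Q and d :: "'r \<Rightarrow> 'k" and h where r: "awalk u0 p0 v" "c \<noteq> 0" "finite Q"
     "\<forall>i\<in>Q. awalk v (h i) v \<and> h i \<noteq> []" "gs u0 p0 * (x * pe u \<eta> * V v) = closed_comb v c Q d h"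
     "(\<exists>n. D \<subseteq> {n}) \<longrightarrow> Q = {}"
    using real_reduce[OF \<eta>(3) v] \<eta>(2) by metis
  have "gs u0 p0 * x * (pe u \<eta> * V v) = closed_comb v c Q d h" using r(5) by (simp add: mult.assoc)
  moreover have "gs u0 p0 \<in> B" "pe u \<eta> * V v \<in> B"
    using gs_B[OF r(1)] pe_B[OF \<eta>(1)] letters_B(1)[OF v] B_simps(3) by blast+
  ultimately show ?thesis using v r(2-4,6) by blast
qed

lemma scalar_vertex:
  assumes "a * x * b = sc c * V v" "c \<noteq> 0" "a \<in> B" "b \<in> B" "v \<in> verts G"
  shows "\<exists>a\<in>B. \<exists>b\<in>B. a * x * b = V v"
proof -
  have "(sc (inverse c) * a) * x * b = (sc (inverse c) * sc c) * V v" using assms(1) by (simp add: mult.assoc)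
  also have "\<dots> = V v" using assms(2) by (simp add: sc_1 flip: sc_mult)
  finally show ?thesis using assms B_simps(5) by blast
qed

lemma homogeneous_reduction:
  assumes "x \<in> vs.span (Mon (verts G) n)" "x \<noteq> 0"
  shows "\<exists>a\<in>B. \<exists>b\<in>B. \<exists>v\<in>verts G. a * x * b = V v"
proof -
  obtain m where "x \<in> Gh {n} m 0" using homogeneous_Gh[OF assms(1)] by blast
  then obtain a b v c Q h and d :: "'r \<Rightarrow> 'k" where r: "a \<in> B" "b \<in> B" "v \<in> verts G" "c \<noteq> 0"
    "a * x * b = closed_comb v c Q d h" "(\<exists>n'. {n} \<subseteq> {n'}) \<longrightarrow> Q = {}"
    using reduction_aux[OF _ assms(2)] by metis
  then have "a * x * b = sc c * V v" by (auto simp: closed_comb_def)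
  then show ?thesis using scalar_vertex r by blast
qed

lemma reduction:
  assumes L: "condition_L G" and x: "x \<in> B" "x \<noteq> 0"
  shows "\<exists>a\<in>B. \<exists>b\<in>B. \<exists>v\<in>verts G. a * x * b = V v"
proof -
  obtain m where "x \<in> Gh UNIV m 0" using B_Gh[OF x(1)] by blast
  then obtain a b v c Q h and d :: "'r \<Rightarrow> 'k" where r: "a \<in> B" "b \<in> B" "v \<in> verts G" "c \<noteq> 0" "finite Q"
    "\<forall>i\<in>Q. awalk v (h i) v \<and> h i \<noteq> []" "a * x * b = closed_comb v c Q d h"
    using reduction_aux[OF _ x(2)] by metis
  obtain \<tau> w where \<tau>: "awalk v \<tau> w" "gs v \<tau> * closed_comb v c Q d h * pe v \<tau> = sc c * V w"
    using closed_comb_reduce[OF L r(3,5)] r(6) by blast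
  have "(gs v \<tau> * a) * x * (b * pe v \<tau>) = sc c * V w"
    using \<tau>(2) unfolding r(7)[symmetric] by (simp add: mult.assoc)
  moreover have "gs v \<tau> * a \<in> B" "b * pe v \<tau> \<in> B" using gs_B[OF \<tau>(1)] pe_B[OF \<tau>(1)] r(1,2) B_simps(3) by blast+
  ultimately show ?thesis using scalar_vertex r(4) awalk_last_in_verts[OF \<tau>(1)] by blast
qed

end

section \<open>Simplicity\<close>

context univ_rep
begin

interpretation RB: subrng RB
  by (rule RB_subrng)

lemma ideal_conj:
  assumes "two_sided_ideal RB I" "x \<in> I" "a \<in> B" "b \<in> B"
  shows "a * x * b \<in> I"
  using assms unfolding RB.two_sided_ideal_iff RB_simps by blast

lemma ideal_sum:
  assumes "two_sided_ideal RB I" "\<And>x. x \<in> A \<Longrightarrow> f x \<in> I"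
  shows "sum f A \<in> I"
proof -
  have "0 \<in> I" "\<forall>a\<in>I. \<forall>b\<in>I. a + b \<in> I" using assms(1) unfolding RB.two_sided_ideal_iff by blast+
  then show ?thesis using assms(2) by (induction A rule: infinite_finite_induct) auto
qed

text \<open>Heredity comes from conjugating a vertex by an edge, saturation from CK2.\<close>

lemma ideal_hereditary_saturated:
  assumes I: "two_sided_ideal RB I"
  shows "hereditary_saturated G {v \<in> verts G. V v \<in> I}"
  unfolding hereditary_saturated_def
proof (intro conjI ballI allI impI)
  show "head G e \<in> {v \<in> verts G. V v \<in> I}" if e: "e \<in> arcs G" "tail G e \<in> {v \<in> verts G. V v \<in> I}" for e
  proof -
    have "Gs e * V (tail G e) * Ed e \<in> I" using ideal_conj[OF I] e letters_B by blast
    then show ?thesis using e by (simp add: Gs_V Gs_Ed_same)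
  qed
  fix v assume v: "regular_vertex G v" "\<forall>e\<in>out_arcs G v. head G e \<in> {v \<in> verts G. V v \<in> I}"
  have "Ed e * Gs e \<in> I" if "e \<in> out_arcs G v" for e
  proof -
    have e: "e \<in> arcs G" "V (head G e) \<in> I" using that v(2) by auto
    then have "Ed e * V (head G e) * Gs e \<in> I" using ideal_conj[OF I] letters_B by blast
    then show ?thesis using e(1) by (simp add: Ed_V)
  qed
  then have "V v \<in> I" unfolding CK2[OF v(1)] by (rule ideal_sum[OF I])
  then show "v \<in> {v \<in> verts G. V v \<in> I}" using v(1) by (simp add: regular_vertex_def)
qed blast

lemma ideal_with_vertex:
  assumes T: "hs_simple G" and I: "two_sided_ideal RB I" and v: "v \<in> verts G" "V v \<in> I"
  shows "I = B"
proof
  show "I \<subseteq> B" using I unfolding RB.two_sided_ideal_iff RB_simps by blast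
  have "{v \<in> verts G. V v \<in> I} = verts G"
    using T ideal_hereditary_saturated[OF I] v unfolding hs_simple_def by blast
  then have all: "V w \<in> I" if "w \<in> verts G" for w using that by blast
  show "B \<subseteq> I"
  proof
    fix x assume x: "x \<in> B"
    obtain F where F: "F \<subseteq> verts G" "x = (\<Sum>v\<in>F. x * V v)" using right_unit[OF x] by blast
    have "x * V w \<in> I" if "w \<in> F" for w
      using I all that F(1) x unfolding RB.two_sided_ideal_iff RB_simps by blast
    then have "(\<Sum>v\<in>F. x * V v) \<in> I" by (rule ideal_sum[OF I])
    then show "x \<in> I" using F(2) by simp
  qed
qed

lemma B_nonzero_iff: "B \<noteq> {0} \<longleftrightarrow> verts G \<noteq> {}"
proof
  assume "verts G \<noteq> {}"
  then obtain v where "v \<in> verts G" by blast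
  then show "B \<noteq> {0}" using letters_B(1) V_ne0 by blast
next
  show "verts G \<noteq> {}" if B: "B \<noteq> {0}"
  proof
    assume "verts G = {}"
    then have "Mon (verts G) n = {}" for n by (simp add: Mon_def)
    then have "B = {0}" unfolding B_span by simp
    then show False using B by blast
  qed
qed

text \<open>The representation on boundary paths outside \<open>H\<close> kills the monomials of
  \<open>J H\<close>, which pass through \<open>H\<close>, but no vertex outside
  \<open>H\<close>.\<close>

lemma J_vertex:
  assumes H: "hereditary_saturated G H" and v: "v \<in> verts G" "V v \<in> J H"
  shows "v \<in> H"
proof -
  let ?\<rho> = "rho_ext H 1 :: _ \<Rightarrow> (('v, 'e) bpath \<Rightarrow> 'k) add_endo"
  interpret R: lpa_rep G ?\<rho> rho_sc by (rule rho_rep[OF H])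
  \<comment> \<open>The representation lives on the free algebra, so each element of
    \<open>J H\<close> is accompanied by a preimage in its kernel.\<close>
  have "\<exists>f\<in>fc. \<phi> f = x \<and> ?\<rho> f = 0" if "x \<in> J H" for x
    using that unfolding J_def
  proof (induction rule: vs.span_induct_alt)
    case base
    then show ?case using fc_0 by (intro bexI[of _ 0]) simp_all
  next
    case (step c y x)
    obtain f where f: "f \<in> fc" "\<phi> f = x" "?\<rho> f = 0" using step(2) by blast
    obtain u p w q v where y: "y = pe u p * gs w q" "awalk u p v" "awalk w q v" "v \<in> H"
      using step(1) unfolding Mon_def by blast
    define g where "g = (wmon (path_word u p @ ghost_word w q) :: ('v, 'e) lword \<Rightarrow>\<^sub>0 'k)"
    have g: "g \<in> fc" unfolding g_def using path_word_letters[OF y(2)] ghost_word_letters[OF y(3)]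
      by (intro fc_wmon) auto
    have "?\<rho> g = R.pe u p * R.gs w q" unfolding g_def by (rule R.\<phi>_monomial[OF y(2,3)])
    also have "\<dots> = R.pe u p * (R.V v * R.gs w q)" using R.V_gs[OF y(3)] by simp
    also have "R.V v = 0"
      unfolding R.V_def using rho_vertex_zero_iff[OF H] y(4) awalk_last_in_verts[OF y(2)] by blast
    finally have "?\<rho> g = 0" by simp
    then have "?\<rho> (Poly_Mapping.single 0 c * g + f) = 0" using f(3) by (simp add: R.\<phi>_add R.\<phi>_scale[OF g])
    moreover have "\<phi> (Poly_Mapping.single 0 c * g + f) = sc c * y + x"
      unfolding \<phi>_add \<phi>_scale[OF g] f(2) y(1) using \<phi>_monomial[OF y(2,3)] unfolding g_def by simp
    ultimately show ?case using g f(1) fc_add fc_scale by blast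
  qed
  then obtain f where f: "f \<in> fc" "\<phi> f = V v" "?\<rho> f = 0" using v(2) by blast
  have w: "(wmon [Vert v] :: ('v, 'e) lword \<Rightarrow>\<^sub>0 'k) \<in> fc" using v(1) by (intro fc_wmon) simp_all
  have "?\<rho> (f - wmon [Vert v]) = 0"
    using f w by (intro transfer_zero[OF R.lpa_rep_axioms]) (simp_all add: \<phi>_diff V_def fc_diff)
  then have "?\<rho> (wmon [Vert v]) = 0" using f(3) by (simp add: R.\<phi>_diff)
  then show ?thesis using rho_vertex_zero_iff[OF H v(1)] by blast
qed

text \<open>A nontrivial \<open>H\<close> is excluded by the graded ideal \<open>J H\<close>.
  Conversely a nonzero graded ideal contains a nonzero homogeneous element, which reduces to a
  vertex.\<close>

lemma graded_simple_iff: "graded_simple RB (\<lambda>n. vs.span (Mon (verts G) n)) \<longleftrightarrow> hs_simple G"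
proof
  assume S: "graded_simple RB (\<lambda>n. vs.span (Mon (verts G) n))"
  show "hs_simple G" unfolding hs_simple_def
  proof (intro conjI allI impI)
    show "verts G \<noteq> {}" using S B_nonzero_iff unfolding graded_simple_def RB_simps by blast
    fix H assume H: "hereditary_saturated G H"
    have her: "\<forall>e\<in>arcs G. tail G e \<in> H \<longrightarrow> head G e \<in> H" and Hv: "H \<subseteq> verts G"
      using H unfolding hereditary_saturated_def by blast+
    have "graded_ideal RB (\<lambda>n. vs.span (Mon (verts G) n)) (J H)"
      unfolding graded_ideal_def
    proof (intro conjI ballI)
      show "two_sided_ideal RB (J H)"
        unfolding RB.two_sided_ideal_iff RB_simps
        using J_B J_ideal[OF her] unfolding J_def
        by (auto intro: vs.span_zero vs.span_add vs.span_neg)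
      fix x assume "x \<in> J H"
      then obtain A h where A: "finite A" "\<forall>n. h n \<in> vs.span (Mon H n)" "x = (\<Sum>n\<in>A. h n)"
        unfolding J_def using span_Union_decomp by blast
      have h: "h n \<in> J H" "h n \<in> vs.span (Mon (verts G) n)" for n
        using A(2) vs.span_mono[of "Mon H n" "\<Union>n. Mon H n"] vs.span_mono[OF Mon_mono[OF Hv]]
        unfolding J_def by blast+
      moreover have "(\<Oplus>\<^bsub>RB\<^esub>n\<in>A. h n) = x"
        unfolding A(3) using A(1) h(1) J_B by (intro RB.finsum_eq) auto
      ultimately show "\<exists>A h. finite A \<and> (\<forall>n\<in>A. h n \<in> J H \<inter> vs.span (Mon (verts G) n)) \<and> x = (\<Oplus>\<^bsub>RB\<^esub>n\<in>A. h n)"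
        using A(1) by (intro exI[of _ A] exI[of _ h]) auto
    qed
    then consider "J H = {0}" | "J H = B" using S unfolding graded_simple_def RB_simps by blast
    then show "H = {} \<or> H = verts G"
    proof cases
      case 1
      have "v \<notin> H" for v
      proof
        assume v: "v \<in> H"
        then have "V v \<in> Mon H 0"
          unfolding Mon_def using Hv
          by (intro CollectI exI[of _ v] exI[of _ "[]"] conjI) (auto simp: V_idem awalk_Nil_iff)
        then have "V v \<in> J H" unfolding J_def by (intro vs.span_base) blast
        then show False using 1 V_ne0 v Hv by blast
      qed
      then show ?thesis by blast
    next
      case 2
      then have "v \<in> H" if "v \<in> verts G" for v using J_vertex[OF H that] letters_B(1)[OF that] by simp
      then show ?thesis using Hv by blast
    qed
  qed
next
  assume T: "hs_simple G"
  show "graded_simple RB (\<lambda>n. vs.span (Mon (verts G) n))"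
    unfolding graded_simple_def RB_simps
  proof (intro conjI allI impI)
    show "B \<noteq> {0}" using T B_nonzero_iff unfolding hs_simple_def by blast
    fix I assume I: "graded_ideal RB (\<lambda>n. vs.span (Mon (verts G) n)) I"
    then have ti: "two_sided_ideal RB I" by (simp add: graded_ideal_def)
    have IB: "I \<subseteq> B" "0 \<in> I" using ti unfolding RB.two_sided_ideal_iff RB_simps by blast+
    show "I = {0} \<or> I = B"
    proof (cases "I = {0}")
      case False
      then obtain x where x: "x \<in> I" "x \<noteq> 0" using IB(2) by blast
      obtain A h where A: "finite A" "\<forall>n\<in>A. h n \<in> I \<inter> vs.span (Mon (verts G) n)" "x = (\<Oplus>\<^bsub>RB\<^esub>n\<in>A. h n)"
        using I x(1) unfolding graded_ideal_def by blast
      have "x = (\<Sum>n\<in>A. h n)" unfolding A(3) using A(1,2) IB(1) by (intro RB.finsum_eq) auto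
      then obtain n where n: "n \<in> A" "h n \<noteq> 0" using x(2) by (metis sum.neutral)
      obtain a b v where r: "a \<in> B" "b \<in> B" "v \<in> verts G" "a * h n * b = V v"
        using homogeneous_reduction[OF _ n(2), of n] A(2) n(1) by blast
      have "a * h n * b \<in> I" using ideal_conj[OF ti _ r(1,2)] A(2) n(1) by blast
      then show ?thesis using ideal_with_vertex[OF T ti r(3)] r(4) by simp
    qed simp
  qed
qed

text \<open>For a closed walk without exit, the kernel of the representation with increment
  \<open>0\<close> contains the difference of vertex and walk but not the vertex, so this ideal is
  neither zero nor everything.\<close>

lemma simple_ring_iff: "simple_ring RB \<longleftrightarrow> hs_simple G \<and> condition_L G"
proof
  assume S: "simple_ring RB"
  then have "graded_simple RB (\<lambda>n. vs.span (Mon (verts G) n))"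
    by (auto simp: simple_ring_def graded_simple_def graded_ideal_def)
  then have T: "hs_simple G" using graded_simple_iff by blast
  have "condition_L G" unfolding condition_L_def
  proof
    assume "\<exists>v p. awalk v p v \<and> p \<noteq> [] \<and> exitless G p"
    then obtain v p where p: "awalk v p v" "p \<noteq> []" "exitless G p" by blast
    have v: "v \<in> verts G" using awalk_hd_in_verts[OF p(1)] .
    let ?\<rho> = "rho_ext {} 0 :: _ \<Rightarrow> (('v, 'e) bpath \<Rightarrow> 'k) add_endo"
    interpret R: lpa_rep G ?\<rho> rho_sc by (rule rho_rep[OF hereditary_saturated_empty])
    define I where "I = \<phi> ` {f \<in> fc. ?\<rho> f = 0}"
    have I_I: "\<phi> f \<in> I" if "f \<in> fc" "?\<rho> f = 0" for f using that by (simp add: I_def)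
    have "two_sided_ideal RB I"
      unfolding RB.two_sided_ideal_iff RB_simps
    proof (intro conjI ballI)
      show "I \<subseteq> B" unfolding I_def B_def by blast
      show "0 \<in> I" using I_I[OF fc_0] by simp
      fix x assume "x \<in> I"
      then obtain f where f: "f \<in> fc" "?\<rho> f = 0" "x = \<phi> f" unfolding I_def by blast
      show "- x \<in> I" using I_I[OF fc_uminus[OF f(1)]] f by (simp add: \<phi>_uminus R.\<phi>_uminus)
      show "x + y \<in> I" if "y \<in> I" for y
      proof -
        obtain g where g: "g \<in> fc" "?\<rho> g = 0" "y = \<phi> g" using \<open>y \<in> I\<close> unfolding I_def by blast
        show ?thesis using I_I[OF fc_add[OF f(1) g(1)]] f g by (simp add: \<phi>_add R.\<phi>_add)
      qed
      fix y assume "y \<in> B"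
      then obtain g where g: "g \<in> fc" "y = \<phi> g" unfolding B_def by blast
      show "y * x \<in> I" using I_I[OF fc_mult[OF g(1) f(1)]] f g by (simp add: \<phi>_mult R.\<phi>_mult)
      show "x * y \<in> I" using I_I[OF fc_mult[OF f(1) g(1)]] f g by (simp add: \<phi>_mult R.\<phi>_mult)
    qed
    then consider "I = {0}" | "I = B" using S unfolding simple_ring_def RB_simps by blast
    then show False
    proof cases
      case 1
      define f where "f = (wmon [Vert v] - wmon (path_word v p) :: ('v, 'e) lword \<Rightarrow>\<^sub>0 'k)"
      have "f \<in> fc" unfolding f_def using v path_word_letters[OF p(1)] by (intro fc_diff fc_wmon) auto
      moreover have "?\<rho> f = 0"
        unfolding f_def R.\<phi>_diff R.\<phi>_path[OF p(1)]
        by (simp add: exitless_closed_rep[OF hereditary_saturated_empty p])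
      ultimately have "\<phi> f \<in> I" by (rule I_I)
      then have "V v - pe v p = 0" using 1 unfolding f_def \<phi>_diff \<phi>_path[OF p(1)] V_def by simp
      \<comment> \<open>A one-element index set matches the shape of the independence statement,
        with coefficient \<open>1\<close> at the vertex.\<close>
      then have "sc 1 * V v + (\<Sum>i\<in>{()}. sc (- 1) * pe v p) = 0"
        using vs.scale_minus_left[of 1 "pe v p"] by (simp add: sc_1)
      then have "(1 :: 'k) = 0"
        by (rule vertex_closed_walk_independent[rotated 3]) (use p v in simp_all)
      then show False by simp
    next
      case 2
      then obtain f where f: "f \<in> fc" "?\<rho> f = 0" "V v = \<phi> f"
        using letters_B(1)[OF v] unfolding I_def by blast
      have w: "(wmon [Vert v] :: ('v, 'e) lword \<Rightarrow>\<^sub>0 'k) \<in> fc" using v by (intro fc_wmon) simp_all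
      have "?\<rho> (f - wmon [Vert v]) = 0"
        using f w by (intro transfer_zero[OF R.lpa_rep_axioms]) (simp_all add: \<phi>_diff V_def fc_diff)
      then have "?\<rho> (wmon [Vert v]) = 0" using f(2) by (simp add: R.\<phi>_diff)
      then show False using rho_vertex_zero_iff[OF hereditary_saturated_empty v] by blast
    qed
  qed
  then show "hs_simple G \<and> condition_L G" using T by blast
next
  assume TL: "hs_simple G \<and> condition_L G"
  show "simple_ring RB" unfolding simple_ring_def RB_simps
  proof (intro conjI allI impI)
    show "B \<noteq> {0}" using TL B_nonzero_iff unfolding hs_simple_def by blast
    fix I assume I: "two_sided_ideal RB I"
    have IB: "I \<subseteq> B" "0 \<in> I" using I unfolding RB.two_sided_ideal_iff RB_simps by blast+
    show "I = {0} \<or> I = B"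
    proof (cases "I = {0}")
      case False
      then obtain x where x: "x \<in> I" "x \<noteq> 0" using IB(2) by blast
      obtain a b v where r: "a \<in> B" "b \<in> B" "v \<in> verts G" "a * x * b = V v"
        using reduction[of x] x IB(1) TL by blast
      have "a * x * b \<in> I" by (rule ideal_conj[OF I x(1) r(1,2)])
      then show ?thesis using ideal_with_vertex[OF _ I r(3)] r(4) TL by simp
    qed simp
  qed
qed

end

section \<open>Infinite idempotents\<close>

context subrng
begin

text \<open>Left multiplication by \<open>u\<close> maps the right ideal of \<open>e\<close> onto
  that of \<open>u * t\<close>, with inverse given by \<open>t\<close>; the complement is generated
  by \<open>e - u * t\<close>. The last inequality makes the summand proper.\<close>

lemma infinite_idempotentI:
  assumes c: "e \<in> carrier R" "u \<in> carrier R" "t \<in> carrier R"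
    and e: "e * e = e" "e * u = u" "u * e = u" "e * t = t" "t * e = t" and tu: "t * u = e" "u * t \<noteq> e"
  shows "infinite_idempotent R e"
proof -
  let ?A = "right_mult R (u * t)" and ?C = "right_mult R (e - u * t)"
  have rm: "right_mult R x = (\<lambda>y. x * y) ` carrier R" for x by (simp add: right_mult_def mult_eq)
  have ut: "u * t \<in> carrier R" "e - u * t \<in> carrier R" using c mult_c minus_c by auto
  have tux: "t * (u * x) = e * x" for x using tu(1) by (simp flip: mult.assoc)
  have ex: "e * (e * x) = e * x" "e * (u * x) = u * x" "u * (e * x) = u * x" "e * (t * x) = t * x" "t * (e * x) = t * x" for x
    using e by (simp_all flip: mult.assoc)
  have "?A \<inter> ?C = {0}"
  proof
    show "?A \<inter> ?C \<subseteq> {0}"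
    proof
      fix x assume "x \<in> ?A \<inter> ?C"
      then obtain y z where x: "x = u * t * y" "x = (e - u * t) * z" unfolding rm by blast
      have "u * t * x = x" unfolding x(1) by (simp add: mult.assoc tux ex)
      moreover have "u * t * x = 0" unfolding x(2) by (simp add: mult.assoc tux ex right_diff_distrib left_diff_distrib)
      ultimately show "x \<in> {0}" by simp
    qed
    show "{0} \<subseteq> ?A \<inter> ?C" unfolding rm using zero_c by (auto intro!: image_eqI[of _ _ 0])
  qed
  moreover have "?A <+>\<^bsub>R\<^esub> ?C = right_mult R e"
  proof
    show "?A <+>\<^bsub>R\<^esub> ?C \<subseteq> right_mult R e"
    proof
      fix x assume "x \<in> ?A <+>\<^bsub>R\<^esub> ?C"
      then obtain y z where x: "x = u * t * y + (e - u * t) * z" "y \<in> carrier R" "z \<in> carrier R"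
        unfolding set_add_image rm add_eq by blast
      have "x = e * x" unfolding x(1) by (simp add: distrib_left left_diff_distrib right_diff_distrib mult.assoc ex)
      moreover have "x \<in> carrier R" unfolding x(1) using x(2,3) ut mult_c add_c by auto
      ultimately show "x \<in> right_mult R e" unfolding rm by blast
    qed
    show "right_mult R e \<subseteq> ?A <+>\<^bsub>R\<^esub> ?C"
    proof
      fix x assume "x \<in> right_mult R e"
      then obtain y where y: "x = e * y" "y \<in> carrier R" unfolding rm by blast
      have "x = u * t * y + (e - u * t) * y" unfolding y(1) by (simp add: left_diff_distrib)
      then show "x \<in> ?A <+>\<^bsub>R\<^esub> ?C" unfolding set_add_image rm add_eq using y(2) by blast
    qed
  qed
  ultimately have ds: "direct_summand R ?A (right_mult R e)"
    unfolding direct_summand_def zero_eq using right_mult_right_ideal[OF ut(1)] right_mult_right_ideal[OF ut(2)] by blast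
  have ne: "?A \<noteq> right_mult R e"
  proof
    assume "?A = right_mult R e"
    then have "e \<in> ?A" unfolding rm using c(1) e(1) by (auto intro!: image_eqI[of _ _ e])
    then obtain y where y: "e = u * t * y" unfolding rm by blast
    have "u * t * e = e" unfolding y by (simp add: mult.assoc tux ex)
    then show False using tu(2) e(4,5) by (simp add: mult.assoc)
  qed
  have "right_module_iso R (right_mult R e) ?A"
    unfolding right_module_iso_def
  proof (intro exI[of _ "\<lambda>x. u * x"] conjI ballI)
    show "bij_betw ((*) u) (right_mult R e) ?A"
      unfolding bij_betw_def
    proof
      show "inj_on ((*) u) (right_mult R e)"
      proof (rule inj_onI)
        fix x y assume xy: "x \<in> right_mult R e" "y \<in> right_mult R e" "u * x = u * y"
        then have "t * (u * x) = t * (u * y)" by simp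
        then show "x = y" using xy(1,2) unfolding rm by (auto simp: tux ex)
      qed
      show "(*) u ` right_mult R e = ?A"
      proof
        show "(*) u ` right_mult R e \<subseteq> ?A"
        proof
          fix x assume "x \<in> (*) u ` right_mult R e"
          then obtain y where y: "x = u * (e * y)" "y \<in> carrier R" unfolding rm by blast
          then have "x = u * t * (u * y)" by (simp add: mult.assoc tux)
          then show "x \<in> ?A" unfolding rm using y(2) c mult_c by blast
        qed
        show "?A \<subseteq> (*) u ` right_mult R e"
        proof
          fix x assume "x \<in> ?A"
          then obtain y where y: "x = u * t * y" "y \<in> carrier R" unfolding rm by blast
          then have "x = u * (e * (t * y))" by (simp add: mult.assoc ex)
          then show "x \<in> (*) u ` right_mult R e" unfolding rm using y(2) c mult_c by blast
        qed
      qed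
    qed
  qed (simp_all add: add_eq mult_eq distrib_left mult.assoc)
  then show ?thesis unfolding infinite_idempotent_def mult_eq using c(1) e(1) ds ne by blast
qed

text \<open>Let \<open>f\<close> be the isomorphism onto the summand \<open>A\<close> and
  \<open>e = a0 + c0\<close> the decomposition of \<open>e\<close>. Then \<open>u\<close> is the
  image of \<open>e\<close> and \<open>t\<close> the preimage of \<open>a0\<close>, so
  \<open>u * t = a0\<close>. The other identities hold because certain differences lie in both
  summands.\<close>

lemma infinite_idempotentE:
  assumes "infinite_idempotent R e"
  obtains u t where "u \<in> carrier R" "t \<in> carrier R" "e \<in> carrier R" "e * e = e" "e * u = u" "u * e = u"
    "e * t = t" "t * e = t" "t * u = e" "u * t \<noteq> e"
proof -
  have rm: "right_mult R x = (\<lambda>y. x * y) ` carrier R" for x by (simp add: right_mult_def mult_eq)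
  have ec: "e \<in> carrier R" "e * e = e"
    using assms unfolding infinite_idempotent_def mult_eq by simp_all
  obtain A where A0: "direct_summand R A (right_mult R e)" and ne: "A \<noteq> right_mult R e"
    and iso: "right_module_iso R (right_mult R e) A"
    using assms unfolding infinite_idempotent_def by blast
  from A0 have A: "right_ideal R A" unfolding direct_summand_def by simp
  obtain C where C: "right_ideal R C" and AC: "A \<inter> C = {0}" "A <+>\<^bsub>R\<^esub> C = right_mult R e"
    using A0 unfolding direct_summand_def zero_eq by blast
  obtain f where f1: "bij_betw f (right_mult R e) A"
    and f2: "\<forall>a\<in>right_mult R e. \<forall>x\<in>carrier R. f (a * x) = f a * x"
    using iso unfolding right_module_iso_def mult_eq by blast
  have f: "bij_betw f (right_mult R e) A"
    "\<And>a x. a \<in> right_mult R e \<Longrightarrow> x \<in> carrier R \<Longrightarrow> f (a * x) = f a * x"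
    using f1 f2 by simp_all
  note A' = A[unfolded right_ideal_iff] and C' = C[unfolded right_ideal_iff]
  have Ac: "x \<in> carrier R" if "x \<in> A" for x using A' that by blast
  have Am: "x * y \<in> A" if "x \<in> A" "y \<in> carrier R" for x y using A' that by blast
  have Cm: "x * y \<in> C" if "x \<in> C" "y \<in> carrier R" for x y using C' that by blast
  have Ad: "x - y \<in> A" if "x \<in> A" "y \<in> A" for x y
    using A' that by (metis add_uminus_conv_diff)
  have Cd: "x - y \<in> C" if "x \<in> C" "y \<in> C" for x y
    using C' that by (metis add_uminus_conv_diff)
  have AeR: "A \<subseteq> right_mult R e"
  proof
    fix x assume x: "x \<in> A"
    have "0 \<in> C" using C' by blast
    then have "x + 0 \<in> A <+>\<^bsub>R\<^esub> C" unfolding set_add_image add_eq using x by blast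
    then show "x \<in> right_mult R e" unfolding AC(2) by simp
  qed
  have eR: "e * x = x" if "x \<in> right_mult R e" for x
    using that ec(2) unfolding rm by (auto simp flip: mult.assoc)
  have eR_c: "x \<in> carrier R" if "x \<in> right_mult R e" for x
    using that ec(1) mult_c unfolding rm by blast
  have eRI: "e * x \<in> right_mult R e" if "x \<in> carrier R" for x using that unfolding rm by blast
  have ee: "e \<in> right_mult R e" using eRI[OF ec(1)] ec(2) by simp
  then obtain a0 c0 where e0: "a0 \<in> A" "c0 \<in> C" "e = a0 + c0"
    unfolding AC(2)[symmetric] set_add_image add_eq by blast
  define u where "u = f e"
  have uA: "u \<in> A" unfolding u_def using f(1) ee by (auto simp: bij_betw_def)
  obtain t where t: "t \<in> right_mult R e" "f t = a0" using f(1) e0(1) by (auto simp: bij_betw_def)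
  have f_inj: "x = y" if "x \<in> right_mult R e" "y \<in> right_mult R e" "f x = f y" for x y
    using f(1) that by (auto simp: bij_betw_def dest: inj_onD)
  have tc: "t \<in> carrier R" and uc: "u \<in> carrier R" using eR_c t(1) Ac uA by auto
  have ue: "u * e = u" unfolding u_def using f(2)[OF ee ec(1)] ec(2) by simp
  have eu: "e * u = u" using eR AeR uA by blast
  have et: "e * t = t" using eR t(1) by blast
  have ut: "u * t = a0" unfolding u_def using f(2)[OF ee tc] et t(2) by simp
  have "c0 * u = u - a0 * u" using eu e0(3) by (simp add: distrib_right algebra_simps)
  then have "c0 * u \<in> A \<inter> C" using Ad[OF uA Am[OF e0(1) uc]] Cm[OF e0(2) uc] by simp
  then have "c0 * u = 0" using AC(1) by blast
  then have a0u: "a0 * u = u" using eu e0(3) by (simp add: distrib_right)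
  have teR: "t * x \<in> right_mult R e" if "x \<in> carrier R" for x
    using eRI[OF mult_c[OF tc that]] et by (simp flip: mult.assoc)
  have tu: "t * u = e"
    by (rule f_inj[OF teR[OF uc] ee]) (simp add: f(2)[OF t(1) uc] t(2) a0u u_def[symmetric])
  have "a0 - a0 * e = c0 * e - c0"
  proof -
    have "a0 * e + c0 * e = a0 + c0" using ec(2) e0(3) by (metis distrib_right)
    then show ?thesis by (simp add: algebra_simps)
  qed
  then have "a0 - a0 * e \<in> A \<inter> C" using Ad[OF e0(1) Am[OF e0(1) ec(1)]] Cd[OF Cm[OF e0(2) ec(1)] e0(2)] by simp
  then have "a0 * e = a0" using AC(1) by simp
  then have te: "t * e = t" by (intro f_inj[OF teR[OF ec(1)] t(1)]) (simp add: f(2)[OF t(1) ec(1)] t(2))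
  have "u * t \<noteq> e"
  proof
    assume "u * t = e"
    then have "e \<in> A" using ut e0(1) by simp
    then have "right_mult R e \<subseteq> A" using Am unfolding rm by blast
    then show False using ne AeR by blast
  qed
  then show ?thesis using that uc tc ec eu ue et te tu by blast
qed

end

section \<open>Pure infiniteness\<close>

context wf_digraph
begin

text \<open>The vertices that do not reach \<open>z\<close> form a hereditary saturated set, and
  \<open>z\<close> is not among them.\<close>

lemma reach_closed_walk:
  assumes T: "hs_simple G" and c: "awalk z c z" "c \<noteq> []" and w: "w \<in> verts G"
  shows "\<exists>p. awalk w p z"
proof -
  define H where "H = {x \<in> verts G. \<not> (\<exists>p. awalk x p z)}"
  have z: "z \<in> verts G" using awalk_hd_in_verts[OF c(1)] .
  have reach: "\<exists>p. awalk (tail G e) p z" if "e \<in> arcs G" "awalk (head G e) p z" for e p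
    using that by (intro exI[of _ "e # p"]) (simp add: awalk_Cons_iff)
  have "hereditary_saturated G H"
    unfolding hereditary_saturated_def
  proof (intro conjI ballI allI impI)
    show "H \<subseteq> verts G" by (auto simp: H_def)
    show "head G e \<in> H" if "e \<in> arcs G" "tail G e \<in> H" for e
      using that reach unfolding H_def by auto
    fix v assume v: "regular_vertex G v" "\<forall>e\<in>out_arcs G v. head G e \<in> H"
    have nz: "\<not> (\<exists>p. p \<noteq> [] \<and> awalk v p z)"
    proof
      assume "\<exists>p. p \<noteq> [] \<and> awalk v p z"
      then obtain p where p: "p \<noteq> []" "awalk v p z" by blast
      then obtain e q where "p = e # q" by (cases p) auto
      then have "e \<in> out_arcs G v" "awalk (head G e) q z" using p by (auto simp: awalk_Cons_iff)
      then show False using v(2) by (auto simp: H_def)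
    qed
    \<comment> \<open>The empty walk is possible only at \<open>z\<close>, where the closed walk
      \<open>c\<close> supplies a nonempty one.\<close>
    have "\<not> awalk v [] z" using nz c by (auto simp: awalk_Nil_iff)
    then have "\<not> (\<exists>p. awalk v p z)" using nz by metis
    then show "v \<in> H" using v(1) by (simp add: H_def regular_vertex_def)
  qed
  moreover have "z \<notin> H" using z by (auto simp: H_def awalk_Nil_iff intro!: exI[of _ "[]"])
  ultimately have "H = {}" using T z unfolding hs_simple_def by blast
  then show ?thesis using w by (auto simp: H_def)
qed

text \<open>A repeated edge encloses a closed walk. Distinctness bounds the length of paths over a
  finite set of edges.\<close>

lemma acyclic_distinct:
  assumes "\<not> has_closed_walk G" "awalk u p v"
  shows "distinct p"
proof (rule ccontr)
  assume "\<not> distinct p"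
  then obtain xs ys zs y where p: "p = xs @ [y] @ ys @ [y] @ zs" using not_distinct_decomp by blast
  have "awalk (tail G y) (y # ys) (tail G y)"
    using assms(2) unfolding p by (auto simp: awalk_append_iff awalk_Cons_iff)
  then show False using assms(1) unfolding has_closed_walk_def by blast
qed

end

context univ_rep
begin

interpretation RB: subrng RB
  by (rule RB_subrng)

text \<open>The path that leaves \<open>c\<close> by an exit has an adjoint annihilating
  \<open>pe z c\<close>. Conjugating the supposed identity by it gives zero on one side and a vertex
  on the other.\<close>

lemma closed_walk_shift:
  assumes L: "condition_L G" and c: "awalk z c z" "c \<noteq> []"
  shows "pe z c * gs z c \<noteq> V z"
proof
  assume eq: "pe z c * gs z c = V z"
  have "\<not> exitless G c" using L c unfolding condition_L_def by blast
  then obtain e where "e \<in> set c" "out_arcs G (tail G e) \<noteq> {e}" "e \<in> out_arcs G (tail G e)"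
    using c(1) unfolding exitless_def awalk_def by auto
  then obtain f where e: "e \<in> set c" "f \<in> out_arcs G (tail G e)" "f \<noteq> e" by blast
  obtain p q where pq: "c = p @ e # q" using split_list[OF e(1)] by blast
  have "awalk z p (tail G e)" using c(1) unfolding pq
    by (auto simp: awalk_append_iff awalk_Cons_iff dest: awlast_of_awalk)
  then have \<tau>: "awalk z (p @ [f]) (head G f)"
    using e(2) by (auto intro!: awalk_appendI simp: awalk_Cons_iff awalk_Nil_iff)
  have "gs z (p @ [f]) * pe z c = 0"
    by (rule gs_pe_zero[OF \<tau> c(1)]) (use e(3) in \<open>auto simp: pq\<close>)
  then have "gs z (p @ [f]) * (pe z c * gs z c) * pe z (p @ [f]) = 0" by (simp flip: mult.assoc)
  then have "V (head G f) = 0"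
    unfolding eq using V_pe[OF \<tau>] gs_pe_same[OF \<tau>] by (simp add: mult.assoc)
  then show False using V_ne0 awalk_last_in_verts[OF \<tau>] by blast
qed

text \<open>Once \<open>a * x * b = V z\<close> is reached, sending \<open>y\<close> to
  \<open>x * b * y * a\<close> is multiplicative on the corner at \<open>z\<close>. It carries the
  vertex, the closed walk and its adjoint to the data for \<open>infinite_idempotentI\<close>,
  inside the right ideal of \<open>x\<close>.\<close>

lemma infinite_idempotent_in_ideal:
  assumes T: "hs_simple G" and L: "condition_L G" and c: "awalk z c z" "c \<noteq> []" and x: "x \<in> B" "x \<noteq> 0"
  shows "\<exists>y\<in>B. infinite_idempotent RB (x * y)"
proof -
  obtain a0 b0 w where r: "a0 \<in> B" "b0 \<in> B" "w \<in> verts G" "a0 * x * b0 = V w"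
    using reduction[OF L x] by blast
  obtain p where p: "awalk w p z" using reach_closed_walk[OF T c r(3)] by blast
  define a where "a = gs w p * a0"
  define b where "b = b0 * pe w p"
  have B: "a \<in> B" "b \<in> B" using r gs_B[OF p] pe_B[OF p] B_simps(3) by (auto simp: a_def b_def)
  have Va: "V z * a = a" unfolding a_def using V_gs[OF p] by (simp flip: mult.assoc)
  have "a * x * b = gs w p * (a0 * x * b0) * pe w p" by (simp add: a_def b_def mult.assoc)
  then have axb: "a * x * b = V z" unfolding r(4) using V_pe[OF p] gs_pe_same[OF p] by (simp add: mult.assoc)
  define u0 where "u0 = pe z c"
  define t0 where "t0 = gs z c"
  have ut: "u0 \<in> B" "t0 \<in> B" "t0 * u0 = V z" "V z * u0 = u0" "V z * t0 = t0"
    "u0 * t0 \<noteq> V z" "t0 * V z = t0"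
    using pe_B[OF c(1)] gs_B[OF c(1)] gs_pe_same[OF c(1)] V_pe[OF c(1)] V_gs[OF c(1)] gs_V[OF c(1)]
      closed_walk_shift[OF L c] by (simp_all add: u0_def t0_def)
  have axb': "a * (x * (b * y)) = V z * y" for y using axb by (simp flip: mult.assoc)
  have V': "V z * (u0 * y) = u0 * y" "V z * (t0 * y) = t0 * y" "t0 * (u0 * y) = V z * y" for y
    using ut(3-5) by (simp_all flip: mult.assoc)
  let ?e = "x * (b * a)" and ?u = "x * (b * (u0 * a))" and ?t = "x * (b * (t0 * a))"
  have "infinite_idempotent RB ?e"
  proof (rule RB.infinite_idempotentI)
    show "?e \<in> carrier RB" "?u \<in> carrier RB" "?t \<in> carrier RB"
      using x(1) B ut(1,2) B_simps(3) by simp_all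
    show "?e * ?e = ?e" "?e * ?u = ?u" "?u * ?e = ?u" "?e * ?t = ?t" "?t * ?e = ?t" "?t * ?u = ?e"
      by (simp_all add: mult.assoc axb' Va V')
    show "?u * ?t \<noteq> ?e"
    proof
      assume "?u * ?t = ?e"
      then have "x * (b * (u0 * (t0 * a))) = x * (b * a)" by (simp add: mult.assoc axb' V')
      \<comment> \<open>Multiplying by \<open>a\<close> on the left and by \<open>x * b\<close> on
        the right returns to the corner at \<open>z\<close>.\<close>
      then have "a * (x * (b * (u0 * (t0 * a)))) * x * b = a * (x * (b * a)) * x * b" by simp
      then have "u0 * (t0 * V z) = V z"
        using axb V_idem[OF awalk_hd_in_verts[OF c(1)]] by (simp add: mult.assoc axb' V' Va)
      then show False using ut(6,7) by simp
    qed
  qed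
  then show ?thesis using B B_simps(3) by blast
qed

text \<open>Confining edges to \<open>S\<close> and starting vertices to \<open>W\<close> gives
  monomials closed under products up to zero. Without closed walks there are finitely many of them
  for finite \<open>S\<close> and \<open>W\<close>; their spans are the finite-dimensional
  subalgebras.\<close>

definition MF :: "'e set \<Rightarrow> 'v set \<Rightarrow> 'r set" where
  "MF S W = {pe u p * gs w q |u p w q v. awalk u p v \<and> awalk w q v \<and> set p \<subseteq> S \<and> set q \<subseteq> S \<and> u \<in> W \<and> w \<in> W}"

lemma MF_B: "MF S W \<subseteq> B"
  unfolding MF_def by (auto intro: B_simps pe_B gs_B)

lemma MF_mono: "S \<subseteq> S' \<Longrightarrow> W \<subseteq> W' \<Longrightarrow> MF S W \<subseteq> MF S' W'"
  unfolding MF_def by blast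

lemma MF_finite:
  assumes "\<not> has_closed_walk G" "finite S" "finite W"
  shows "finite (MF S W)"
proof -
  define P where "P = {p. set p \<subseteq> S \<and> length p \<le> card S}"
  have P: "finite P" unfolding P_def by (rule finite_lists_length_le[OF assms(2)])
  have PP: "p \<in> P" if "awalk u p v" "set p \<subseteq> S" for u p v
    using acyclic_distinct[OF assms(1) that(1)] that(2) assms(2) distinct_card[of p] card_mono[of S "set p"]
    by (simp add: P_def)
  have "MF S W \<subseteq> (\<lambda>(u, p, w, q). pe u p * gs w q) ` (W \<times> P \<times> W \<times> P)"
  proof
    fix x assume "x \<in> MF S W"
    then obtain u p w q v where x: "x = pe u p * gs w q" "awalk u p v" "awalk w q v" "set p \<subseteq> S" "set q \<subseteq> S"
      "u \<in> W" "w \<in> W" unfolding MF_def by blast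
    then show "x \<in> (\<lambda>(u, p, w, q). pe u p * gs w q) ` (W \<times> P \<times> W \<times> P)"
      using PP[OF x(2,4)] PP[OF x(3,5)] by (intro image_eqI[of _ _ "(u, p, w, q)"]) simp_all
  qed
  then show ?thesis using P assms(3) by (meson finite_SigmaI finite_imageI finite_subset)
qed

lemma MF_mult:
  assumes "x \<in> MF S W" "y \<in> MF S W"
  shows "x * y \<in> vs.span (MF S W)"
proof -
  obtain u p w q v where x: "x = pe u p * gs w q" "awalk u p v" "awalk w q v" "set p \<subseteq> S" "set q \<subseteq> S" "u \<in> W" "w \<in> W"
    using assms(1) unfolding MF_def by blast
  obtain u' p' w' q' v' where y: "y = pe u' p' * gs w' q'" "awalk u' p' v'" "awalk w' q' v'"
    "set p' \<subseteq> S" "set q' \<subseteq> S" "u' \<in> W" "w' \<in> W"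
    using assms(2) unfolding MF_def by blast
  have "x * y = 0 \<or> x * y \<in> MF S W"
    using monomial_mult[OF x(2,3) y(2,3)]
  proof (elim disjE exE conjE)
    fix r assume r: "p' = q @ r" "awalk u (p @ r) v'"
      "(pe u p * gs w q) * (pe u' p' * gs w' q') = pe u (p @ r) * gs w' q'"
    have "set (p @ r) \<subseteq> S" using x(4) y(4) r(1) by simp
    then show ?thesis unfolding x(1) y(1) r(3) MF_def using r(2) x(6) y(3,5,7) by blast
  next
    fix r assume r: "q = p' @ r" "awalk w' (q' @ r) v"
      "(pe u p * gs w q) * (pe u' p' * gs w' q') = pe u p * gs w' (q' @ r)"
    have "set (q' @ r) \<subseteq> S" using x(5) y(5) r(1) by simp
    then show ?thesis unfolding x(1) y(1) r(3) MF_def using r(2) x(2,4,6) y(7) by blast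
  qed (simp add: x y)
  then show ?thesis using vs.span_base vs.span_zero by metis
qed

lemma MF_cover:
  assumes "x \<in> B"
  shows "\<exists>S W. finite S \<and> finite W \<and> x \<in> vs.span (MF S W)"
  using assms unfolding B_span
proof (induction rule: vs.span_induct_alt)
  case base
  then show ?case using vs.span_zero by blast
next
  case (step c y x)
  obtain S W where SW: "finite S" "finite W" "x \<in> vs.span (MF S W)" using step(2) by blast
  obtain u p w q v where y: "y = pe u p * gs w q" "awalk u p v" "awalk w q v"
    using step(1) unfolding Mon_def by blast
  let ?S = "S \<union> set p \<union> set q" and ?W = "W \<union> {u, w}"
  have "y \<in> MF ?S ?W" unfolding MF_def using y by blast
  moreover have "x \<in> vs.span (MF ?S ?W)"
    using SW(3) vs.span_mono[OF MF_mono[of S ?S W ?W]] by blast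
  ultimately have "sc c * y + x \<in> vs.span (MF ?S ?W)"
    by (intro vs.span_add vs.span_scale) (auto intro: vs.span_base)
  then show ?case using SW by (intro exI[of _ ?S] exI[of _ ?W]) simp
qed

text \<open>Multiplying a linear dependence by one of the idempotents isolates its
  coefficient.\<close>

lemma orthogonal_idempotents_independent:
  assumes orth: "\<And>n m. g n * g m = (if n = m then g n else 0)" and ne: "\<And>n. g n \<noteq> (0 :: 'r)"
  shows "inj (g :: nat \<Rightarrow> 'r)" "vs.independent (range g)"
proof -
  show inj: "inj g"
  proof (rule injI, rule ccontr)
    fix n m assume "g n = g m" "n \<noteq> m"
    then show False using orth[of n n] orth[of n m] ne[of n] by simp
  qed
  show "vs.independent (range g)"
  proof
    assume "vs.dependent (range g)"
    then obtain t r v where t: "finite t" "t \<subseteq> range g" "(\<Sum>v\<in>t. sc (r v) * v) = 0" "v \<in> t" "r v \<noteq> 0"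
      unfolding vs.dependent_explicit by blast
    have vv: "w * v = (if w = v then v else 0)" if "w \<in> t" for w
      using t(2,4) that orth by (auto simp: image_iff subset_iff) (metis orth)+
    have "(\<Sum>w\<in>t. sc (r w) * w) * v = (\<Sum>w\<in>t. if w = v then sc (r v) * v else 0)"
      unfolding sum_distrib_right using vv by (intro sum.cong HOL.refl) (simp add: mult.assoc)
    then have "sc (r v) * v = 0" using t(1,3,4) by simp
    moreover obtain n where "v = g n" using t(2,4) by blast
    then have "v \<noteq> 0" using ne[of n] by simp
    ultimately show False using t(5) by simp
  qed
qed

text \<open>Repeatedly applying \<open>u\<close> on the left and \<open>t\<close> on the right to
  \<open>e - u * t\<close> yields infinitely many nonzero orthogonal idempotents, which is
  impossible in a finite-dimensional span closed under products.\<close>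

lemma no_infinite_idempotent:
  assumes ac: "\<not> has_closed_walk G"
  shows "\<not> infinite_idempotent RB e"
proof
  assume "infinite_idempotent RB e"
  then obtain u t where ut: "u \<in> B" "t \<in> B" "e \<in> B" "e * e = e" "e * u = u" "u * e = u"
    "e * t = t" "t * e = t" "t * u = e" "u * t \<noteq> e"
    by (rule RB.infinite_idempotentE) simp
  obtain S1 W1 S2 W2 S3 W3 where SW: "finite S1" "finite W1" "u \<in> vs.span (MF S1 W1)"
    "finite S2" "finite W2" "t \<in> vs.span (MF S2 W2)" "finite S3" "finite W3" "e \<in> vs.span (MF S3 W3)"
    using MF_cover ut(1-3) by meson
  define S where "S = S1 \<union> S2 \<union> S3"
  define W where "W = W1 \<union> W2 \<union> W3"
  let ?M = "vs.span (MF S W)"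
  have fin: "finite (MF S W)" using SW by (intro MF_finite[OF ac]) (auto simp: S_def W_def)
  have mem: "u \<in> ?M" "t \<in> ?M" "e \<in> ?M"
    using SW(3,6,9) vs.span_mono[OF MF_mono[of S1 S W1 W]] vs.span_mono[OF MF_mono[of S2 S W2 W]]
      vs.span_mono[OF MF_mono[of S3 S W3 W]] by (auto simp: S_def W_def)
  have mult: "x * y \<in> ?M" if "x \<in> ?M" "y \<in> ?M" for x y
    using span_mult[OF MF_B that] MF_mult by blast
  define g where "g = rec_nat (e - u * t) (\<lambda>_ y. u * y * t)"
  have g: "g 0 = e - u * t" "g (Suc n) = u * g n * t" for n by (simp_all add: g_def)
  have gM: "g n \<in> ?M" for n by (induction n) (simp_all add: g mem mult vs.span_diff)
  have tux: "t * (u * x) = e * x" and ex: "e * (u * x) = u * x" "u * (e * x) = u * x" "e * (e * x) = e * x"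
    "e * (t * x) = t * x" "t * (e * x) = t * x" for x
    using ut(4-9) by (simp_all flip: mult.assoc)
  have eg: "e * g n = g n" for n
    by (cases n) (simp_all add: g right_diff_distrib ut(4) ex mult.assoc)
  have ge: "g n * e = g n" for n
    by (cases n) (simp_all add: g left_diff_distrib ut(4,8) mult.assoc)
  have orth: "g n * g m = (if n = m then g n else 0)" for n m
  proof (induction n arbitrary: m)
    case 0
    show ?case
      by (cases m) (simp_all add: g left_diff_distrib right_diff_distrib mult.assoc ut(4-9) tux ex)
  next
    case (Suc n)
    show ?case
    proof (cases m)
      case 0
      then show ?thesis by (simp add: g right_diff_distrib mult.assoc ut(8) tux ex ut(7))
    next
      case (Suc k)
      have "g (Suc n) * g m = u * (g n * (e * (g k * t)))"
        unfolding Suc g by (simp add: mult.assoc tux)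
      also have "\<dots> = u * (g n * g k) * t" using ge[of n] by (simp add: mult.assoc flip: mult.assoc[of "g n" e])
      finally show ?thesis unfolding Suc.IH Suc by (simp add: g)
    qed
  qed
  \<comment> \<open>Applying \<open>t\<close> on the left and \<open>u\<close> on the right lowers
    the index, down to \<open>e - u * t\<close>, which is nonzero.\<close>
  have gne: "g n \<noteq> 0" for n
  proof (induction n)
    case 0
    then show ?case using ut(10) by (simp add: g)
  next
    case (Suc n)
    have "t * g (Suc n) * u = e * g n * e" by (simp add: g mult.assoc tux ut(9))
    then show ?case using Suc eg ge by auto
  qed
  have "finite (range g)"
    using vs.independent_span_bound[OF fin orthogonal_idempotents_independent(2)[OF orth gne]] gM by blast
  then show False
    using orthogonal_idempotents_independent(1)[OF orth gne] range_inj_infinite by blast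
qed

text \<open>The whole algebra is a nonzero right ideal, so it contains an infinite idempotent, which
  forces a closed walk.\<close>

lemma purely_infinite_simple_iff:
  "purely_infinite_simple RB \<longleftrightarrow> hs_simple G \<and> condition_L G \<and> has_closed_walk G"
proof
  assume P: "purely_infinite_simple RB"
  then have S: "simple_ring RB" by (simp add: purely_infinite_simple_def)
  have "right_ideal RB B" unfolding RB.right_ideal_iff RB_simps using B_simps by auto
  moreover have "B \<noteq> {\<zero>\<^bsub>RB\<^esub>}" using S unfolding simple_ring_def by simp
  ultimately have "\<exists>e\<in>B. infinite_idempotent RB e"
    using P unfolding purely_infinite_simple_def by blast
  then have "has_closed_walk G" using no_infinite_idempotent by blast
  then show "hs_simple G \<and> condition_L G \<and> has_closed_walk G" using S simple_ring_iff by blast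
next
  assume R: "hs_simple G \<and> condition_L G \<and> has_closed_walk G"
  then obtain z c where c: "awalk z c z" "c \<noteq> []" unfolding has_closed_walk_def by blast
  show "purely_infinite_simple RB" unfolding purely_infinite_simple_def
  proof (intro conjI allI impI)
    show "simple_ring RB" using R simple_ring_iff by blast
    fix I assume "right_ideal RB I \<and> I \<noteq> {\<zero>\<^bsub>RB\<^esub>}"
    then have I: "I \<subseteq> B" "0 \<in> I" "\<forall>a\<in>I. \<forall>x\<in>B. a * x \<in> I" "I \<noteq> {0}"
      unfolding RB.right_ideal_iff RB_simps by blast+
    then obtain x where x: "x \<in> I" "x \<noteq> 0" by blast
    then obtain y where "y \<in> B" "infinite_idempotent RB (x * y)"
      using infinite_idempotent_in_ideal[OF _ _ c] R I(1) by blast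
    then show "\<exists>e\<in>I. infinite_idempotent RB e" using I(3) x(1) by blast
  qed
qed

end

section \<open>The main theorem\<close>

theorem corollary5p10:
  fixes E :: "('v, 'e) pre_digraph"
  assumes "wf_digraph E"
  shows
    "((graded_simple (leavitt_path_algebra TYPE('k::field) E) (lpa_component TYPE('k) E)
        \<longleftrightarrow> simple_gamma_monoid (graph_monoid E)) \<and>
      (simple_gamma_monoid (graph_monoid E)
        \<longleftrightarrow> simple_ordered_gamma_group (graph_group E))) \<and>
     ((simple_ring (leavitt_path_algebra TYPE('k) E)
        \<longleftrightarrow> simple_gamma_monoid (graph_monoid E) \<and>
            \<not> (\<exists>a\<in>carrier (graph_monoid E). a \<noteq> \<one>\<^bsub>graph_monoid E\<^esub> \<and> periodic (graph_monoid E) a)) \<and>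
      (simple_ring (leavitt_path_algebra TYPE('k) E)
        \<longleftrightarrow> simple_gamma_monoid (graph_monoid E) \<and>
            (\<forall>a\<in>carrier (graph_monoid E). a \<noteq> \<one>\<^bsub>graph_monoid E\<^esub> \<and> comparable (graph_monoid E) a
               \<longrightarrow> aperiodic (graph_monoid E) a))) \<and>
     (purely_infinite_simple (leavitt_path_algebra TYPE('k) E)
        \<longleftrightarrow> simple_gamma_monoid (graph_monoid E) \<and>
            \<not> (\<exists>a\<in>carrier (graph_monoid E). a \<noteq> \<one>\<^bsub>graph_monoid E\<^esub> \<and> periodic (graph_monoid E) a) \<and>
            (\<exists>a\<in>carrier (graph_monoid E). aperiodic (graph_monoid E) a))"
proof -
  interpret wf_digraph E by fact
  interpret M: cancel_gamma_monoid "graph_monoid E" by (rule cancel_gamma_monoid_MM)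
  obtain \<phi> :: "(('v, 'e) lword \<Rightarrow>\<^sub>0 'k) \<Rightarrow> (('v, 'e) lword \<Rightarrow>\<^sub>0 'k) add_endo" and sc where "univ_rep E \<phi> sc"
    using univ_rep_exists by blast
  then interpret U: univ_rep E \<phi> sc .
  \<comment> \<open>A closed walk without exit gives only a periodic vertex, so the equivalence is
    stated for graphs in which every closed walk has an exit.\<close>
  have P: "(\<exists>a\<in>carrier (graph_monoid E). aperiodic (graph_monoid E) a) \<longleftrightarrow> has_closed_walk E" if "condition_L E"
    using that closed_walk_if_aperiodic aperiodic_if_closed_walk by blast
  show ?thesis
    using U.graded_simple_LL_iff U.graded_simple_iff simple_monoid_iff M.simple_group_iff
      U.simple_LL_iff U.simple_ring_iff no_periodic_iff M.no_periodic_iff_comparable_aperiodic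
      U.pis_LL_iff U.purely_infinite_simple_iff P
    by metis
qed

end
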